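(* Let $X=\{X(t)\}$ be the Markov chain on $\mathbb{R}^\ell$ defined by $X(t+1)=a(X(t),N(t+1))$, and suppose that assumptions (A1)--(A4) (listed in the context) hold. Let $v=e^V$, with $V$ the Lyapunov function of (A4), let $\pi$ be the unique invariant probability measure of the chain, and let $\widetilde P^t := P^t-1\otimes\pi$, i.e. $\widetilde P^t f(x)=P^tf(x)-\pi(f)$. Then for every $\eta\in(0,1]$ there are constants $b_0<\infty$, $t_1<\infty$ and $\varrho_0<1$ such that $$|||\widetilde P^t|||_{v^\eta,1}\le b_0\varrho_0^t,\qquad t\ge t_1 .$$ Consequently, for each $f\in L_\infty^{v^\eta,1}$, every $x\in\mathbb{R}^\ell$ and all $t\ge t_1$, $$\big|\mathsf{E}_x[f(X(t))]-\pi(f)\big|\le b_0\varrho_0^t\|f\|_{v^\eta,1}\,v^\eta(x),$$ and $$\Big|\frac{\partial}{\partial x_i}\mathsf{E}_x[f(X(t))]\Big|\le b_0\varrho_0^t\|f\|_{v^\eta,1}\,v^\eta(x),\qquad 1\le i\le \ell .$$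
   Context: **Model.** The state space is $\mathsf{X}=\mathbb{R}^\ell$ with Borel $\sigma$-field $\mathcal{B}$. The chain is $X(t+1)=a(X(t),N(t+1))$, $t\ge 0$, where $\{N(t)\}$ are i.i.d. $\mathbb{R}^m$-valued random variables and $a:\mathbb{R}^\ell\times\mathbb{R}^m\to\mathbb{R}^\ell$ is continuous. $P^t(x,A)=\Pr\{X(t)\in A\mid X(0)=x\}$, $P=P^1$, $P^tf(x)=\int f(y)P^t(x,dy)=\mathsf{E}_x[f(X(t))]$, and $\mu(f)=\int f\,d\mu$ for a (signed) measure $\mu$. **Assumptions.** (A1) (i) The process $\{N(t)\}$ does not depend on the initial condition $X(0)$. (ii) $a$ is continuously differentiable in its first variable, with $\sup_{x,n}\|\nabla_x a(x,n)\|<\infty$ (any matrix norm), where $[\nabla_x a(x,n)]_{i,j}=\partial a_j(x,n)/\partial x_i$. (A2) For some $t_0\ge1$ there is a continuously differentiable function $p_{t_0}$ on $\mathsf{X}\times\mathsf{X}$ with $P^{t_0}(x,A)=\int_A p_{t_0}(x,y)\,dy$ for all $x\in\mathsf{X}$, $A\in\mathcal{B}$. (A3) There is a state $x_0\in\mathsf{X}$ such that for any $x\in\mathsf{X}$ and any open set $O$ containing $x_0$, $P^t(x,O)>0$ for all $t\ge0$ sufficiently large. (A4) There are functions $V:\mathsf{X}\to(0,\infty)$ and $W:\mathsf{X}\to[1,\infty)$, both continuously differentiable with compact sublevel sets $\{x: F(x)\le r\}$ ($F=V,W$, $r\ge 0$), a compact set $C\subset\mathsf{X}$ and constants $\delta>0$,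 $b<\infty$ such that (DV3) holds: $\log(Pe^V)-V\le-\delta W+b\,\mathbb{I}_C$ on $\mathsf{X}$. Under (A1)--(A4) the chain is known to have a unique invariant probability measure $\pi$ and to be $v$-uniformly ergodic with $v=e^V$ (i.e. there are $b<\infty$, $\rho<1$ with $|P^tf(x)-\pi(f)|\le b\rho^t\|f\|_v v(x)$ for all $f\in L_\infty^v$, $t\ge0$, $x\in\mathsf X$). **Spaces.** For a continuous $w:\mathsf{X}\to[1,\infty)$ (such as $w=v^\eta=e^{\eta V}$): $\|f\|_w=\sup_x|f(x)|/w(x)$; $L_\infty^w=\{f \text{ measurable}:\|f\|_w<\infty\}$; $L_\infty^{w,0}=\{f\in L_\infty^w: f\text{ continuous}\}$ with norm $\|\cdot\|_w$; $L_\infty^{w,1}$ is the space of $f:\mathsf X\to\mathbb{R}$ such that $f,\partial_1f,\dots,\partial_\ell f$ exist and all belong to $L_\infty^{w,0}$, with norm $\|f\|_{w,1}=\max\{\|f\|_w,\|\partial_1f\|_w,\dots,\|\partial_\ell f\|_w\}$. For a linear operator $Z$ on $L_\infty^{w,1}$, $|||Z|||_{w,1}=\sup\{\|Zf\|_{w,1}/\|f\|_{w,1}: f\in L_\infty^{w,1},\|f\|_{w,1}\ne0\}$. *)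

theory Defs
  imports "HOL-Probability.Probability"
begin

section \<open>Differentiability\<close>

definition continuously_differentiable ::
    "('a::real_normed_vector \<Rightarrow> 'b::real_normed_vector) \<Rightarrow> bool" where
  "continuously_differentiable f \<longleftrightarrow>
     (\<exists>D :: 'a \<Rightarrow> 'a \<Rightarrow>\<^sub>L 'b. (\<forall>x. (f has_derivative blinfun_apply (D x)) (at x))
        \<and> continuous_on UNIV D)"

definition has_partial :: "'l::finite \<Rightarrow> (real^'l \<Rightarrow> real) \<Rightarrow> real^'l \<Rightarrow> bool" where
  "has_partial i f x \<longleftrightarrow> (\<lambda>s::real. f (x + s *\<^sub>R axis i 1)) field_differentiable (at 0)"

definition partial :: "'l::finite \<Rightarrow> (real^'l \<Rightarrow> real) \<Rightarrow> real^'l \<Rightarrow> real" where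
  "partial i f x = deriv (\<lambda>s::real. f (x + s *\<^sub>R axis i 1)) 0"

text \<open>The entry in row \<open>i\<close> and column \<open>j\<close> is the \<open>i\<close>-th partial derivative of the \<open>j\<close>-th
  component, i.e. this is the transpose of the usual Jacobian matrix.\<close>

definition grad_fst :: "(real^'l::finite \<Rightarrow> 'n \<Rightarrow> real^'l) \<Rightarrow> real^'l \<Rightarrow> 'n \<Rightarrow> real^'l^'l" where
  "grad_fst a x n = (\<chi> i j. partial i (\<lambda>z. a z n $ j) x)"

section \<open>Weighted function spaces\<close>

text \<open>The norms are extended-real valued, so that an unbounded supremum is \<open>\<infinity>\<close>.\<close>

definition wnorm :: "('a \<Rightarrow> real) \<Rightarrow> ('a \<Rightarrow> real) \<Rightarrow> ereal" where
  "wnorm w f = (SUP x. ereal (\<bar>f x\<bar> / w x))"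

definition Linf :: "('a::topological_space \<Rightarrow> real) \<Rightarrow> ('a \<Rightarrow> real) set" where
  "Linf w = {f \<in> borel_measurable borel. wnorm w f < \<infinity>}"

definition Linf0 :: "('a::topological_space \<Rightarrow> real) \<Rightarrow> ('a \<Rightarrow> real) set" where
  "Linf0 w = {f \<in> Linf w. continuous_on UNIV f}"

definition Linf1 :: "(real^'l::finite \<Rightarrow> real) \<Rightarrow> (real^'l \<Rightarrow> real) set" where
  "Linf1 w = {f \<in> Linf0 w. \<forall>i. (\<forall>x. has_partial i f x) \<and> partial i f \<in> Linf0 w}"

definition wnorm1 :: "(real^'l::finite \<Rightarrow> real) \<Rightarrow> (real^'l \<Rightarrow> real) \<Rightarrow> ereal" where
  "wnorm1 w f = Max (insert (wnorm w f) (range (\<lambda>i. wnorm w (partial i f))))"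

text \<open>Only meaningful for operators that map \<^term>\<open>Linf1 w\<close> into itself, since
  \<^const>\<open>partial\<close> is unspecified where a partial derivative does not exist.\<close>

definition opnorm1 ::
    "(real^'l::finite \<Rightarrow> real) \<Rightarrow> ((real^'l \<Rightarrow> real) \<Rightarrow> (real^'l \<Rightarrow> real)) \<Rightarrow> ereal" where
  "opnorm1 w Z = (SUP f \<in> {f \<in> Linf1 w. wnorm1 w f \<noteq> 0}. wnorm1 w (Z f) / wnorm1 w f)"

section \<open>The Markov chain\<close>

text \<open>\<open>Pr x\<close> is the law of the whole system (noise and chain) given \<open>X(0) = x\<close>.\<close>

definition chain_model ::
    "(real^'l::finite \<Rightarrow> 'w measure) \<Rightarrow> (real^'l \<Rightarrow> real^'m::finite \<Rightarrow> real^'l)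
      \<Rightarrow> (nat \<Rightarrow> 'w \<Rightarrow> real^'m) \<Rightarrow> (nat \<Rightarrow> 'w \<Rightarrow> real^'l) \<Rightarrow> bool" where
  "chain_model Pr a N X \<longleftrightarrow>
     continuous_on UNIV (\<lambda>(x, n). a x n) \<and>
     (\<forall>x. prob_space (Pr x)
        \<and> prob_space.indep_vars (Pr x) (\<lambda>_. borel) N {1..}
        \<and> (\<forall>s\<ge>1. \<forall>t\<ge>1. distr (Pr x) borel (N s) = distr (Pr x) borel (N t))
        \<and> (\<forall>t. X t \<in> borel_measurable (Pr x))
        \<and> (AE \<omega> in Pr x. X 0 \<omega> = x)
        \<and> (\<forall>t. \<forall>\<omega>\<in>space (Pr x). X (Suc t) \<omega> = a (X t \<omega>) (N (Suc t) \<omega>)))"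

definition Pt :: "('x::topological_space \<Rightarrow> 'w measure) \<Rightarrow> (nat \<Rightarrow> 'w \<Rightarrow> 'x) \<Rightarrow> nat \<Rightarrow> 'x \<Rightarrow> 'x measure" where
  "Pt Pr X t x = distr (Pr x) borel (X t)"

definition Pt_op ::
    "('x::topological_space \<Rightarrow> 'w measure) \<Rightarrow> (nat \<Rightarrow> 'w \<Rightarrow> 'x) \<Rightarrow> nat \<Rightarrow> ('x \<Rightarrow> real) \<Rightarrow> 'x \<Rightarrow> real" where
  "Pt_op Pr X t f x = (\<integral>y. f y \<partial>Pt Pr X t x)"

definition Pt_centered ::
    "('x::topological_space \<Rightarrow> 'w measure) \<Rightarrow> (nat \<Rightarrow> 'w \<Rightarrow> 'x) \<Rightarrow> 'x measure
      \<Rightarrow> nat \<Rightarrow> ('x \<Rightarrow> real) \<Rightarrow> 'x \<Rightarrow> real" where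
  "Pt_centered Pr X \<pi> t f x = Pt_op Pr X t f x - (\<integral>y. f y \<partial>\<pi>)"

definition invariant_prob ::
    "('x::topological_space \<Rightarrow> 'w measure) \<Rightarrow> (nat \<Rightarrow> 'w \<Rightarrow> 'x) \<Rightarrow> 'x measure \<Rightarrow> bool" where
  "invariant_prob Pr X \<pi> \<longleftrightarrow> prob_space \<pi> \<and> sets \<pi> = sets borel \<and>
     (\<forall>A\<in>sets borel. emeasure \<pi> A = (\<integral>\<^sup>+x. emeasure (Pt Pr X 1 x) A \<partial>\<pi>))"

section \<open>The standing assumptions\<close>

text \<open>First conjunct: the law of the noise process is the same for every initial condition.
  Continuity of the derivative is in \<open>x\<close> only, separately for each \<open>n\<close>.\<close>

definition assumption_A1 ::
    "(real^'l::finite \<Rightarrow> 'w measure) \<Rightarrow> (real^'l \<Rightarrow> real^'m::finite \<Rightarrow> real^'l)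
      \<Rightarrow> (nat \<Rightarrow> 'w \<Rightarrow> real^'m) \<Rightarrow> bool" where
  "assumption_A1 Pr a N \<longleftrightarrow>
     (\<forall>x y. distr (Pr x) (PiM {1..} (\<lambda>_. borel)) (\<lambda>\<omega>. \<lambda>t\<in>{1..}. N t \<omega>)
          = distr (Pr y) (PiM {1..} (\<lambda>_. borel)) (\<lambda>\<omega>. \<lambda>t\<in>{1..}. N t \<omega>)) \<and>
     (\<forall>n. continuously_differentiable (\<lambda>x. a x n)) \<and>
     bdd_above (range (\<lambda>(x, n). norm (grad_fst a x n)))"

text \<open>The case \<open>A = UNIV\<close> forces \<open>p (x, _)\<close> to be integrable, since the left-hand side is
  then 1.\<close>

definition assumption_A2 ::
    "(real^'l::finite \<Rightarrow> 'w measure) \<Rightarrow> (nat \<Rightarrow> 'w \<Rightarrow> real^'l) \<Rightarrow> bool" where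
  "assumption_A2 Pr X \<longleftrightarrow>
     (\<exists>t0\<ge>1. \<exists>p :: (real^'l) \<times> (real^'l) \<Rightarrow> real. continuously_differentiable p \<and>
        (\<forall>x. \<forall>A\<in>sets borel. measure (Pt Pr X t0 x) A = (LINT y:A|lborel. p (x, y))))"

definition assumption_A3 ::
    "(real^'l::finite \<Rightarrow> 'w measure) \<Rightarrow> (nat \<Rightarrow> 'w \<Rightarrow> real^'l) \<Rightarrow> bool" where
  "assumption_A3 Pr X \<longleftrightarrow>
     (\<exists>x0. \<forall>x U. open U \<longrightarrow> x0 \<in> U \<longrightarrow> (\<forall>\<^sub>F t in sequentially. measure (Pt Pr X t x) U > 0))"

definition DV3 ::
    "(real^'l::finite \<Rightarrow> 'w measure) \<Rightarrow> (nat \<Rightarrow> 'w \<Rightarrow> real^'l) \<Rightarrow> (real^'l \<Rightarrow> real)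
      \<Rightarrow> (real^'l \<Rightarrow> real) \<Rightarrow> (real^'l) set \<Rightarrow> real \<Rightarrow> real \<Rightarrow> bool" where
  "DV3 Pr X V W C \<delta> b \<longleftrightarrow>
     (\<forall>x. integrable (Pt Pr X 1 x) (\<lambda>y. exp (V y)) \<and>
        ln (Pt_op Pr X 1 (\<lambda>y. exp (V y)) x) - V x \<le> - \<delta> * W x + b * indicator C x)"

definition assumption_A4 ::
    "(real^'l::finite \<Rightarrow> 'w measure) \<Rightarrow> (nat \<Rightarrow> 'w \<Rightarrow> real^'l) \<Rightarrow> (real^'l \<Rightarrow> real) \<Rightarrow> bool" where
  "assumption_A4 Pr X V \<longleftrightarrow>
     (\<exists>W C \<delta> b.
        (\<forall>x. V x > 0) \<and> (\<forall>x. W x \<ge> 1) \<and>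
        continuously_differentiable V \<and> continuously_differentiable W \<and>
        (\<forall>r\<ge>0. compact {x. V x \<le> r}) \<and> (\<forall>r\<ge>0. compact {x. W x \<le> r}) \<and>
        compact C \<and> \<delta> > 0 \<and> DV3 Pr X V W C \<delta> b)"

end

(* The noise realises the chain as a random C^1 flow F t x omega with Jacobian at most K^t, and
   (DV3) with Jensen's inequality gives P w <= B kappa w for w = v^eta, where kappa tends to 0 at
   infinity. In the norm ||.||_w, geometric ergodicity follows by the argument of Hairer and Mattingly:
   far out the drift contracts the weighted oscillation, and on compact sets the laws started from any
   two points overlap after a common time. (The overlap holds locally for pairs by (A2) and (A3) and it
   persists in time, so compactness of the set of pairs gives a common time.)
   For gradients, a Lasota-Yorke inequality ||grad P^n g||_w <= ||grad g||_w / 2 + C ||g||_w with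
   n = 2 t0 + 1 holds. Iterating it on P^k f - pi(f), whose w-norm decays geometrically, gives the decay
   of the gradients. *)

theory Submission
  imports Defs
begin

section \<open>Partial derivatives\<close>

text \<open>The obstacle is the weight. Each noise path is differentiable in its starting point, but
  no integrable majorant of \<open>w (F t x \<omega>)\<close> that is uniform over nearby
  \<open>x\<close> is at hand, so dominated convergence yields neither continuity of
  \<open>P t w\<close> nor differentiation under the expectation. Two devices replace it. Increments
  along a path are bounded by averages over the segment between the starting points, whose
  expectations are segment averages of \<open>P t w\<close> by Fubini. Convergence is then obtained
  with majorants that vary, provided that their expectations converge, which holds as soon as
  \<open>P t w\<close> is continuous. The length 2 t0 + 1 of a block adds two stages: after t0 + 1
  steps the function is C^1, and t0 further steps let the density absorb the derivative. The
  Jacobian bound \<open>K ^ t\<close> may grow with \<open>t\<close>. This is harmless, since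
  contraction is needed over one fixed block only, where \<open>\<kappa>\<close> far out beats any
  constant.\<close>

lemma continuously_differentiable_continuous:
  "continuously_differentiable f \<Longrightarrow> continuous_on UNIV f"
  unfolding continuously_differentiable_def
  by (meson continuous_at_imp_continuous_on has_derivative_continuous)

text \<open>This is the differential part of membership in \<open>Linf1\<close>, without weights. It
  is phrased through single partial derivatives because the norms are; Frechet differentiability is
  recovered below.\<close>

definition C1_partials :: "(real^'l::finite \<Rightarrow> real) \<Rightarrow> bool" where
  "C1_partials f \<longleftrightarrow> (\<forall>i. (\<forall>x. has_partial i f x) \<and> continuous_on UNIV (partial i f))"

lemma has_partialI:
  assumes "((\<lambda>s. f (x + s *\<^sub>R axis i 1)) has_real_derivative d) (at 0)"
  shows "has_partial i f x" "partial i f x = d"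
  using assms by (auto simp: has_partial_def partial_def field_differentiable_def DERIV_imp_deriv)

lemma has_partial_DERIV:
  assumes "has_partial i f (x + s *\<^sub>R axis i 1)"
  shows "((\<lambda>s. f (x + s *\<^sub>R axis i 1)) has_real_derivative partial i f (x + s *\<^sub>R axis i 1)) (at s)"
proof -
  have "((\<lambda>u. f ((x + s *\<^sub>R axis i 1) + u *\<^sub>R axis i 1)) has_real_derivative partial i f (x + s *\<^sub>R axis i 1)) (at 0)"
    using assms unfolding has_partial_def partial_def by (simp add: DERIV_deriv_iff_field_differentiable)
  then have "((\<lambda>u. f (x + (s + u) *\<^sub>R axis i 1)) has_real_derivative partial i f (x + s *\<^sub>R axis i 1)) (at 0)"
    by (simp add: scaleR_add_left add.assoc)
  then show ?thesis
    using DERIV_at_within_shift[of "\<lambda>s. f (x + s *\<^sub>R axis i 1)" "partial i f (x + s *\<^sub>R axis i 1)" s 0 UNIV]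
    by simp
qed

text \<open>The segment is parametrised over [0, 1] with increment \<open>\<theta> * h\<close>, so
  that positive, negative and zero \<open>h\<close> are treated alike.\<close>

lemma partial_mvt:
  assumes "\<And>x. has_partial i f x"
  shows "\<exists>\<theta>\<in>{0..1}. f (x + h *\<^sub>R axis i 1) - f x = h * partial i f (x + (\<theta> * h) *\<^sub>R axis i 1)"
proof -
  have "((\<lambda>\<theta>. f (x + (\<theta> * h) *\<^sub>R axis i 1)) has_real_derivative
          partial i f (x + (\<theta> * h) *\<^sub>R axis i 1) * h) (at \<theta>)" for \<theta>
    by (rule DERIV_chain'[of "\<lambda>\<theta>. \<theta> * h" h \<theta> UNIV "\<lambda>s. f (x + s *\<^sub>R axis i 1)", simplified mult.commute])
      (auto intro!: derivative_eq_intros has_partial_DERIV assms simp: mult.commute)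
  then have "\<exists>z. 0 < z \<and> z < 1 \<and> f (x + (1 * h) *\<^sub>R axis i 1) - f (x + (0 * h) *\<^sub>R axis i 1)
      = (1 - 0) * (partial i f (x + (z * h) *\<^sub>R axis i 1) * h)"
    by (intro MVT2) auto
  then show ?thesis by (auto simp: mult.commute intro: less_imp_le)
qed

text \<open>The increment from \<open>x\<close> to \<open>y\<close> is made one coordinate at a
  time. The mean value theorem evaluates each partial derivative at an intermediate point that is no
  further from \<open>x\<close> than \<open>y\<close> is, where continuity bounds its change by
  \<open>e'\<close>.\<close>

lemma C1_partials_has_derivative:
  fixes f :: "real^'l::finite \<Rightarrow> real"
  assumes "C1_partials f"
  shows "(f has_derivative (\<lambda>h. \<Sum>j\<in>UNIV. h $ j * partial j f x)) (at x)"
  unfolding has_derivative_at_alt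
proof (intro conjI allI impI)
  have "linear (\<lambda>h. \<Sum>j\<in>UNIV. h $ j * partial j f x)"
    by (rule linearI) (auto simp: algebra_simps sum.distrib sum_distrib_left)
  then show "bounded_linear (\<lambda>h. \<Sum>j\<in>UNIV. h $ j * partial j f x)"
    by (simp add: linear_conv_bounded_linear)
  fix e :: real assume e: "0 < e"
  \<comment> \<open>Each of the \<open>CARD('l)\<close> coordinates contributes an error of at most
    \<open>e' * norm h\<close>.\<close>
  define e' where "e' = e / CARD('l)"
  have e': "0 < e'" using e by (simp add: e'_def)
  have "\<exists>d>0. \<forall>y. norm (y - x) < d \<longrightarrow> \<bar>partial j f y - partial j f x\<bar> < e'" for j
  proof -
    have "isCont (partial j f) x"
      using assms by (simp add: C1_partials_def continuous_on_eq_continuous_at)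
    then show ?thesis using e' unfolding continuous_at_eps_delta by (auto simp: dist_norm)
  qed
  then obtain d where d: "\<And>j. d j > 0"
      "\<And>j y. norm (y - x) < d j \<Longrightarrow> \<bar>partial j f y - partial j f x\<bar> < e'"
    by metis
  define \<delta> where "\<delta> = Min (range d)"
  have \<delta>: "\<delta> > 0" "\<And>j. \<delta> \<le> d j" using d by (auto simp: \<delta>_def)
  show "\<exists>\<delta>>0. \<forall>y. norm (y - x) < \<delta> \<longrightarrow>
     norm (f y - f x - (\<Sum>j\<in>UNIV. (y - x) $ j * partial j f x)) \<le> e * norm (y - x)"
  proof (intro exI[of _ \<delta>] conjI allI impI \<delta>)
    fix y assume y: "norm (y - x) < \<delta>"
    define h where "h = y - x"
    \<comment> \<open>\<open>hS S\<close> keeps the coordinates of the increment that lie in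
      \<open>S\<close>; enlarging \<open>S\<close> moves from \<open>x\<close> to
      \<open>x + h\<close> parallel to the axes.\<close>
    define hS where "hS S = (\<chi> j. if j \<in> S then h $ j else 0)" for S
    have "norm (f (x + hS S) - f x - (\<Sum>j\<in>S. h $ j * partial j f x)) \<le> card S * (e' * norm h)"
      if "finite S" for S
      using that
    proof (induction S rule: finite_induct)
      case empty
      have "hS {} = 0" by (simp add: hS_def vec_eq_iff)
      then show ?case by simp
    next
      case (insert i S)
      have eq: "hS (insert i S) = hS S + h $ i *\<^sub>R axis i 1"
        using insert.hyps by (auto simp: hS_def vec_eq_iff axis_def)
      obtain \<theta> where \<theta>: "\<theta> \<in> {0..1}"
        "f (x + hS S + h $ i *\<^sub>R axis i 1) - f (x + hS S)
          = h $ i * partial i f (x + hS S + (\<theta> * h $ i) *\<^sub>R axis i 1)"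
        using partial_mvt[of i f "x + hS S" "h $ i"] assms unfolding C1_partials_def by auto
      let ?z = "x + hS S + (\<theta> * h $ i) *\<^sub>R axis i 1"
      have "norm (hS S + (\<theta> * h $ i) *\<^sub>R axis i 1) \<le> norm h"
      proof (rule norm_le_componentwise_cart)
        fix j
        have "\<bar>\<theta> * h $ i\<bar> \<le> \<bar>h $ i\<bar>" using \<theta>(1) by (simp add: abs_mult mult_left_le_one_le)
        then show "norm ((hS S + (\<theta> * h $ i) *\<^sub>R axis i 1) $ j) \<le> norm (h $ j)"
          using insert.hyps by (auto simp: hS_def axis_def)
      qed
      then have "norm (?z - x) < d i" using y \<delta>(2)[of i] by (simp add: h_def add.assoc)
      then have "\<bar>partial i f ?z - partial i f x\<bar> < e'" by (rule d)
      then have 1: "\<bar>h $ i * (partial i f ?z - partial i f x)\<bar> \<le> e' * norm h"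
        unfolding abs_mult using component_le_norm_cart[of h i] e'
        by (subst mult.commute) (intro mult_mono, auto)
      have "f (x + hS (insert i S)) - f x - (\<Sum>j\<in>insert i S. h $ j * partial j f x)
          = (f (x + hS S) - f x - (\<Sum>j\<in>S. h $ j * partial j f x))
            + h $ i * (partial i f ?z - partial i f x)"
        using insert.hyps \<theta>(2) by (simp add: eq algebra_simps)
      also have "norm \<dots> \<le> card S * (e' * norm h) + e' * norm h"
        using insert.IH 1 by (intro norm_triangle_le add_mono) auto
      also have "\<dots> = card (insert i S) * (e' * norm h)"
        using insert.hyps by (simp add: algebra_simps)
      finally show ?case .
    qed
    from this[of UNIV] have "norm (f (x + h) - f x - (\<Sum>j\<in>UNIV. h $ j * partial j f x))
        \<le> CARD('l) * (e' * norm h)" by (simp add: hS_def)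
    then show "norm (f y - f x - (\<Sum>j\<in>UNIV. (y - x) $ j * partial j f x)) \<le> e * norm (y - x)"
      by (simp add: h_def e'_def)
  qed
qed

lemma C1_partials_continuous:
  assumes "C1_partials f"
  shows "continuous_on UNIV f"
  using C1_partials_has_derivative[OF assms]
  by (meson continuous_at_imp_continuous_on has_derivative_continuous)

lemma has_derivative_imp_partial:
  fixes f :: "real^'l::finite \<Rightarrow> real"
  assumes "(f has_derivative D) (at x)"
  shows "has_partial i f x" "partial i f x = D (axis i 1)"
proof -
  interpret D: bounded_linear D using assms by (rule has_derivative_bounded_linear)
  have "((\<lambda>s. x + s *\<^sub>R axis i (1::real)) has_derivative (\<lambda>s. s *\<^sub>R axis i 1)) (at 0)"
    by (auto intro!: derivative_eq_intros)
  from diff_chain_at[OF this, of f D] assms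
  have "((\<lambda>s. f (x + s *\<^sub>R axis i 1)) has_derivative (\<lambda>s. D (s *\<^sub>R axis i 1))) (at 0)"
    by (simp add: o_def)
  then have "((\<lambda>s. f (x + s *\<^sub>R axis i 1)) has_real_derivative D (axis i 1)) (at 0)"
    by (simp add: has_field_derivative_def D.scaleR mult_commute_abs)
  then show "has_partial i f x" "partial i f x = D (axis i 1)"
    by (rule has_partialI)+
qed

text \<open>The bound stands under the quantifier that supplies the derivative, so that composing
  maps multiplies the constants; the flow then inherits \<open>K ^ t\<close>.\<close>

definition C1_bound :: "real \<Rightarrow> ('a::real_normed_vector \<Rightarrow> 'b::real_normed_vector) \<Rightarrow> bool" where
  "C1_bound L f \<longleftrightarrow> (\<exists>D :: 'a \<Rightarrow> 'a \<Rightarrow>\<^sub>L 'b. (\<forall>x. (f has_derivative blinfun_apply (D x)) (at x))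
        \<and> continuous_on UNIV D \<and> (\<forall>x. norm (D x) \<le> L))"

lemma C1_bound_continuous: "C1_bound L f \<Longrightarrow> continuous_on UNIV f"
  unfolding C1_bound_def by (meson continuous_at_imp_continuous_on has_derivative_continuous)

lemma C1_bound_id: "C1_bound 1 (\<lambda>x. x)"
  unfolding C1_bound_def
  by (intro exI[of _ "\<lambda>_. id_blinfun"]) (auto simp: norm_blinfun_id_le)

lemma C1_bound_compose:
  assumes f: "C1_bound L f" and g: "C1_bound L' g"
  shows "C1_bound (L' * L) (\<lambda>x. g (f x))"
proof -
  obtain D where D: "\<And>x. (f has_derivative blinfun_apply (D x)) (at x)"
      "continuous_on UNIV D" "\<And>x. norm (D x) \<le> L"
    using f unfolding C1_bound_def by blast
  obtain E where E: "\<And>x. (g has_derivative blinfun_apply (E x)) (at x)"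
      "continuous_on UNIV E" "\<And>x. norm (E x) \<le> L'"
    using g unfolding C1_bound_def by blast
  show ?thesis unfolding C1_bound_def
  proof (intro exI[of _ "\<lambda>x. E (f x) o\<^sub>L D x"] conjI allI)
    fix x
    show "((\<lambda>x. g (f x)) has_derivative blinfun_apply (E (f x) o\<^sub>L D x)) (at x)"
      using diff_chain_at[OF D(1) E(1)[of "f x"]] by (simp add: o_def blinfun_compose.rep_eq)
    have "0 \<le> L'" using E(3)[of undefined] norm_ge_zero order_trans by blast
    then have "norm (E (f x)) * norm (D x) \<le> L' * L"
      by (intro mult_mono D E) auto
    then show "norm (E (f x) o\<^sub>L D x) \<le> L' * L"
      using norm_blinfun_compose order_trans by blast
  next
    have "continuous_on UNIV (\<lambda>x. E (f x))"
      using continuous_on_compose2[OF E(2) C1_bound_continuous[OF f]] by simp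
    then show "continuous_on UNIV (\<lambda>x. E (f x) o\<^sub>L D x)"
      using D(2) by (intro continuous_intros)
  qed
qed

text \<open>By the chain rule the derivative combines the \<open>partial j g (f x)\<close> with
  coefficients the components of \<open>D x (axis i 1)\<close>, each at most the operator norm
  \<open>L\<close>. The sum over \<open>j\<close> is the source of the factor
  \<open>real CARD('l)\<close> in \<open>jac\<close>.\<close>

lemma C1_partials_compose:
  fixes g :: "real^'k::finite \<Rightarrow> real" and f :: "real^'l::finite \<Rightarrow> real^'k"
  assumes g: "C1_partials g" and f: "C1_bound L f"
  shows "C1_partials (\<lambda>x. g (f x))"
    and "\<bar>partial i (\<lambda>x. g (f x)) x\<bar> \<le> L * (\<Sum>j\<in>UNIV. \<bar>partial j g (f x)\<bar>)"
proof -
  obtain D where D: "\<And>x. (f has_derivative blinfun_apply (D x)) (at x)"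
      "continuous_on UNIV D" "\<And>x. norm (D x) \<le> L"
    using f unfolding C1_bound_def by blast
  have der: "((\<lambda>x. g (f x)) has_derivative (\<lambda>h. \<Sum>j\<in>UNIV. (D x h) $ j * partial j g (f x))) (at x)" for x
    using diff_chain_at[OF D(1) C1_partials_has_derivative[OF g], of x] by (simp add: o_def)
  have par: "has_partial i (\<lambda>x. g (f x)) x"
      "partial i (\<lambda>x. g (f x)) x = (\<Sum>j\<in>UNIV. (D x (axis i 1)) $ j * partial j g (f x))" for i x
    using has_derivative_imp_partial[OF der] by blast+
  have "continuous_on UNIV (\<lambda>x. partial j g (f x))" for j
    using g continuous_on_compose2[OF _ C1_bound_continuous[OF f]] unfolding C1_partials_def by blast
  then have "continuous_on UNIV (\<lambda>x. \<Sum>j\<in>UNIV. (D x (axis i 1)) $ j * partial j g (f x))" for i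
    using D(2) by (intro continuous_intros) auto
  then show "C1_partials (\<lambda>x. g (f x))"
    unfolding C1_partials_def par(2)[abs_def] by (intro allI conjI par(1))
  have "\<bar>(D x (axis i 1)) $ j * partial j g (f x)\<bar> \<le> L * \<bar>partial j g (f x)\<bar>" for j
  proof -
    have "\<bar>(D x (axis i 1)) $ j\<bar> \<le> norm (D x (axis i 1))" by (rule component_le_norm_cart)
    also have "\<dots> \<le> norm (D x) * norm (axis i (1::real))" by (rule norm_blinfun)
    also have "\<dots> \<le> L" using D(3) by simp
    finally show ?thesis by (simp add: abs_mult mult_right_mono)
  qed
  then show "\<bar>partial i (\<lambda>x. g (f x)) x\<bar> \<le> L * (\<Sum>j\<in>UNIV. \<bar>partial j g (f x)\<bar>)"
    unfolding par sum_distrib_left by (intro order_trans[OF sum_abs] sum_mono) auto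
qed

text \<open>The vectors in the hypothesis are the images \<open>D x (axis i 1)\<close>, the rows of
  the transposed Jacobian. Expanding a general direction in the standard basis costs the factor
  \<open>real CARD('l)\<close>.\<close>

lemma C1_boundI_partials:
  fixes f :: "real^'l::finite \<Rightarrow> real^'k::finite" and L :: real
  assumes f: "continuously_differentiable f"
    and bound: "\<And>i x. norm (\<chi> j. partial i (\<lambda>z. f z $ j) x) \<le> L"
  shows "C1_bound (real CARD('l) * L) f"
proof -
  obtain D where D: "\<And>x. (f has_derivative blinfun_apply (D x)) (at x)"
      "continuous_on UNIV D"
    using f unfolding continuously_differentiable_def by blast
  have L: "0 \<le> L" using bound norm_ge_zero order_trans by blast
  have "norm (D x) \<le> real CARD('l) * L" for x
  proof (rule norm_blinfun_bound)
    show "0 \<le> real CARD('l) * L" using L by simp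
  next
    fix h :: "real^'l"
    have ax: "norm (D x (axis i 1)) \<le> L" for i
    proof -
      have "((\<lambda>z. f z $ j) has_derivative (\<lambda>h. D x h $ j)) (at x)" for j
        using bounded_linear.has_derivative[OF bounded_linear_vec_nth D(1)] .
      from has_derivative_imp_partial(2)[OF this]
      have "D x (axis i 1) = (\<chi> j. partial i (\<lambda>z. f z $ j) x)"
        by (simp add: vec_eq_iff)
      then show ?thesis using bound[where i=i and x=x] by (simp only:)
    qed
    have "h = (\<Sum>i\<in>UNIV. h $ i *\<^sub>R axis i 1)"
      using basis_expansion[of h] by (simp add: scalar_mult_eq_scaleR)
    then have "D x h = D x (\<Sum>i\<in>UNIV. h $ i *\<^sub>R axis i 1)" by simp
    also have "\<dots> = (\<Sum>i\<in>UNIV. h $ i *\<^sub>R D x (axis i 1))"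
      by (simp only: blinfun.scaleR_right blinfun.sum_right)
    also have "norm \<dots> \<le> (\<Sum>i\<in>(UNIV::'l set). norm h * L)"
      using ax L component_le_norm_cart[of h]
      by (intro order_trans[OF norm_sum] sum_mono) (simp add: mult_mono)
    also have "\<dots> = real CARD('l) * L * norm h" by simp
    finally show "norm (D x h) \<le> real CARD('l) * L * norm h" .
  qed
  then show ?thesis unfolding C1_bound_def by (intro exI[of _ D] conjI allI D)
qed

section \<open>Products, affine images and cutoffs\<close>

lemma C1_partials_mult:
  assumes "C1_partials f" "C1_partials g"
  shows "C1_partials (\<lambda>x. f x * g x)"
    and "partial i (\<lambda>x. f x * g x) x = f x * partial i g x + partial i f x * g x"
proof -
  have "((\<lambda>s. f (x + s *\<^sub>R axis i 1) * g (x + s *\<^sub>R axis i 1)) has_real_derivative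
        f x * partial i g x + partial i f x * g x) (at 0)" for i x
    using DERIV_mult'[OF has_partial_DERIV[of i f x 0] has_partial_DERIV[of i g x 0]] assms
    by (simp add: C1_partials_def)
  note * = has_partialI[OF this]
  show "partial i (\<lambda>x. f x * g x) x = f x * partial i g x + partial i f x * g x" by (rule *)
  have "continuous_on UNIV (\<lambda>x. f x * partial i g x + partial i f x * g x)" for i
    using assms C1_partials_continuous[OF assms(1)] C1_partials_continuous[OF assms(2)]
    unfolding C1_partials_def by (intro continuous_intros) auto
  then show "C1_partials (\<lambda>x. f x * g x)"
    unfolding C1_partials_def *(2)[abs_def] by (intro allI conjI *(1))
qed

text \<open>The affine form covers \<open>1 - cutoff R\<close> with \<open>a = - 1\<close> as well
  as centering by the invariant mean with \<open>a = 1\<close>.\<close>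

lemma C1_partials_affine:
  assumes "C1_partials f"
  shows "C1_partials (\<lambda>x. b + a * f x)"
    and "partial i (\<lambda>x. b + a * f x) x = a * partial i f x"
proof -
  have "((\<lambda>s. b + a * f (x + s *\<^sub>R axis i 1)) has_real_derivative a * partial i f x) (at 0)" for i x
    using has_partial_DERIV[of i f x 0] assms
    by (auto simp: C1_partials_def intro!: derivative_eq_intros)
  note * = has_partialI[OF this]
  show "partial i (\<lambda>x. b + a * f x) x = a * partial i f x" by (rule *)
  have "continuous_on UNIV (\<lambda>x. a * partial i f x)" for i
    using assms by (intro continuous_intros) (auto simp: C1_partials_def)
  then show "C1_partials (\<lambda>x. b + a * f x)"
    unfolding C1_partials_def *(2)[abs_def] by (intro allI conjI *(1))
qed

text \<open>The bound \<open>q\<close> may vary with the increment, as segment averages do; only its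
  limit survives. Gradient estimates thus need difference quotients rather than a formula for the
  derivative.\<close>

lemma partial_le:
  assumes "has_partial i G x"
    and "eventually (\<lambda>r. \<bar>G (x + r *\<^sub>R axis i 1) - G x\<bar> \<le> \<bar>r\<bar> * q r) (at 0)"
    and "(q \<longlongrightarrow> L) (at 0)"
  shows "\<bar>partial i G x\<bar> \<le> L"
proof -
  have "((\<lambda>r. \<bar>(G (x + r *\<^sub>R axis i 1) - G x) / r\<bar>) \<longlongrightarrow> \<bar>partial i G x\<bar>) (at 0)"
    using has_partial_DERIV[of i G x 0] assms(1) by (intro tendsto_rabs) (simp add: DERIV_def)
  moreover have "eventually (\<lambda>r. \<bar>(G (x + r *\<^sub>R axis i 1) - G x) / r\<bar> \<le> q r) (at 0)"
    using assms(2) unfolding eventually_at_filter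
    by (rule eventually_mono) (auto simp: abs_divide divide_le_eq mult.commute)
  ultimately show ?thesis
    using assms(3) tendsto_le[OF at_neq_bot] by blast
qed

text \<open>For positive \<open>R\<close>, squaring the positive part of a paraboloid gives a
  compactly supported C^1 function with gradient of order \<open>1 / R\<close>. It equals 1 only at
  the origin; in place of a plateau, \<open>1 - cutoff R x\<close> is of order
  \<open>(norm x)\<^sup>2 / R\<^sup>2\<close>.\<close>

definition cutoff :: "real \<Rightarrow> real^'l::finite \<Rightarrow> real" where
  "cutoff R x = (max 0 (1 - (x \<bullet> x) / R\<^sup>2))\<^sup>2"

lemma DERIV_max0_square:
  "((\<lambda>s::real. (max 0 s)\<^sup>2) has_real_derivative 2 * max 0 s) (at s)"
proof (cases "s = 0")
  case True
  have "((\<lambda>h. (max 0 h)\<^sup>2 / h) \<longlongrightarrow> 0) (at (0::real))"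
  proof (rule Lim_null_comparison)
    show "eventually (\<lambda>h. norm ((max 0 h)\<^sup>2 / h) \<le> \<bar>h\<bar>) (at (0::real))"
      by (auto simp: max_def power2_eq_square intro!: always_eventually)
    show "((\<lambda>h::real. \<bar>h\<bar>) \<longlongrightarrow> 0) (at 0)" by (intro tendsto_rabs_zero tendsto_ident_at)
  qed
  then show ?thesis using True by (simp add: DERIV_def)
next
  case False
  then consider "s < 0" | "s > 0" by linarith
  then show ?thesis
  proof cases
    case 1
    have "((\<lambda>s::real. 0) has_real_derivative 0) (at s)" by simp
    moreover have "eventually (\<lambda>s::real. 0 = (max 0 s)\<^sup>2) (nhds s)"
      using 1 eventually_nhds_in_open[of "{..<0}" s] by (auto elim!: eventually_mono)
    ultimately show ?thesis using 1 by (subst (asm) DERIV_cong_ev[OF refl _ refl]) auto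
  next
    case 2
    have "((\<lambda>s::real. s\<^sup>2) has_real_derivative 2 * s) (at s)"
      by (auto intro!: derivative_eq_intros)
    moreover have "eventually (\<lambda>s::real. s\<^sup>2 = (max 0 s)\<^sup>2) (nhds s)"
      using 2 eventually_nhds_in_open[of "{0<..}" s] by (auto elim!: eventually_mono)
    ultimately show ?thesis using 2 by (subst (asm) DERIV_cong_ev[OF refl _ refl]) auto
  qed
qed

lemma cutoff_props:
  fixes x :: "real^'l::finite"
  assumes R: "R > 0"
  shows "C1_partials (cutoff R :: real^'l::finite \<Rightarrow> real)"
    and "0 \<le> cutoff R x" "cutoff R x \<le> 1"
    and "R < norm x \<Longrightarrow> cutoff R x = 0"
    and "1 - cutoff R x \<le> 2 * (norm x)\<^sup>2 / R\<^sup>2"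
    and "\<bar>partial i (cutoff R) x\<bar> \<le> 4 / R"
proof -
  have [simp]: "R \<noteq> 0" using R by simp
  let ?m = "\<lambda>x::real^'l. max 0 (1 - (x \<bullet> x) / R\<^sup>2)"
  have "((\<lambda>s. (max 0 (1 - (x + s *\<^sub>R axis i 1) \<bullet> (x + s *\<^sub>R axis i 1) / R\<^sup>2))\<^sup>2)
      has_real_derivative 2 * ?m x * (- (2 * x $ i) / R\<^sup>2)) (at 0)" for x :: "real^'l" and i
  proof -
    have "((\<lambda>s. 1 - (x \<bullet> x + 2 * s * x $ i + s\<^sup>2) / R\<^sup>2) has_real_derivative - (2 * x $ i) / R\<^sup>2) (at 0)"
      by (auto intro!: derivative_eq_intros simp: power2_eq_square field_simps)
    also have "(\<lambda>s. 1 - (x \<bullet> x + 2 * s * x $ i + s\<^sup>2) / R\<^sup>2)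
        = (\<lambda>s. 1 - (x + s *\<^sub>R axis i 1) \<bullet> (x + s *\<^sub>R axis i 1) / R\<^sup>2)"
      by (simp add: inner_add inner_axis inner_axis' power2_eq_square algebra_simps)
    finally show ?thesis
      using DERIV_chain'[OF _ DERIV_max0_square, of "\<lambda>s. 1 - (x + s *\<^sub>R axis i 1) \<bullet> (x + s *\<^sub>R axis i 1) / R\<^sup>2"]
      by fastforce
  qed
  note * = has_partialI[of "cutoff R", unfolded cutoff_def, OF this, folded cutoff_def]
  show "C1_partials (cutoff R :: real^'l::finite \<Rightarrow> real)"
    unfolding C1_partials_def *(2)[abs_def]
    by (intro allI conjI *(1) continuous_intros) auto
  show "0 \<le> cutoff R x" by (simp add: cutoff_def)
  have m1: "?m x \<le> 1" "0 \<le> ?m x" using R by auto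
  then show "cutoff R x \<le> 1" by (simp add: cutoff_def power_le_one)
  show "cutoff R x = 0" if "R < norm x"
  proof -
    have "R\<^sup>2 \<le> (norm x)\<^sup>2" using that R by (intro power_mono) auto
    then show ?thesis using R by (simp add: cutoff_def dot_square_norm max_def)
  qed
  have "1 - (?m x)\<^sup>2 = (1 - ?m x) * (1 + ?m x)" by (simp add: power2_eq_square algebra_simps)
  also have "\<dots> \<le> (1 - ?m x) * 2" using m1 by (intro mult_left_mono) auto
  also have "\<dots> \<le> 2 * (norm x)\<^sup>2 / R\<^sup>2"
    using R by (auto simp: dot_square_norm max_def field_simps)
  finally show "1 - cutoff R x \<le> 2 * (norm x)\<^sup>2 / R\<^sup>2" by (simp add: cutoff_def)
  \<comment> \<open>The gradient is at most 4 times \<open>norm x / R\<^sup>2\<close>, and it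
    vanishes outside the ball of radius \<open>R\<close>, so that \<open>norm x\<close> may be
    replaced by \<open>R\<close>.\<close>
  show "\<bar>partial i (cutoff R) x\<bar> \<le> 4 / R"
  proof (cases "norm x \<le> R")
    case True
    have "\<bar>partial i (cutoff R) x\<bar> = 4 * (?m x * \<bar>x $ i\<bar>) / R\<^sup>2"
      by (simp add: * abs_mult)
    also have "\<dots> \<le> 4 * (1 * R) / R\<^sup>2"
      using m1 component_le_norm_cart[of x i] True
      by (intro divide_right_mono mult_left_mono mult_mono) auto
    also have "\<dots> = 4 / R" by (simp add: power2_eq_square)
    finally show ?thesis .
  next
    case False
    then have "R\<^sup>2 \<le> (norm x)\<^sup>2" using R by (intro power_mono) auto
    then have "?m x = 0" using R by (simp add: dot_square_norm max_def)
    then show ?thesis using R by (simp add: *)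
  qed
qed

section \<open>Weighted bounds for the semigroup\<close>

text \<open>In the application \<open>w = v powr \<eta>\<close>, and \<open>\<kappa> = exp (- \<eta> \<delta> W)\<close> and \<open>B\<close> come from (DV3) by Jensen's
  inequality; \<open>V\<close> and \<open>v\<close> play no further role.\<close>

locale smooth_markov_flow = prob_space M for M :: "'w measure" +
  fixes F :: "nat \<Rightarrow> real^'l::finite \<Rightarrow> 'w \<Rightarrow> real^'l"
    and K B :: real and w \<kappa> :: "real^'l \<Rightarrow> real"
    and t0 :: nat and p :: "(real^'l) \<times> (real^'l) \<Rightarrow> real" and x0 :: "real^'l"
    and \<pi> :: "(real^'l) measure"
  assumes F_measurable: "(\<lambda>(x, \<omega>). F t x \<omega>) \<in> borel_measurable (borel \<Otimes>\<^sub>M M)"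
    and F_0: "\<omega> \<in> space M \<Longrightarrow> F 0 x \<omega> = x"
    and F_C1: "\<omega> \<in> space M \<Longrightarrow> C1_bound (K ^ t) (\<lambda>x. F t x \<omega>)"
    and K_nonneg: "0 \<le> K"
    and markov: "f \<in> borel_measurable borel \<Longrightarrow>
      (\<integral>\<^sup>+\<omega>. f (F (s + t) x \<omega>) \<partial>M) = (\<integral>\<^sup>+\<omega>. (\<integral>\<^sup>+\<omega>'. f (F t (F s x \<omega>) \<omega>') \<partial>M) \<partial>M)"
    and w_ge_1: "1 \<le> w x"
    and w_continuous: "continuous_on UNIV w"
    and w_compact: "compact {x. w x \<le> r}"
    and \<kappa>_continuous: "continuous_on UNIV \<kappa>"
    and \<kappa>_nonneg: "0 \<le> \<kappa> x" and \<kappa>_le_1: "\<kappa> x \<le> 1"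
    and \<kappa>_small: "0 < \<epsilon> \<Longrightarrow> \<exists>r. \<forall>x. r < norm x \<longrightarrow> \<kappa> x \<le> \<epsilon>"
    and B_ge_1: "1 \<le> B"
    and drift: "(\<integral>\<^sup>+\<omega>. w (F 1 x \<omega>) \<partial>M) \<le> ennreal (B * (\<kappa> x * w x))"
    and t0_ge_1: "1 \<le> t0"
    and p_C1: "continuously_differentiable p"
    and p_nonneg: "0 \<le> p z"
    and p_density: "distr M borel (F t0 x) = density lborel (\<lambda>y. ennreal (p (x, y)))"
    and reach: "open U \<Longrightarrow> x0 \<in> U \<Longrightarrow> \<forall>\<^sub>F t in sequentially. 0 < measure M {\<omega> \<in> space M. F t x \<omega> \<in> U}"
    and \<pi>_prob: "prob_space \<pi>" and \<pi>_sets: "sets \<pi> = sets borel"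
    and \<pi>_invariant: "f \<in> borel_measurable borel \<Longrightarrow>
      (\<integral>\<^sup>+x. f x \<partial>\<pi>) = (\<integral>\<^sup>+x. (\<integral>\<^sup>+\<omega>. f (F 1 x \<omega>) \<partial>M) \<partial>\<pi>)"
begin

text \<open>A Bochner integral, with value 0 where \<open>f (F t x \<omega>)\<close> is not
  integrable in \<open>\<omega>\<close>; \<open>wbound\<close> rules this out.\<close>

definition P :: "nat \<Rightarrow> (real^'l \<Rightarrow> real) \<Rightarrow> real^'l \<Rightarrow> real" where
  "P t f x = (\<integral>\<omega>. f (F t x \<omega>) \<partial>M)"

text \<open>A real constant above the weighted norm replaces the extended-real norm, and
  measurability is included so that this one hypothesis justifies integration.\<close>

definition wbound :: "real \<Rightarrow> (real^'l \<Rightarrow> real) \<Rightarrow> bool" where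
  "wbound c f \<longleftrightarrow> f \<in> borel_measurable borel \<and> (\<forall>x. \<bar>f x\<bar> \<le> c * w x)"

lemma w_pos [simp]: "0 < w x" "0 \<le> w x" "w x \<noteq> 0"
  using w_ge_1[of x] by auto

lemma w_borel [measurable]: "w \<in> borel_measurable borel"
  by (rule borel_measurable_continuous_onI[OF w_continuous])

lemma F_measurable1 [measurable]: "F t x \<in> borel_measurable M"
proof -
  have "(\<lambda>\<omega>. (x, \<omega>)) \<in> M \<rightarrow>\<^sub>M borel \<Otimes>\<^sub>M M" by simp
  from measurable_compose[OF this F_measurable[of t]] show ?thesis by simp
qed

lemma F_measurable2 [measurable (raw)]:
  assumes "g \<in> borel_measurable N" "h \<in> N \<rightarrow>\<^sub>M M"
  shows "(\<lambda>z. F t (g z) (h z)) \<in> borel_measurable N"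
  using measurable_compose[OF measurable_Pair[OF assms] F_measurable[of t]] by simp

lemma F_continuous: "\<omega> \<in> space M \<Longrightarrow> continuous_on UNIV (\<lambda>x. F t x \<omega>)"
  using F_C1 by (rule C1_bound_continuous)

section \<open>Calculus of weighted bounds\<close>

lemma wboundD: "wbound c f \<Longrightarrow> f \<in> borel_measurable borel" "wbound c f \<Longrightarrow> \<bar>f x\<bar> \<le> c * w x"
  by (auto simp: wbound_def)

lemma wbound_nonneg: "wbound c f \<Longrightarrow> 0 \<le> c"
  using wboundD(2)[of c f 0] by (metis abs_ge_zero order_trans w_pos(1) zero_le_mult_iff not_less)

lemma wbound_w: "wbound 1 w"
  by (simp add: wbound_def)

lemma wbound_bounded:
  assumes "f \<in> borel_measurable borel" "\<And>x. \<bar>f x\<bar> \<le> c"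
  shows "wbound c f"
proof -
  have "0 \<le> c" using assms(2) abs_ge_zero order_trans by blast
  then show ?thesis using assms mult_left_mono[OF w_ge_1, of c] by (auto simp: wbound_def intro: order_trans)
qed

lemma wbound_mono: "wbound c f \<Longrightarrow> c \<le> d \<Longrightarrow> wbound d f"
  unfolding wbound_def by (meson mult_right_mono order_trans w_pos(2))

lemma wbound_add: "wbound c f \<Longrightarrow> wbound d g \<Longrightarrow> wbound (c + d) (\<lambda>x. f x + g x)"
  unfolding wbound_def by (auto simp: distrib_right intro!: order_trans[OF abs_triangle_ineq] add_mono)

lemma wbound_cmult: "wbound c f \<Longrightarrow> wbound (\<bar>a\<bar> * c) (\<lambda>x. a * f x)"
  unfolding wbound_def by (auto simp: abs_mult mult.assoc intro!: mult_left_mono)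

lemma wbound_const: "wbound \<bar>a\<bar> (\<lambda>x. a)"
  by (rule wbound_bounded) auto

lemma wbound_diff_const: "wbound c f \<Longrightarrow> wbound (c + \<bar>a\<bar>) (\<lambda>x. f x - a)"
  using wbound_add[OF _ wbound_const, of c f "- a"] by simp

text \<open>Nonnegative integrals are used because integrability of
  \<open>w (F t x \<omega>)\<close> is a consequence of this bound. The gain
  \<open>\<kappa> x\<close> is given away here.\<close>

lemma nn_w_le: "(\<integral>\<^sup>+\<omega>. w (F t x \<omega>) \<partial>M) \<le> ennreal (B ^ t * w x)"
proof (induction t arbitrary: x)
  case 0
  have "(\<integral>\<^sup>+\<omega>. w (F 0 x \<omega>) \<partial>M) = (\<integral>\<^sup>+\<omega>. w x \<partial>M)"
    by (intro nn_integral_cong) (simp add: F_0)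
  then show ?case by (simp add: emeasure_space_1)
next
  case (Suc t)
  have "(\<integral>\<^sup>+\<omega>. w (F (Suc t) x \<omega>) \<partial>M) = (\<integral>\<^sup>+\<omega>. (\<integral>\<^sup>+\<omega>'. w (F t (F 1 x \<omega>) \<omega>') \<partial>M) \<partial>M)"
    using markov[of "\<lambda>x. ennreal (w x)" 1 t x] by simp
  also have "\<dots> \<le> (\<integral>\<^sup>+\<omega>. ennreal (B ^ t) * w (F 1 x \<omega>) \<partial>M)"
    using Suc.IH B_ge_1 by (intro nn_integral_mono) (simp add: ennreal_mult)
  also have "\<dots> = ennreal (B ^ t) * (\<integral>\<^sup>+\<omega>. w (F 1 x \<omega>) \<partial>M)"
    by (rule nn_integral_cmult) measurable
  also have "\<dots> \<le> ennreal (B ^ t) * ennreal (B * (\<kappa> x * w x))"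
    by (intro mult_left_mono drift) simp
  also have "\<dots> = ennreal (B ^ Suc t * (\<kappa> x * w x))"
    using B_ge_1 \<kappa>_nonneg by (subst ennreal_mult'[symmetric]) (auto simp: ac_simps)
  also have "\<dots> \<le> ennreal (B ^ Suc t * w x)"
    using B_ge_1 \<kappa>_nonneg[of x] \<kappa>_le_1[of x]
    by (intro ennreal_leI mult_left_mono mult_left_le_one_le) auto
  finally show ?case .
qed

text \<open>The first of the \<open>t\<close> steps contributes \<open>\<kappa>\<close> at the
  starting point; the later steps only cost powers of \<open>B\<close>. The smallness of
  \<open>\<kappa>\<close> at infinity is thus available at every time from 1 on.\<close>

lemma nn_w_le_\<kappa>: 
  assumes "1 \<le> t"
  shows "(\<integral>\<^sup>+\<omega>. w (F t x \<omega>) \<partial>M) \<le> ennreal (B ^ t * (\<kappa> x * w x))"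
proof -
  obtain s where s: "t = 1 + s" using assms by (metis le_Suc_ex)
  have "(\<integral>\<^sup>+\<omega>. w (F t x \<omega>) \<partial>M) = (\<integral>\<^sup>+\<omega>. (\<integral>\<^sup>+\<omega>'. w (F s (F 1 x \<omega>) \<omega>') \<partial>M) \<partial>M)"
    unfolding s using markov[of "\<lambda>x. ennreal (w x)" 1 s x] by simp
  also have "\<dots> \<le> (\<integral>\<^sup>+\<omega>. ennreal (B ^ s) * w (F 1 x \<omega>) \<partial>M)"
    using nn_w_le B_ge_1 by (intro nn_integral_mono) (simp add: ennreal_mult)
  also have "\<dots> = ennreal (B ^ s) * (\<integral>\<^sup>+\<omega>. w (F 1 x \<omega>) \<partial>M)"
    by (rule nn_integral_cmult) measurable
  also have "\<dots> \<le> ennreal (B ^ s) * ennreal (B * (\<kappa> x * w x))"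
    by (intro mult_left_mono drift) simp
  also have "\<dots> = ennreal (B ^ t * (\<kappa> x * w x))"
    using B_ge_1 \<kappa>_nonneg by (subst ennreal_mult'[symmetric]) (auto simp: ac_simps s)
  finally show ?thesis .
qed

section \<open>The transition operators on weighted functions\<close>

lemma integrable_w: "integrable M (\<lambda>\<omega>. w (F t x \<omega>))"
proof (rule integrableI_bounded)
  have "(\<integral>\<^sup>+\<omega>. norm (w (F t x \<omega>)) \<partial>M) \<le> ennreal (B ^ t * w x)" using nn_w_le by simp
  then show "(\<integral>\<^sup>+\<omega>. norm (w (F t x \<omega>)) \<partial>M) < \<infinity>"
    by (rule order_le_less_trans) simp
qed measurable

lemma integrable_wbound:
  assumes "wbound c f"
  shows "integrable M (\<lambda>\<omega>. f (F t x \<omega>))"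
proof (rule Bochner_Integration.integrable_bound)
  show "integrable M (\<lambda>\<omega>. c * w (F t x \<omega>))" using integrable_w by simp
  have [measurable]: "f \<in> borel_measurable borel" using assms by (rule wboundD)
  show "(\<lambda>\<omega>. f (F t x \<omega>)) \<in> borel_measurable M" by measurable
  show "AE \<omega> in M. norm (f (F t x \<omega>)) \<le> norm (c * w (F t x \<omega>))"
    using wboundD(2)[OF assms] order_trans[OF _ abs_ge_self] by (intro AE_I2) auto
qed

lemma P_mono:
  assumes "wbound c f" "wbound d g" "\<And>x. f x \<le> g x"
  shows "P t f x \<le> P t g x"
  unfolding P_def using assms by (intro integral_mono integrable_wbound)

lemma P_add: "wbound c f \<Longrightarrow> wbound d g \<Longrightarrow> P t (\<lambda>x. f x + g x) x = P t f x + P t g x"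
  unfolding P_def by (intro Bochner_Integration.integral_add integrable_wbound)

lemma P_diff: "wbound c f \<Longrightarrow> wbound d g \<Longrightarrow> P t (\<lambda>x. f x - g x) x = P t f x - P t g x"
  unfolding P_def by (intro Bochner_Integration.integral_diff integrable_wbound)

lemma P_cmult: "P t (\<lambda>x. a * f x) x = a * P t f x"
  unfolding P_def by simp

lemma P_const [simp]: "P t (\<lambda>x. a) x = a"
  unfolding P_def by (simp add: prob_space)

lemma P_diff_const: "wbound c f \<Longrightarrow> P t (\<lambda>x. f x - a) x = P t f x - a"
  using P_diff[OF _ wbound_const[of a], of c f t x] by simp

lemma P_0: "P 0 f x = f x"
proof -
  have "P 0 f x = (\<integral>\<omega>. f x \<partial>M)" unfolding P_def by (intro Bochner_Integration.integral_cong) (auto simp: F_0)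
  then show ?thesis by (simp add: prob_space)
qed

lemma P_w_le: "P t w x \<le> B ^ t * w x"
  unfolding P_def using nn_w_le[of t x] B_ge_1 integrable_w[of t x]
  by (subst (asm) nn_integral_eq_integral) auto

lemma P_w_le_\<kappa>: "1 \<le> t \<Longrightarrow> P t w x \<le> B ^ t * (\<kappa> x * w x)"
  unfolding P_def using nn_w_le_\<kappa>[of t x] B_ge_1 integrable_w[of t x] \<kappa>_nonneg[of x]
  by (subst (asm) nn_integral_eq_integral) auto

lemma P_abs_le:
  assumes "wbound c f"
  shows "\<bar>P t f x\<bar> \<le> c * P t w x"
proof -
  have "wbound c (\<lambda>x. c * w x)" using wbound_cmult[OF wbound_w, of c] wbound_nonneg[OF assms] by simp
  moreover have "wbound c (\<lambda>x. \<bar>f x\<bar>)" using assms by (auto simp: wbound_def)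
  ultimately have "P t (\<lambda>x. \<bar>f x\<bar>) x \<le> c * P t w x"
    using P_mono[of c "\<lambda>x. \<bar>f x\<bar>" c "\<lambda>x. c * w x"] wboundD(2)[OF assms] by (simp add: P_cmult)
  moreover have "\<bar>P t f x\<bar> \<le> P t (\<lambda>x. \<bar>f x\<bar>) x" unfolding P_def by (rule integral_abs_bound)
  ultimately show ?thesis by linarith
qed

lemma P_borel [measurable (raw)]:
  assumes "f \<in> borel_measurable borel"
  shows "P t f \<in> borel_measurable borel"
  unfolding P_def using assms by measurable

lemma P_wbound:
  assumes "wbound c f"
  shows "wbound (c * B ^ t) (P t f)"
proof -
  have "\<bar>P t f x\<bar> \<le> c * B ^ t * w x" for x
    using P_abs_le[OF assms, of t x] mult_left_mono[OF P_w_le wbound_nonneg[OF assms], of t x]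
    by (simp add: mult.assoc)
  then show ?thesis using P_borel[OF wboundD(1)[OF assms]] by (simp add: wbound_def)
qed

lemma P_abs_le_\<kappa>:
  assumes "wbound c f" "1 \<le> t"
  shows "\<bar>P t f x\<bar> \<le> c * B ^ t * (\<kappa> x * w x)"
  using P_abs_le[OF assms(1), of t x] mult_left_mono[OF P_w_le_\<kappa> wbound_nonneg[OF assms(1)], OF assms(2), of x]
  by (simp add: mult.assoc)

lemma nn_integral_P:
  assumes "wbound c f" "\<And>x. 0 \<le> f x"
  shows "(\<integral>\<^sup>+\<omega>. f (F t x \<omega>) \<partial>M) = ennreal (P t f x)"
  unfolding P_def using assms by (intro nn_integral_eq_integral integrable_wbound AE_I2)

lemma P_nonneg: "(\<And>x. 0 \<le> f x) \<Longrightarrow> 0 \<le> P t f x"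
  unfolding P_def by (intro Bochner_Integration.integral_nonneg) auto

text \<open>Adding \<open>c * w\<close> makes \<open>f\<close> nonnegative. The Markov property and
  invariance, known for nonnegative integrals, carry over to signed functions by subtracting the
  contribution of \<open>c * w\<close>.\<close>

lemma wbound_shift:
  assumes "wbound c f"
  shows "wbound (c + c) (\<lambda>x. f x + c * w x)" "0 \<le> f x + c * w x"
  using wbound_add[OF assms wbound_cmult[OF wbound_w, of c]] wbound_nonneg[OF assms]
    wboundD(2)[OF assms, of x] by auto

lemma P_P_add:
  assumes f: "wbound c f"
  shows "P (s + t) f x = P s (P t f) x"
proof -
  have *: "P (s + t) g x = P s (P t g) x" if g: "wbound d g" "\<And>x. 0 \<le> g x" for d g
  proof -
    have [measurable]: "g \<in> borel_measurable borel" using g by (auto dest: wboundD)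
    have "ennreal (P (s + t) g x) = (\<integral>\<^sup>+\<omega>. g (F (s + t) x \<omega>) \<partial>M)"
      by (rule nn_integral_P[OF g, symmetric])
    also have "\<dots> = (\<integral>\<^sup>+\<omega>. (\<integral>\<^sup>+\<omega>'. g (F t (F s x \<omega>) \<omega>') \<partial>M) \<partial>M)"
      by (rule markov) measurable
    also have "\<dots> = (\<integral>\<^sup>+\<omega>. P t g (F s x \<omega>) \<partial>M)"
      by (simp add: nn_integral_P[OF g])
    also have "\<dots> = ennreal (P s (P t g) x)"
      by (intro nn_integral_P[OF P_wbound[OF g(1)]] P_nonneg g)
    finally show ?thesis by (simp add: P_nonneg g)
  qed
  have cw: "wbound c (\<lambda>x. c * w x)" using wbound_cmult[OF wbound_w, of c] wbound_nonneg[OF f] by simp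
  have "P (s + t) (\<lambda>x. f x + c * w x) x = P s (P t (\<lambda>x. f x + c * w x)) x"
    by (rule *) (rule wbound_shift[OF f])+
  also have "P t (\<lambda>x. f x + c * w x) = (\<lambda>x. P t f x + P t (\<lambda>x. c * w x) x)"
    using P_add[OF f cw] by (rule ext)
  also have "P s \<dots> x = P s (P t f) x + P s (P t (\<lambda>x. c * w x)) x"
    using P_add[OF P_wbound[OF f] P_wbound[OF cw]] .
  also have "P s (P t (\<lambda>x. c * w x)) x = P (s + t) (\<lambda>x. c * w x) x"
    by (rule *[symmetric, OF cw]) (use wbound_nonneg[OF f] in simp)
  finally show ?thesis using P_add[OF f cw] by simp
qed

text \<open>\<open>Kd\<close> is the same for all times. This matters for the contraction below,
  where the level of \<open>w\<close> is fixed from \<open>Kd\<close> before the time of overlap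
  \<open>T\<close> is known.\<close>

lemma drift_iterate: "\<exists>Kd\<ge>0. \<forall>t\<ge>1. \<forall>x. P t w x \<le> w x / 2 + Kd"
proof -
  \<comment> \<open>With this threshold one step halves \<open>w\<close> outside the ball of radius
    \<open>r\<close>; inside, \<open>w\<close> is bounded.\<close>
  obtain r where r: "\<And>x. r < norm x \<Longrightarrow> \<kappa> x \<le> 1 / (2 * B)"
    using \<kappa>_small[of "1 / (2 * B)"] B_ge_1 by auto
  have "bounded (w ` cball 0 r)"
    by (intro compact_imp_bounded compact_continuous_image compact_cball
        continuous_on_subset[OF w_continuous]) auto
  then obtain W where W: "\<forall>x\<in>cball 0 r. \<bar>w x\<bar> \<le> W" "0 < W"
    unfolding bounded_pos by auto
  have 1: "P 1 w x \<le> w x / 2 + B * W" for x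
  proof (cases "r < norm x")
    case True
    have "B * (\<kappa> x * w x) \<le> B * ((1 / (2 * B)) * w x)"
      using B_ge_1 r[OF True] by (intro mult_left_mono mult_right_mono) auto
    also have "\<dots> = w x / 2" using B_ge_1 by simp
    finally have "B * (\<kappa> x * w x) \<le> w x / 2" .
    moreover have "P 1 w x \<le> B * (\<kappa> x * w x)" using P_w_le_\<kappa>[of 1 x] by simp
    moreover have "0 \<le> B * W" using W(2) B_ge_1 by simp
    ultimately show ?thesis by linarith
  next
    case False
    then have "B * w x \<le> B * W" using W(1) B_ge_1 by (intro mult_left_mono) auto
    then show ?thesis using P_w_le[of 1 x] by (simp add: add_increasing)
  qed
  \<comment> \<open>The additive constant \<open>2 * (B * W)\<close> is the fixed point of s -> s /
    2 + B W, so it reproduces itself in the induction.\<close>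
  have "P t w x \<le> w x / 2 + 2 * (B * W)" if "1 \<le> t" for t x
    using that
  proof (induction t rule: dec_induct)
    case base
    show ?case using 1[of x] W(2) B_ge_1 mult_nonneg_nonneg[of B W] by linarith
  next
    case (step t)
    let ?g = "\<lambda>x. (1 / 2) * w x + B * W"
    have g: "wbound (\<bar>1 / 2\<bar> * 1 + \<bar>B * W\<bar>) ?g" 
      by (intro wbound_add wbound_cmult wbound_w wbound_const)
    have "P (Suc t) w x = P t (P 1 w) x" using P_P_add[OF wbound_w, of t 1 x] by simp
    also have "\<dots> \<le> P t ?g x"
      using 1 by (intro P_mono[OF P_wbound[OF wbound_w] g]) auto
    also have "\<dots> = (1 / 2) * P t w x + B * W"
      using P_add[OF wbound_cmult[OF wbound_w] wbound_const, of t "1 / 2" "B * W" x]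
      by (simp only: P_cmult P_const)
    also have "\<dots> \<le> (1 / 2) * (w x / 2 + 2 * (B * W)) + B * W" using step.IH by simp
    also have "\<dots> \<le> w x / 2 + 2 * (B * W)" using w_pos(2)[of x] by simp
    finally show ?case .
  qed
  then show ?thesis using W(2) B_ge_1 by (intro exI[of _ "2 * (B * W)"]) auto
qed

end

section \<open>Convergence with varying majorants\<close>

text \<open>A dominated convergence theorem in the manner of Pratt. Clip \<open>f k\<close> to the
  interval from \<open>- Y\<close> to \<open>Y\<close>: the clipped functions converge under the
  fixed majorant \<open>Y\<close>. What is cut off is at most the excess of \<open>Z k\<close> over
  \<open>Y\<close>, whose integral tends to 0 because the integrals of \<open>Z k\<close> and of its
  minimum with \<open>Y\<close> have the same limit.\<close>

lemma integral_tendsto_varying_majorant: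
  fixes f :: "nat \<Rightarrow> 'a \<Rightarrow> real"
  assumes f [measurable]: "\<And>k. f k \<in> borel_measurable M" "g \<in> borel_measurable M"
    and Z: "\<And>k. integrable M (Z k)" "integrable M Y"
    and bound: "\<And>k x. x \<in> space M \<Longrightarrow> \<bar>f k x\<bar> \<le> Z k x"
    and f_lim: "\<And>x. x \<in> space M \<Longrightarrow> (\<lambda>k. f k x) \<longlonglongrightarrow> g x"
    and Z_lim: "\<And>x. x \<in> space M \<Longrightarrow> (\<lambda>k. Z k x) \<longlonglongrightarrow> Y x"
    and int_lim: "(\<lambda>k. \<integral>x. Z k x \<partial>M) \<longlonglongrightarrow> (\<integral>x. Y x \<partial>M)"
  shows "(\<lambda>k. \<integral>x. f k x \<partial>M) \<longlonglongrightarrow> (\<integral>x. g x \<partial>M)"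
proof -
  have [measurable]: "Z k \<in> borel_measurable M" "Y \<in> borel_measurable M" for k
    using Z by (auto dest: borel_measurable_integrable)
  have Y: "\<bar>g x\<bar> \<le> Y x" if "x \<in> space M" for x
    by (rule LIMSEQ_le[OF tendsto_rabs[OF f_lim[OF that]] Z_lim[OF that]]) (use bound that in auto)
  have min: "(\<lambda>k. \<integral>x. min (Z k x) (Y x) \<partial>M) \<longlonglongrightarrow> (\<integral>x. Y x \<partial>M)"
  proof (rule integral_dominated_convergence[where w=Y])
    have "(\<lambda>k. min (Z k x) (Y x)) \<longlonglongrightarrow> min (Y x) (Y x)" if "x \<in> space M" for x
      by (intro tendsto_intros Z_lim that)
    then show "AE x in M. (\<lambda>k. min (Z k x) (Y x)) \<longlonglongrightarrow> Y x"
      by (intro AE_I2) simp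
    show "AE x in M. norm (min (Z k x) (Y x)) \<le> Y x" for k
    proof (intro AE_I2)
      fix x assume x: "x \<in> space M"
      show "norm (min (Z k x) (Y x)) \<le> Y x"
        using bound[OF x, of k] Y[OF x] by (auto simp: min_def)
    qed
  qed (use Z in measurable)
  define f' where "f' k x = max (- Y x) (min (f k x) (Y x))" for k x
  have [measurable]: "f' k \<in> borel_measurable M" for k unfolding f'_def by measurable
  have f': "(\<lambda>k. \<integral>x. f' k x \<partial>M) \<longlonglongrightarrow> (\<integral>x. g x \<partial>M)"
  proof (rule integral_dominated_convergence[where w=Y])
    have "(\<lambda>k. f' k x) \<longlonglongrightarrow> max (- Y x) (min (g x) (Y x))" if "x \<in> space M" for x
      unfolding f'_def by (intro tendsto_intros f_lim that)
    moreover have "max (- Y x) (min (g x) (Y x)) = g x" if "x \<in> space M" for x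
      using Y[OF that] by auto
    ultimately show "AE x in M. (\<lambda>k. f' k x) \<longlonglongrightarrow> g x" by (intro AE_I2) auto
    show "AE x in M. norm (f' k x) \<le> Y x" for k
      using Y by (intro AE_I2) (fastforce simp: f'_def)
  qed (use Z in measurable)
  have int_f: "integrable M (f k)" for k
    using order_trans[OF bound abs_ge_self]
    by (intro Bochner_Integration.integrable_bound[OF Z(1)[of k]] AE_I2) auto
  have int_f': "integrable M (f' k)" for k
  proof (intro Bochner_Integration.integrable_bound[OF Z(2)] AE_I2)
    show "norm (f' k x) \<le> norm (Y x)" if "x \<in> space M" for x
      using Y[OF that] by (auto simp: f'_def)
  qed measurable
  have int_min: "integrable M (\<lambda>x. min (Z k x) (Y x))" for k
    using Z by (intro integrable_min)
  have le: "norm ((\<integral>x. f k x \<partial>M) - (\<integral>x. f' k x \<partial>M)) \<le> (\<integral>x. Z k x \<partial>M) - (\<integral>x. min (Z k x) (Y x) \<partial>M)" for k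
  proof -
    have "\<bar>f k x - f' k x\<bar> \<le> Z k x - min (Z k x) (Y x)" if "x \<in> space M" for x
      using bound[OF that, of k] Y[OF that] by (auto simp: f'_def min_def max_def abs_le_iff)
    then have "norm (\<integral>x. f k x - f' k x \<partial>M) \<le> (\<integral>x. Z k x - min (Z k x) (Y x) \<partial>M)"
      by (intro order_trans[OF integral_norm_bound] integral_mono)
         (auto intro!: integrable_norm Bochner_Integration.integrable_diff int_f int_f' int_min Z)
    then show ?thesis using int_f int_f' int_min Z by simp
  qed
  have lim: "(\<lambda>k. (\<integral>x. Z k x \<partial>M) - (\<integral>x. min (Z k x) (Y x) \<partial>M)) \<longlonglongrightarrow> 0"
    using tendsto_diff[OF int_lim min] by simp
  have "(\<lambda>k. (\<integral>x. f k x \<partial>M) - (\<integral>x. f' k x \<partial>M)) \<longlonglongrightarrow> 0"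
    by (rule Lim_null_comparison[OF always_eventually[OF allI, OF le] lim])
  from tendsto_add[OF this f'] show ?thesis by simp
qed

lemma continuous_integral_varying_majorant:
  fixes f Z :: "'b::metric_space \<Rightarrow> 'a \<Rightarrow> real"
  assumes "\<And>x. f x \<in> borel_measurable M" "\<And>x. integrable M (Z x)"
    and "\<And>x \<omega>. \<omega> \<in> space M \<Longrightarrow> \<bar>f x \<omega>\<bar> \<le> Z x \<omega>"
    and "\<And>\<omega>. \<omega> \<in> space M \<Longrightarrow> continuous_on UNIV (\<lambda>x. f x \<omega>)"
    and "\<And>\<omega>. \<omega> \<in> space M \<Longrightarrow> continuous_on UNIV (\<lambda>x. Z x \<omega>)"
    and "continuous_on UNIV (\<lambda>x. \<integral>\<omega>. Z x \<omega> \<partial>M)"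
  shows "continuous_on UNIV (\<lambda>x. \<integral>\<omega>. f x \<omega> \<partial>M)"
proof -
  have seq: "(\<lambda>k. h (u k)) \<longlonglongrightarrow> h x" if "continuous_on UNIV h" "u \<longlonglongrightarrow> x"
    for h :: "'b \<Rightarrow> real" and u x
    using continuous_on_tendsto_compose[OF that] by simp
  show ?thesis unfolding continuous_on_sequentially o_def
  proof (intro allI ballI impI, elim conjE)
    fix u :: "nat \<Rightarrow> 'b" and x assume u: "u \<longlonglongrightarrow> x"
    show "(\<lambda>k. \<integral>\<omega>. f (u k) \<omega> \<partial>M) \<longlonglongrightarrow> (\<integral>\<omega>. f x \<omega> \<partial>M)"
      by (rule integral_tendsto_varying_majorant[where Z="\<lambda>k. Z (u k)" and Y="Z x"])
         (use assms in \<open>auto intro: seq u\<close>)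
  qed
qed

section \<open>Geometric ergodicity in the weighted supremum norm\<close>

text \<open>The rate per step is the \<open>n\<close>-th root of the rate per block.
  \<open>j\<close> counts blocks not exploited for decay: 1 for a remainder shorter than one block,
  2 for a remainder of one to two blocks.\<close>

lemma geometric_subsequence:
  fixes \<alpha> :: real
  assumes "0 < \<alpha>" "\<alpha> < 1" "1 \<le> n"
  shows "\<exists>\<rho>. 0 < \<rho> \<and> \<rho> < 1 \<and> (\<forall>t k. t \<le> (k + j) * n \<longrightarrow> \<alpha> ^ k \<le> (1 / \<alpha> ^ j) * \<rho> ^ t)"
proof (intro exI[of _ "root n \<alpha>"] conjI allI impI)
  have n: "n > 0" using assms by simp
  show "0 < root n \<alpha>" "root n \<alpha> < 1" using assms n by (auto simp: real_root_gt_zero)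
  fix t k assume "t \<le> (k + j) * n"
  then have "root n \<alpha> ^ ((k + j) * n) \<le> root n \<alpha> ^ t"
    using assms n by (intro power_decreasing) (auto simp: real_root_ge_zero less_imp_le)
  also have "root n \<alpha> ^ ((k + j) * n) = \<alpha> ^ (k + j)"
    using assms n by (simp add: mult.commute[of _ n] power_mult)
  finally show "\<alpha> ^ k \<le> (1 / \<alpha> ^ j) * root n \<alpha> ^ t"
    using assms by (simp add: power_add field_simps)
qed

context smooth_markov_flow
begin

lemma \<pi>_measurable [measurable_cong]: "sets \<pi> = sets borel"
  by (rule \<pi>_sets)

section \<open>Integrability and invariance under the stationary law\<close>

lemma nn_integral_P_invariant:
  assumes f: "wbound c f" "\<And>x. 0 \<le> f x"
  shows "(\<integral>\<^sup>+x. f x \<partial>\<pi>) = (\<integral>\<^sup>+x. P t f x \<partial>\<pi>)"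
proof (induction t)
  case 0
  then show ?case by (simp add: P_0)
next
  case (Suc t)
  have [measurable]: "P t f \<in> borel_measurable borel" using f(1) by (intro P_borel wboundD)
  have "(\<integral>\<^sup>+x. P t f x \<partial>\<pi>) = (\<integral>\<^sup>+x. (\<integral>\<^sup>+\<omega>. P t f (F 1 x \<omega>) \<partial>M) \<partial>\<pi>)"
    by (rule \<pi>_invariant) measurable
  also have "\<dots> = (\<integral>\<^sup>+x. P 1 (P t f) x \<partial>\<pi>)"
    by (simp only: nn_integral_P[OF P_wbound[OF f(1)] P_nonneg[OF f(2)]])
  also have "\<dots> = (\<integral>\<^sup>+x. P (Suc t) f x \<partial>\<pi>)"
    using P_P_add[OF f(1), of 1 t] by simp
  finally show ?case using Suc.IH by simp
qed

text \<open>As finiteness of the integral of \<open>w\<close> is the claim, the integrals of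
  \<open>w\<close> and \<open>P 1 w\<close> may not be subtracted. For the truncation
  \<open>?u\<close> at level \<open>m\<close>, the difference \<open>?u - P 1 ?u\<close> has
  integral 0, while it is at least \<open>w x / 2 - Kd\<close> where \<open>w x \<le> m\<close>, by
  the drift, and at least 0 elsewhere. The resulting bound \<open>2 * Kd\<close> is independent of
  \<open>m\<close>, and Fatou's lemma concludes.\<close>

lemma integrable_w_invariant: "integrable \<pi> w"
proof -
  interpret \<pi>: prob_space \<pi> by (rule \<pi>_prob)
  obtain Kd where Kd: "0 \<le> Kd" "\<And>x. P 1 w x \<le> w x / 2 + Kd"
    using drift_iterate by auto
  have bound: "(\<integral>\<^sup>+x. ennreal (if w x \<le> m then w x else 0) \<partial>\<pi>) \<le> ennreal (2 * Kd)"
    if "0 \<le> m" for m :: real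
  proof -
    let ?u = "\<lambda>x. min (w x) m"
    have wu: "wbound 1 ?u" using that by (auto simp: wbound_def)
    have wP: "P 1 ?u x \<le> w x / 2 + Kd" "P 1 ?u x \<le> m" "0 \<le> P 1 ?u x" for x
      using P_mono[OF wu wbound_w, of 1 x] P_mono[OF wu wbound_const, of m 1 x] Kd(2)[of x]
        P_nonneg[of ?u 1 x] that by auto
    have i1: "integrable \<pi> ?u"
      using that by (intro \<pi>.integrable_const_bound[where B=m] AE_I2) auto
    have [measurable]: "P 1 ?u \<in> borel_measurable borel" by (intro P_borel) measurable
    have i2: "integrable \<pi> (P 1 ?u)"
      using that wP by (intro \<pi>.integrable_const_bound[where B=m] AE_I2) auto
    have "ennreal (\<integral>x. ?u x \<partial>\<pi>) = ennreal (\<integral>x. P 1 ?u x \<partial>\<pi>)"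
      using nn_integral_P_invariant[OF wu, of 1] i1 i2 that wP(3)
      by (simp add: nn_integral_eq_integral)
    then have eq: "(\<integral>x. ?u x \<partial>\<pi>) = (\<integral>x. P 1 ?u x \<partial>\<pi>)"
      using that wP(3) by (simp add: Bochner_Integration.integral_nonneg)
    have i3: "integrable \<pi> (\<lambda>x. if w x \<le> m then w x else 0)"
      using that by (intro \<pi>.integrable_const_bound[where B=m] AE_I2) auto
    have "(\<integral>x. (if w x \<le> m then w x else 0) / 2 - Kd \<partial>\<pi>) \<le> (\<integral>x. ?u x - P 1 ?u x \<partial>\<pi>)"
    proof (intro integral_mono Bochner_Integration.integrable_diff i1 i2)
      show "integrable \<pi> (\<lambda>x. (if w x \<le> m then w x else 0) / 2)" using i3 by simp
      show "(if w x \<le> m then w x else 0) / 2 - Kd \<le> ?u x - P 1 ?u x" for x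
        using wP(1,2)[of x] Kd(1) by (cases "w x \<le> m") (simp_all add: min_absorb1 min_absorb2)
    qed simp
    also have "\<dots> = 0" using eq i1 i2 by simp
    finally have "(\<integral>x. (if w x \<le> m then w x else 0) \<partial>\<pi>) \<le> 2 * Kd"
      using i3 by (simp add: \<pi>.prob_space)
    then show ?thesis using i3 by (subst nn_integral_eq_integral) (auto intro: ennreal_leI)
  qed
  show ?thesis
  proof (rule integrableI_bounded)
    have "(\<integral>\<^sup>+x. ennreal (norm (w x)) \<partial>\<pi>)
        = (\<integral>\<^sup>+x. liminf (\<lambda>m. ennreal (if w x \<le> real m then w x else 0)) \<partial>\<pi>)"
    proof (intro nn_integral_cong)
      fix x
      have "(\<lambda>m. ennreal (if w x \<le> real m then w x else 0)) \<longlonglongrightarrow> ennreal (w x)"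
        using eventually_ge_at_top[of "nat \<lceil>w x\<rceil>"]
        by (intro tendsto_eventually) (auto elim!: eventually_mono)
      from lim_imp_Liminf[OF sequentially_bot this]
      show "ennreal (norm (w x)) = liminf (\<lambda>m. ennreal (if w x \<le> real m then w x else 0))"
        by simp
    qed
    also have "\<dots> \<le> liminf (\<lambda>m. \<integral>\<^sup>+x. ennreal (if w x \<le> real m then w x else 0) \<partial>\<pi>)"
      by (rule nn_integral_liminf) measurable
    also have "\<dots> \<le> ennreal (2 * Kd)"
      using bound by (intro Liminf_le always_eventually) auto
    finally show "(\<integral>\<^sup>+x. ennreal (norm (w x)) \<partial>\<pi>) < \<infinity>" by (rule order_le_less_trans) simp
  qed measurable
qed

lemma integrable_invariant:
  assumes "wbound c f"
  shows "integrable \<pi> f"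
proof (rule Bochner_Integration.integrable_bound)
  show "integrable \<pi> (\<lambda>x. c * w x)" using integrable_w_invariant by simp
  show "f \<in> borel_measurable \<pi>" using wboundD(1)[OF assms] by simp
  show "AE x in \<pi>. norm (f x) \<le> norm (c * w x)"
    using order_trans[OF wboundD(2)[OF assms] abs_ge_self] by (intro AE_I2) (simp only: real_norm_def)
qed

lemma integral_P_invariant:
  assumes f: "wbound c f"
  shows "(\<integral>x. P t f x \<partial>\<pi>) = (\<integral>x. f x \<partial>\<pi>)"
proof -
  have *: "(\<integral>x. P t g x \<partial>\<pi>) = (\<integral>x. g x \<partial>\<pi>)" if g: "wbound d g" "\<And>x. 0 \<le> g x" for d g
    using nn_integral_P_invariant[OF g, of t] g wboundD(1)[OF g(1)]
    by (subst (1 2) integral_eq_nn_integral) (auto intro!: P_nonneg P_borel)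
  have cw: "wbound c (\<lambda>x. c * w x)" using wbound_cmult[OF wbound_w, of c] wbound_nonneg[OF f] by simp
  have "(\<integral>x. P t f x \<partial>\<pi>) + (\<integral>x. P t (\<lambda>x. c * w x) x \<partial>\<pi>) = (\<integral>x. P t (\<lambda>x. f x + c * w x) x \<partial>\<pi>)"
    using P_add[OF f cw] P_wbound[OF f, of t] P_wbound[OF cw, of t] by (simp add: integrable_invariant)
  also have "\<dots> = (\<integral>x. f x \<partial>\<pi>) + (\<integral>x. c * w x \<partial>\<pi>)"
    using integrable_invariant[OF f] integrable_invariant[OF cw]
    by (subst *[OF wbound_shift(1)[OF f] wbound_shift(2)[OF f]]) simp
  also have "(\<integral>x. P t (\<lambda>x. c * w x) x \<partial>\<pi>) = (\<integral>x. c * w x \<partial>\<pi>)"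
    using wbound_nonneg[OF f] by (intro *[OF cw]) simp
  finally show ?thesis by simp
qed

section \<open>Feller property, minorization and overlap of laws\<close>

lemma P_continuous_bounded:
  assumes "continuous_on UNIV f" "\<And>x. \<bar>f x\<bar> \<le> c"
  shows "continuous_on UNIV (P t f)"
  unfolding P_def
proof (rule continuous_integral_varying_majorant[where Z="\<lambda>_ _. c"])
  have [measurable]: "f \<in> borel_measurable borel" by (rule borel_measurable_continuous_onI) fact
  show "(\<lambda>\<omega>. f (F t x \<omega>)) \<in> borel_measurable M" for x by measurable
  show "continuous_on UNIV (\<lambda>x. f (F t x \<omega>))" if "\<omega> \<in> space M" for \<omega>
    using continuous_on_compose2[OF assms(1) F_continuous[OF that]] by simp
qed (use assms in auto)

lemma p_continuous: "continuous_on UNIV p"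
  by (rule continuously_differentiable_continuous[OF p_C1])

lemma P_t0_density:
  assumes "wbound c u"
  shows "integrable lborel (\<lambda>y. p (x, y) * u y)"
    and "P t0 u x = (\<integral>y. p (x, y) * u y \<partial>lborel)"
proof -
  have u: "u \<in> borel_measurable borel" using assms by (rule wboundD)
  have p [measurable]: "(\<lambda>y. p (x, y)) \<in> borel_measurable borel"
    by (intro borel_measurable_continuous_onI continuous_on_compose2[OF p_continuous] continuous_intros) auto
  have "integrable (density lborel (\<lambda>y. ennreal (p (x, y)))) u"
    unfolding p_density[symmetric]
    using integrable_wbound[OF assms] u by (subst integrable_distr_eq) auto
  then show "integrable lborel (\<lambda>y. p (x, y) * u y)"
    using u by (subst (asm) integrable_density) (auto simp: p_nonneg)
  have "P t0 u x = (\<integral>y. u y \<partial>distr M borel (F t0 x))"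
    unfolding P_def using u by (subst integral_distr) auto
  then show "P t0 u x = (\<integral>y. p (x, y) * u y \<partial>lborel)"
    unfolding p_density using u by (subst (asm) integral_density) (auto simp: p_nonneg)
qed



text \<open>A small-set condition: from points near \<open>x0\<close> the law at time
  \<open>t0\<close> dominates \<open>c\<close> times Lebesgue measure on a ball. The range from 0 to
  2 of the test functions is that of \<open>1 - \<phi>\<close> and \<open>1 + \<phi>\<close> for
  \<open>\<phi>\<close> bounded by 1.\<close>

definition minorized :: "real \<Rightarrow> real \<Rightarrow> real^'l \<Rightarrow> bool" where
  "minorized r c y0 \<longleftrightarrow>
    (\<forall>z. \<forall>u\<in>borel_measurable borel. dist x0 z < r \<longrightarrow> (\<forall>y. 0 \<le> u y \<and> u y \<le> 2)
      \<longrightarrow> c * (\<integral>y. indicator (ball y0 r) y * u y \<partial>lborel) \<le> P t0 u z)"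

text \<open>The density at \<open>x0\<close> cannot vanish identically, since \<open>P t0\<close>
  preserves constants. Near a point where it is positive, continuity keeps \<open>p\<close> above
  half its value in both variables at once.\<close>

lemma local_minorization: "\<exists>r c y0. 0 < r \<and> 0 < c \<and> minorized r c y0"
proof -
  have "\<exists>y0. 0 < p (x0, y0)"
  proof (rule ccontr)
    assume "\<nexists>y0. 0 < p (x0, y0)"
    then have "p (x0, y) = 0" for y using p_nonneg[of "(x0, y)"] by (metis less_eq_real_def)
    then have "P t0 (\<lambda>_. 1) x0 = 0" using P_t0_density(2)[OF wbound_const[of 1], of x0] by simp
    then show False by simp
  qed
  then obtain y0 where y0: "0 < p (x0, y0)" by blast
  define c where "c = p (x0, y0) / 2"
  have c: "0 < c" using y0 by (simp add: c_def)
  have "isCont p (x0, y0)" using p_continuous by (simp add: continuous_on_eq_continuous_at)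
  then obtain d where d: "0 < d" "\<And>z. dist z (x0, y0) < d \<Longrightarrow> dist (p z) (p (x0, y0)) < c"
    unfolding continuous_at_eps_delta using c by blast
  have p_ge: "c \<le> p (z, y)" if "dist x0 z < d / 2" "dist y0 y < d / 2" for z y
  proof -
    have "dist (z, y) (x0, y0) \<le> dist z x0 + dist y y0"
      unfolding dist_Pair_Pair by (rule sqrt_sum_squares_le_sum) auto
    also have "\<dots> < d" using that by (simp add: dist_commute)
    finally have "dist (p (z, y)) (p (x0, y0)) < c" by (rule d(2))
    then show ?thesis unfolding dist_real_def c_def by (simp add: abs_if split: if_splits)
  qed
  have "minorized (d / 2) c y0"
    unfolding minorized_def
  proof (intro allI ballI impI)
    fix z and u :: "real^'l \<Rightarrow> real" assume z: "dist x0 z < d / 2" and u [measurable]: "u \<in> borel_measurable borel"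
      and u02: "\<forall>y. 0 \<le> u y \<and> u y \<le> 2"
    have u_ge: "0 \<le> u y" and u_le: "u y \<le> 2" for y using u02 by auto
    have wu: "wbound 2 u" using u u_ge u_le by (intro wbound_bounded) auto
    have "integrable lborel (\<lambda>y. 2 * indicator (ball y0 (d / 2)) y :: real)"
      by (intro integrable_mult_right integrable_real_indicator)
         (use emeasure_lborel_ball_finite in auto)
    then have int: "integrable lborel (\<lambda>y. indicator (ball y0 (d / 2)) y * u y)"
      by (rule Bochner_Integration.integrable_bound)
         (use u_ge u_le in \<open>auto simp: indicator_def\<close>)
    have "c * (\<integral>y. indicator (ball y0 (d / 2)) y * u y \<partial>lborel)
        = (\<integral>y. c * (indicator (ball y0 (d / 2)) y * u y) \<partial>lborel)" by simp
    also have "\<dots> \<le> (\<integral>y. p (z, y) * u y \<partial>lborel)"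
    proof (intro integral_mono integrable_mult_right int P_t0_density(1)[OF wu])
      fix y show "c * (indicator (ball y0 (d / 2)) y * u y) \<le> p (z, y) * u y"
        using p_ge[OF z, of y] u_ge[of y] p_nonneg[of "(z, y)"] c
        by (auto simp: indicator_def intro: mult_right_mono)
    qed
    finally show "c * (\<integral>y. indicator (ball y0 (d / 2)) y * u y \<partial>lborel) \<le> P t0 u z"
      using P_t0_density(2)[OF wu] by simp
  qed
  moreover have "0 < d / 2" using d by simp
  ultimately show ?thesis using c by blast
qed

text \<open>The dual form of total variation: the two laws at time \<open>T\<close> share at least
  mass \<open>a\<close>. A one-sided inequality is enough because \<open>\<phi>\<close> may be
  replaced by \<open>- \<phi>\<close>.\<close>

definition coupled :: "nat \<Rightarrow> real \<Rightarrow> real^'l \<Rightarrow> real^'l \<Rightarrow> bool" where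
  "coupled T a x y \<longleftrightarrow> (\<forall>\<phi>\<in>borel_measurable borel. (\<forall>z. \<bar>\<phi> z\<bar> \<le> 1) \<longrightarrow> P T \<phi> x - P T \<phi> y \<le> 2 * (1 - a))"

text \<open>A longer time only replaces the test function \<open>\<phi>\<close> by
  \<open>P s \<phi>\<close>, which is again bounded by 1.\<close>

lemma coupled_mono:
  assumes "coupled T a x y" "T \<le> T'" "a' \<le> a"
  shows "coupled T' a' x y"
  unfolding coupled_def
proof (intro ballI impI)
  fix \<phi> :: "real^'l \<Rightarrow> real" assume \<phi>: "\<phi> \<in> borel_measurable borel" "\<forall>z. \<bar>\<phi> z\<bar> \<le> 1"
  have wb: "wbound 1 \<phi>" using \<phi> by (intro wbound_bounded) auto
  obtain s where s: "T' = T + s" using assms(2) le_Suc_ex by blast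
  have "\<bar>P s \<phi> z\<bar> \<le> 1" for z
    using P_mono[OF wb wbound_const[of 1], of s z] P_mono[OF wbound_const[of "-1"] wb, of s z] \<phi>(2)
    by (auto simp: abs_le_iff)
  then have "P T (P s \<phi>) x - P T (P s \<phi>) y \<le> 2 * (1 - a)"
    using assms(1) P_borel[OF \<phi>(1)] unfolding coupled_def by blast
  then show "P T' \<phi> x - P T' \<phi> y \<le> 2 * (1 - a')"
    using assms(3) by (simp add: s P_P_add[OF wb])
qed

text \<open>At some common time \<open>s\<close> both starting points charge the neighbourhood of
  \<open>x0\<close>, and the minorization then gives the two laws a common part, a multiple of
  Lebesgue measure on a ball.\<close>

lemma locally_coupled:
  obtains U T a where "open U" "(x, y) \<in> U" "(a::real) > 0"
    "\<And>x' y'. (x', y') \<in> U \<Longrightarrow> coupled T a x' y'"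
proof -
  obtain r c y0 where r: "0 < r" and c: "0 < c" and "minorized r c y0"
    using local_minorization by blast
  then have minor: "c * (\<integral>y. indicator (ball y0 r) y * u y \<partial>lborel) \<le> P t0 u z"
    if "dist x0 z < r" "u \<in> borel_measurable borel" "\<And>y. 0 \<le> u y" "\<And>y. u y \<le> 2" for u z
    using that unfolding minorized_def by simp
  define \<Lambda> where "\<Lambda> u = (\<integral>y. indicator (ball y0 r) y * u y \<partial>lborel)" for u :: "real^'l \<Rightarrow> real"
  \<comment> \<open>A continuous function between the indicators of the balls of radius
    \<open>r / 2\<close> and \<open>r\<close>: by the Feller property the set where
    \<open>P s \<psi>\<close> exceeds a level is open.\<close>
  define \<psi> where "\<psi> z = max 0 (min 1 (2 - 2 * dist x0 z / r))" for z
  have "continuous_on UNIV \<psi>"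
    unfolding \<psi>_def using r by (intro continuous_intros) auto
  then have \<psi>: "continuous_on UNIV \<psi>" "\<And>z. 0 \<le> \<psi> z" "\<And>z. \<psi> z \<le> 1"
    "\<And>z. dist x0 z < r / 2 \<Longrightarrow> \<psi> z = 1" "\<And>z. \<not> dist x0 z < r \<Longrightarrow> \<psi> z = 0"
    using r by (auto simp: \<psi>_def field_simps max_def min_def)
  have [measurable]: "\<psi> \<in> borel_measurable borel"
    by (rule borel_measurable_continuous_onI[OF \<psi>(1)])
  have w\<psi>: "wbound 1 \<psi>" using \<psi>(2,3) by (simp add: wbound_bounded)
  have ev: "\<forall>\<^sub>F s in sequentially. 0 < P s \<psi> z" for z
  proof (rule eventually_mono[OF reach[of "ball x0 (r / 2)" z]])
    fix s
    let ?A = "{\<omega> \<in> space M. F s z \<omega> \<in> ball x0 (r / 2)}"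
    assume pos: "0 < measure M ?A"
    have "measure M ?A = (\<integral>\<omega>. indicator ?A \<omega> \<partial>M)" by simp
    also have "\<dots> \<le> P s \<psi> z"
      unfolding P_def
    proof (intro integral_mono integrable_wbound[OF w\<psi>])
      show "integrable M (\<lambda>\<omega>. indicator ?A \<omega> :: real)"
        by (intro integrable_real_indicator) (auto simp: emeasure_eq_measure)
      show "indicator ?A \<omega> \<le> \<psi> (F s z \<omega>)" for \<omega>
        using \<psi>(2,4)[of "F s z \<omega>"] by (auto simp: indicator_def)
    qed
    finally show "0 < P s \<psi> z" using pos by simp
  qed (use r in auto)
  have "\<forall>\<^sub>F s in sequentially. 0 < P s \<psi> x \<and> 0 < P s \<psi> y" using ev by (intro eventually_conj)
  then obtain s where s: "0 < P s \<psi> x" "0 < P s \<psi> y" unfolding eventually_sequentially by auto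
  \<comment> \<open>Half the smaller value, so that the strict inequalities defining
    \<open>U\<close> hold at \<open>(x, y)\<close> itself.\<close>
  define q where "q = min (P s \<psi> x) (P s \<psi> y) / 2"
  have q: "0 < q" "q < P s \<psi> x" "q < P s \<psi> y" using s by (auto simp: q_def)
  have cont: "continuous_on UNIV (P s \<psi>)"
    using \<psi>(2,3) by (intro P_continuous_bounded[OF \<psi>(1), of 1]) simp
  define U where "U = {z. q < P s \<psi> (fst z)} \<inter> {z. q < P s \<psi> (snd z)}"
  have low: "q * (c * \<Lambda> u) \<le> P (s + t0) u z"
    if "q < P s \<psi> z" and u [measurable]: "u \<in> borel_measurable borel"
      and u_ge: "\<And>y. 0 \<le> u y" and u_le: "\<And>y. u y \<le> (2::real)" for z u
  proof -
    have wu: "wbound 2 u" using u u_ge u_le by (intro wbound_bounded) auto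
    have \<Lambda>: "0 \<le> \<Lambda> u" unfolding \<Lambda>_def using u_ge by (intro Bochner_Integration.integral_nonneg) auto
    have "q * (c * \<Lambda> u) \<le> P s \<psi> z * (c * \<Lambda> u)"
      using that(1) c \<Lambda> by (intro mult_right_mono) auto
    also have "\<dots> = P s (\<lambda>z. (c * \<Lambda> u) * \<psi> z) z" by (simp add: P_cmult)
    also have "\<dots> \<le> P s (P t0 u) z"
    proof (rule P_mono[OF wbound_cmult[OF w\<psi>] P_wbound[OF wu]])
      fix z' show "c * \<Lambda> u * \<psi> z' \<le> P t0 u z'"
      proof (cases "dist x0 z' < r")
        case True
        have "c * \<Lambda> u * \<psi> z' \<le> c * \<Lambda> u * 1" using c \<Lambda> \<psi>(3) by (intro mult_left_mono) auto
        then show ?thesis using minor[OF True u u_ge u_le] by (simp add: \<Lambda>_def)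
      next
        case False
        then show ?thesis using \<psi>(5) u_ge by (simp add: P_nonneg)
      qed
    qed
    finally show ?thesis using P_P_add[OF wu, of s t0 z] by simp
  qed
  define a where "a = q * (c * measure lborel (ball y0 r))"
  have "0 < measure lborel (ball y0 r)"
    using r content_ball_pos[of r y0] by simp
  then have a: "0 < a" using q(1) c by (simp add: a_def)
  show ?thesis
  proof (rule that[of U a "s + t0"])
    have "open {z. q < P s \<psi> z}" using open_Collect_less[OF continuous_on_const cont] by simp
    then have "open (fst -` {z. q < P s \<psi> z} \<inter> snd -` {z. q < P s \<psi> z})"
      by (intro open_Int open_vimage_fst open_vimage_snd)
    then show "open U" by (simp add: U_def vimage_def)
    show "(x, y) \<in> U" using q by (simp add: U_def)
    fix x' y' assume xy: "(x', y') \<in> U"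
    show "coupled (s + t0) a x' y'" unfolding coupled_def
    proof (intro ballI impI)
      fix \<phi> :: "real^'l \<Rightarrow> real" assume \<phi> [measurable]: "\<phi> \<in> borel_measurable borel" and \<phi>1: "\<forall>z. \<bar>\<phi> z\<bar> \<le> 1"
      have \<phi>1': "- 1 \<le> \<phi> z" "\<phi> z \<le> 1" for z using \<phi>1 by (auto simp: abs_le_iff minus_le_iff)
      have \<phi>2: "0 \<le> 1 - \<phi> z" "1 - \<phi> z \<le> 2" "0 \<le> 1 + \<phi> z" "1 + \<phi> z \<le> 2" for z
        using \<phi>1'[of z] by auto
      have w\<phi>: "wbound 1 \<phi>" using \<phi>1 by (intro wbound_bounded) auto
      have int: "integrable lborel (\<lambda>y. indicator (ball y0 r) y * u y)" if u [measurable]: "u \<in> borel_measurable borel"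
        and "\<And>y. \<bar>u y\<bar> \<le> (1::real)" for u
      proof -
        have "integrable lborel (\<lambda>y. indicator (ball y0 r) y :: real)"
          by (intro integrable_real_indicator) (use emeasure_lborel_ball_finite in auto)
        then show ?thesis
          by (rule Bochner_Integration.integrable_bound) (use that(2) in \<open>auto simp: indicator_def\<close>)
      qed
      \<comment> \<open>The lower bound is applied to \<open>1 - \<phi>\<close> at \<open>x'\<close>
        and to \<open>1 + \<phi>\<close> at \<open>y'\<close>. In the sum
        \<open>\<Lambda> \<phi>\<close> cancels, and twice the common mass \<open>a\<close>
        remains.\<close>
      have "q * (c * \<Lambda> (\<lambda>z. 1 - \<phi> z)) \<le> P (s + t0) (\<lambda>z. 1 - \<phi> z) x'"
        using xy by (intro low \<phi>2) (auto simp: U_def)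
      moreover have "q * (c * \<Lambda> (\<lambda>z. 1 + \<phi> z)) \<le> P (s + t0) (\<lambda>z. 1 + \<phi> z) y'"
        using xy by (intro low \<phi>2) (auto simp: U_def)
      moreover have "P (s + t0) (\<lambda>z. 1 - \<phi> z) x' = 1 - P (s + t0) \<phi> x'"
        "P (s + t0) (\<lambda>z. 1 + \<phi> z) y' = 1 + P (s + t0) \<phi> y'"
        using P_diff[OF wbound_const w\<phi>, of "s + t0" 1] P_add[OF wbound_const w\<phi>, of "s + t0" 1] by simp_all
      moreover have "\<Lambda> (\<lambda>z. 1 - \<phi> z) = measure lborel (ball y0 r) - \<Lambda> \<phi>"
        "\<Lambda> (\<lambda>z. 1 + \<phi> z) = measure lborel (ball y0 r) + \<Lambda> \<phi>"
        unfolding \<Lambda>_def using int[of \<phi>] int[of "\<lambda>_. 1"] \<phi> \<phi>1 by (simp_all add: algebra_simps)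
      ultimately have "2 * a \<le> 2 - P (s + t0) \<phi> x' + P (s + t0) \<phi> y'"
        by (simp add: a_def algebra_simps)
      then show "P (s + t0) \<phi> x' - P (s + t0) \<phi> y' \<le> 2 * (1 - a)" by simp
    qed
  qed (rule a)
qed

lemma uniformly_coupled:
  "\<exists>T a. 1 \<le> T \<and> 0 < a \<and> a \<le> 1 \<and> (\<forall>x y. w x \<le> R \<longrightarrow> w y \<le> R \<longrightarrow> coupled T a x y)"
proof -
  \<comment> \<open>One index serves as the time and as the reciprocal of the overlap. Both
    conditions weaken as it grows, so the sets increase and a finite subcover collapses to its
    largest member.\<close>
  define G where "G n = interior {z. coupled (Suc n) (1 / real (Suc n)) (fst z) (snd z)}" for n
  have mono: "G n \<subseteq> G m" if "n \<le> m" for n m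
    unfolding G_def using that by (intro interior_mono) (auto elim!: coupled_mono simp: frac_le)
  have compact: "compact ({x. w x \<le> R} \<times> {x. w x \<le> R})"
    by (intro compact_Times w_compact)
  have "{x. w x \<le> R} \<times> {x. w x \<le> R} \<subseteq> (\<Union>n\<in>UNIV. G n)"
  proof clarsimp
    fix x y
    obtain U a T where U: "open U" "(x, y) \<in> U" "(a::real) > 0"
      "\<And>x' y'. (x', y') \<in> U \<Longrightarrow> coupled T a x' y'" by (rule locally_coupled[of x y]) (rule that)
    obtain n where n: "1 / real (Suc n) < a" using U(3) nat_approx_posE by metis
    have "U \<subseteq> {z. coupled (Suc (max n T)) (1 / real (Suc (max n T))) (fst z) (snd z)}"
    proof
      fix z assume "z \<in> U"
      then have "coupled T a (fst z) (snd z)" using U(4) by simp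
      moreover have "1 / real (Suc (max n T)) \<le> 1 / real (Suc n)" by (intro divide_left_mono) auto
      ultimately show "z \<in> {z. coupled (Suc (max n T)) (1 / real (Suc (max n T))) (fst z) (snd z)}"
        using n by (auto elim!: coupled_mono)
    qed
    then have "(x, y) \<in> G (max n T)" unfolding G_def using U(1,2) by (meson interiorI)
    then show "\<exists>n. (x, y) \<in> G n" by blast
  qed
  then obtain C where C: "finite C" "{x. w x \<le> R} \<times> {x. w x \<le> R} \<subseteq> (\<Union>n\<in>C. G n)"
    by (rule compactE_image[OF compact, rotated]) (auto simp: G_def)
  define N where "N = Max (insert 0 C)"
  have "(\<Union>n\<in>C. G n) \<subseteq> G N"
    using C(1) mono by (intro UN_least) (simp add: N_def)
  then have "coupled (Suc N) (1 / real (Suc N)) x y" if "w x \<le> R" "w y \<le> R" for x y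
  proof -
    have "(x, y) \<in> G N" using that C(2) \<open>(\<Union>n\<in>C. G n) \<subseteq> G N\<close> by blast
    then have "(x, y) \<in> {z. coupled (Suc N) (1 / real (Suc N)) (fst z) (snd z)}"
      unfolding G_def by (rule subsetD[OF interior_subset])
    then show ?thesis by simp
  qed
  then show ?thesis by (intro exI[of _ "Suc N"] exI[of _ "1 / real (Suc N)"]) auto
qed

text \<open>The weighted oscillation seminorm of Hairer and Mattingly.\<close>

definition oscillation_le :: "real \<Rightarrow> real \<Rightarrow> (real^'l \<Rightarrow> real) \<Rightarrow> bool" where
  "oscillation_le \<beta> A \<phi> \<longleftrightarrow> (\<forall>x y. \<phi> x - \<phi> y \<le> A * (2 + \<beta> * (w x + w y)))"

text \<open>A bound on weighted differences is a bound on the weighted distance to a constant: it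
  says that every value of the lower envelope lies below every value of the upper one, and
  \<open>s\<close> is the supremum of the former.\<close>

lemma oscillation_le_center:
  assumes "oscillation_le \<beta> A \<phi>"
  obtains s where "\<And>x. \<bar>\<phi> x - s\<bar> \<le> A * (1 + \<beta> * w x)"
proof -
  have le: "\<phi> x - A * (1 + \<beta> * w x) \<le> \<phi> y + A * (1 + \<beta> * w y)" for x y
    using assms unfolding oscillation_le_def by (simp add: algebra_simps)
  define s where "s = (SUP x. \<phi> x - A * (1 + \<beta> * w x))"
  have "\<phi> x - A * (1 + \<beta> * w x) \<le> s" for x
    unfolding s_def using le[of _ 0] by (intro cSUP_upper) (auto intro!: bdd_aboveI2)
  moreover have "s \<le> \<phi> y + A * (1 + \<beta> * w y)" for y
    unfolding s_def using le[of _ y] by (intro cSUP_least) auto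
  ultimately show ?thesis by (intro that[of s]) (simp add: abs_le_iff algebra_simps)
qed

lemma oscillation_contraction:
  "\<exists>T \<alpha> \<beta>. 1 \<le> T \<and> 0 < \<alpha> \<and> \<alpha> < 1 \<and> 0 < \<beta> \<and>
    (\<forall>c A \<phi>. wbound c \<phi> \<longrightarrow> 0 \<le> A \<longrightarrow> oscillation_le \<beta> A \<phi> \<longrightarrow> oscillation_le \<beta> (\<alpha> * A) (P T \<phi>))"
proof -
  obtain Kd where Kd: "0 \<le> Kd" "\<And>t x. 1 \<le> t \<Longrightarrow> P t w x \<le> w x / 2 + Kd"
    using drift_iterate by auto
  \<comment> \<open>For \<open>w x + w y\<close> at least \<open>R\<close> the drift constant
    \<open>2 * Kd\<close> is at most a quarter of that sum; the summand 2 keeps \<open>R\<close>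
    positive.\<close>
  define R where "R = 8 * Kd + 2"
  have R: "0 < R" using Kd by (simp add: R_def)
  obtain T a where T: "1 \<le> T" and a: "0 < (a::real)" "a \<le> 1"
    and coupled: "\<And>x y. w x \<le> R \<Longrightarrow> w y \<le> R \<Longrightarrow> coupled T a x y"
    using uniformly_coupled[of R] by blast
  \<comment> \<open>Small enough that the drift constant costs at most \<open>a\<close> near the
    centre, half of the gain \<open>2 * a\<close> from the overlap.\<close>
  define \<beta> where "\<beta> = a / (2 * Kd + 1)"
  have \<beta>: "0 < \<beta>" using a Kd by (simp add: \<beta>_def)
  have \<beta>Kd: "\<beta> * (2 * Kd) \<le> a"
  proof -
    have "\<beta> * (2 * Kd) \<le> \<beta> * (2 * Kd + 1)" using \<beta> by simp
    also have "\<dots> = a" using Kd by (simp add: \<beta>_def)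
    finally show ?thesis .
  qed
  \<comment> \<open>The factor for the far region: the corresponding ratio decreases in
    \<open>w x + w y\<close>, hence is worst at \<open>R\<close>.\<close>
  define \<alpha>1 where "\<alpha>1 = (2 + \<beta> * R * (3/4)) / (2 + \<beta> * R)"
  \<comment> \<open>Near the centre, \<open>1 - a / 2\<close> is the factor of the constant part and
    \<open>1 / 2\<close> that of the weights.\<close>
  define \<alpha> where "\<alpha> = max \<alpha>1 (max (1 - a / 2) (1 / 2))"
  have \<beta>R: "0 < \<beta> * R" using \<beta> R by simp
  have "\<alpha>1 < 1" unfolding \<alpha>1_def using \<beta>R by (subst divide_less_eq_1_pos) linarith+
  then have \<alpha>: "0 < \<alpha>" "\<alpha> < 1" using a by (auto simp: \<alpha>_def)
  have \<alpha>_ge: "1 - a / 2 \<le> \<alpha>" "1 / 2 \<le> \<alpha>" unfolding \<alpha>_def by linarith+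
  have "oscillation_le \<beta> (\<alpha> * A) (P T \<phi>)"
    if \<phi>: "wbound c \<phi>" and A: "0 \<le> A" and osc: "oscillation_le \<beta> A \<phi>" for c A \<phi>
    unfolding oscillation_le_def
  proof (intro allI)
    fix x y
    obtain s where s: "\<And>x. \<bar>\<phi> x - s\<bar> \<le> A * (1 + \<beta> * w x)"
      using oscillation_le_center[OF osc] by blast
    define \<psi> where "\<psi> z = \<phi> z - s" for z
    have \<psi>: "wbound (c + \<bar>s\<bar>) \<psi>" unfolding \<psi>_def by (rule wbound_diff_const[OF \<phi>])
    have [measurable]: "\<psi> \<in> borel_measurable borel" using \<psi> by (rule wboundD)
    have P\<psi>: "P T \<psi> z = P T \<phi> z - s" for z
      using P_diff_const[OF \<phi>] by (simp add: \<psi>_def[abs_def])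
    define S where "S = w x + w y"
    have S0: "0 \<le> S" by (simp add: S_def)
    have Pw: "P T w x + P T w y \<le> S / 2 + 2 * Kd"
      using add_mono[OF Kd(2)[OF T, of x] Kd(2)[OF T, of y]]
      by (simp only: S_def add_divide_distrib mult_2 ac_simps)
    have goal: "P T \<psi> x - P T \<psi> y \<le> \<alpha> * A * (2 + \<beta> * S)"
    proof (cases "R \<le> S")
      case True
      have g: "wbound (\<bar>A\<bar> + \<bar>A * \<beta>\<bar> * 1) (\<lambda>z. A + (A * \<beta>) * w z)"
        by (intro wbound_add wbound_cmult wbound_w wbound_const)
      have Pg: "P T (\<lambda>z. A + (A * \<beta>) * w z) z = A + A * \<beta> * P T w z" for z
        using P_add[OF wbound_const wbound_cmult[OF wbound_w], of T A "A * \<beta>" z]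
        by (simp only: P_cmult P_const)
      have abs: "\<bar>P T \<psi> z\<bar> \<le> A + A * \<beta> * P T w z" for z
      proof -
        have "\<bar>P T \<psi> z\<bar> \<le> P T (\<lambda>z. \<bar>\<psi> z\<bar>) z" unfolding P_def by (rule integral_abs_bound)
        also have "\<dots> \<le> P T (\<lambda>z. A + (A * \<beta>) * w z) z"
        proof (rule P_mono[OF _ g])
          show "wbound (c + \<bar>s\<bar>) (\<lambda>z. \<bar>\<psi> z\<bar>)" using \<psi> by (auto simp: wbound_def)
          show "\<bar>\<psi> z\<bar> \<le> A + A * \<beta> * w z" for z using s[of z] by (simp add: \<psi>_def algebra_simps)
        qed
        finally show ?thesis by (simp add: Pg)
      qed
      have "P T \<psi> x - P T \<psi> y \<le> A * (2 + \<beta> * (P T w x + P T w y))"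
        using abs[of x] abs[of y] by (simp add: algebra_simps abs_le_iff)
      also have "\<dots> \<le> A * (2 + \<beta> * (S / 2 + 2 * Kd))"
        using A \<beta> Pw by (intro mult_left_mono add_left_mono) auto
      also have "\<dots> \<le> A * (2 + \<beta> * S * (3/4))"
      proof -
        have "S / 2 + 2 * Kd \<le> S * (3/4)" using True by (simp add: R_def)
        then have "\<beta> * (S / 2 + 2 * Kd) \<le> \<beta> * (S * (3/4))" using \<beta> by (intro mult_left_mono) auto
        then show ?thesis using A by (intro mult_left_mono) auto
      qed
      also have "\<dots> \<le> A * (\<alpha>1 * (2 + \<beta> * S))"
      proof (intro mult_left_mono A)
        have "\<beta> * R \<le> \<beta> * S" using True \<beta> by simp
        moreover have "(2 + v * (3/4)) * (2 + u) \<le> (2 + u * (3/4)) * (2 + v)" if "u \<le> v" for u v :: real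
          using that by (simp add: field_simps)
        ultimately have "(2 + \<beta> * S * (3/4)) * (2 + \<beta> * R) \<le> (2 + \<beta> * R * (3/4)) * (2 + \<beta> * S)"
          by blast
        then show "2 + \<beta> * S * (3/4) \<le> \<alpha>1 * (2 + \<beta> * S)"
          using \<beta>R by (simp add: \<alpha>1_def pos_le_divide_eq)
      qed
      also have "\<dots> \<le> A * (\<alpha> * (2 + \<beta> * S))"
        using A \<beta> S0 by (intro mult_left_mono mult_right_mono) (auto simp: \<alpha>_def)
      finally show ?thesis by (simp add: ac_simps)
    next
      case False
      then have "w x \<le> R" "w y \<le> R" using w_ge_1[of x] w_ge_1[of y] by (auto simp: S_def)
      note cpl = coupled[OF this, unfolded coupled_def, rule_format]
      \<comment> \<open>Overlap controls bounded functions only, so \<open>\<psi>\<close> is clipped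
        at \<open>A\<close>. The remainder is at most \<open>A * \<beta> * w z\<close> by the
        centred bound and is left to the drift.\<close>
      define \<psi>1 where "\<psi>1 z = max (- A) (min A (\<psi> z))" for z
      define \<psi>2 where "\<psi>2 z = \<psi> z - \<psi>1 z" for z
      have [measurable]: "\<psi>1 \<in> borel_measurable borel" "\<psi>2 \<in> borel_measurable borel"
        unfolding \<psi>1_def[abs_def] \<psi>2_def[abs_def] by measurable
      have \<psi>1: "\<bar>\<psi>1 z\<bar> \<le> A" for z using A by (auto simp: \<psi>1_def)
      have \<psi>2: "\<bar>\<psi>2 z\<bar> \<le> (A * \<beta>) * w z" for z
      proof -
        have "0 \<le> (A * \<beta>) * w z" using A \<beta> by simp
        then show ?thesis using s[of z] A by (auto simp: \<psi>2_def \<psi>1_def \<psi>_def algebra_simps)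
      qed
      have w1: "wbound A \<psi>1" using \<psi>1 by (intro wbound_bounded) auto
      have w2: "wbound (A * \<beta>) \<psi>2" using \<psi>2 by (simp add: wbound_def)
      have split: "P T \<psi> z = P T \<psi>1 z + P T \<psi>2 z" for z
        using P_add[OF w1 w2, of T z] by (simp add: \<psi>2_def)
      have "P T \<psi>1 x - P T \<psi>1 y \<le> A * (2 * (1 - a))"
      proof (cases "A = 0")
        case True
        then have "\<psi>1 = (\<lambda>_. 0)" using \<psi>1 by fastforce
        then show ?thesis using True by simp
      next
        case False
        then have "0 < A" using A by simp
        have "P T (\<lambda>z. (1 / A) * \<psi>1 z) x - P T (\<lambda>z. (1 / A) * \<psi>1 z) y \<le> 2 * (1 - a)"
        proof (rule cpl)
          show "\<bar>1 / A * \<psi>1 z\<bar> \<le> 1" for z using \<psi>1[of z] \<open>0 < A\<close> by (simp add: abs_mult)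
        qed measurable
        then have "(P T \<psi>1 x - P T \<psi>1 y) / A \<le> 2 * (1 - a)"
          unfolding P_cmult by (simp add: diff_divide_distrib)
        then show ?thesis using \<open>0 < A\<close> by (simp add: divide_le_eq mult.commute)
      qed
      moreover have "P T \<psi>2 x - P T \<psi>2 y \<le> (A * \<beta>) * (P T w x + P T w y)"
        using P_abs_le[OF w2, of T x] P_abs_le[OF w2, of T y] by (simp add: abs_le_iff algebra_simps)
      moreover have "(A * \<beta>) * (P T w x + P T w y) \<le> (A * \<beta>) * (S / 2 + 2 * Kd)"
        using Pw A \<beta> by (intro mult_left_mono) auto
      moreover have "(A * \<beta>) * (S / 2 + 2 * Kd) = A * (\<beta> * S / 2 + \<beta> * (2 * Kd))"
        by (simp add: algebra_simps)
      moreover have "A * (\<beta> * S / 2 + \<beta> * (2 * Kd)) \<le> A * (\<beta> * S / 2 + a)"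
        using A \<beta>Kd by (intro mult_left_mono) auto
      ultimately have "P T \<psi> x - P T \<psi> y \<le> A * (2 * (1 - a)) + A * (\<beta> * S / 2 + a)"
        unfolding split by linarith
      also have "\<dots> = A * ((1 - a / 2) * 2 + (1 / 2) * (\<beta> * S))" by (simp add: algebra_simps)
      also have "\<dots> \<le> A * (\<alpha> * 2 + \<alpha> * (\<beta> * S))"
        using A S0 \<beta> by (intro mult_left_mono add_mono mult_right_mono \<alpha>_ge) auto
      finally show ?thesis by (simp add: algebra_simps)
    qed
    then show "P T \<phi> x - P T \<phi> y \<le> \<alpha> * A * (2 + \<beta> * (w x + w y))"
      by (simp add: P\<psi> S_def)
  qed
  then show ?thesis using T \<alpha> \<beta> by blast
qed

text \<open>Contraction of oscillations compares two starting points; integrating the second one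
  against \<open>\<pi>\<close> replaces it by the invariant mean. This is possible because
  \<open>w\<close> is integrable under \<open>\<pi>\<close>, and \<open>1 \<le> w x\<close> absorbs
  the integral \<open>W\<close> into the weight.\<close>

theorem geometric_ergodicity:
  "\<exists>C \<rho>. 0 \<le> C \<and> 0 < \<rho> \<and> \<rho> < 1 \<and>
    (\<forall>c f t x. wbound c f \<longrightarrow> \<bar>P t f x - (\<integral>y. f y \<partial>\<pi>)\<bar> \<le> C * \<rho> ^ t * c * w x)"
proof -
  interpret \<pi>: prob_space \<pi> by (rule \<pi>_prob)
  obtain T \<alpha> \<beta> where T: "1 \<le> T" and \<alpha>: "0 < \<alpha>" "\<alpha> < 1" and \<beta>: "0 < \<beta>"
    and contr: "\<And>c A \<phi>. wbound c \<phi> \<Longrightarrow> 0 \<le> A \<Longrightarrow> oscillation_le \<beta> A \<phi> \<Longrightarrow> oscillation_le \<beta> (\<alpha> * A) (P T \<phi>)"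
    using oscillation_contraction by blast
  have iter: "oscillation_le \<beta> (\<alpha> ^ k * A) (P (k * T) \<phi>)"
    if "wbound c \<phi>" "0 \<le> A" "oscillation_le \<beta> A \<phi>" for c A \<phi> k
  proof (induction k)
    case 0
    then show ?case using that(3) by (simp add: P_0[abs_def] oscillation_le_def)
  next
    case (Suc k)
    have "oscillation_le \<beta> (\<alpha> * (\<alpha> ^ k * A)) (P T (P (k * T) \<phi>))"
      using \<alpha> that(2) by (intro contr[OF P_wbound[OF that(1)] _ Suc.IH]) auto
    moreover have "P T (P (k * T) \<phi>) = P (Suc k * T) \<phi>"
      using P_P_add[OF that(1), of T "k * T"] by (intro ext) simp
    ultimately show ?case by (simp add: mult.assoc)
  qed
  obtain \<rho> where \<rho>: "0 < \<rho>" "\<rho> < 1" "\<And>t k. t \<le> (k + 1) * T \<Longrightarrow> \<alpha> ^ k \<le> (1 / \<alpha> ^ 1) * \<rho> ^ t"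
    using geometric_subsequence[OF \<alpha> T, of 1] by auto
  define W where "W = (\<integral>y. w y \<partial>\<pi>)"
  have W: "0 \<le> W" unfolding W_def by (intro Bochner_Integration.integral_nonneg) auto
  \<comment> \<open>\<open>B ^ T\<close> pays for the fewer than \<open>T\<close> remaining steps,
    \<open>2 / \<beta> + 1\<close> for passing from a weighted bound to an oscillation bound and
    back, and \<open>1 / \<alpha>\<close> for rounding the time to full blocks.\<close>
  define D where "D = B ^ T * (2 / \<beta> + 1) / \<alpha>"
  have D: "0 \<le> D" using B_ge_1 \<beta> \<alpha> by (simp add: D_def)
  have main: "\<bar>P t f x - (\<integral>y. f y \<partial>\<pi>)\<bar> \<le> D * (1 + W) * \<rho> ^ t * c * w x" if f: "wbound c f" for c f t x
  proof -
    define k j where "k = t div T" and "j = t mod T"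
    have j: "j < T" using T by (simp add: j_def)
    have t: "t = k * T + j" by (simp add: k_def j_def)
    have c: "0 \<le> c" by (rule wbound_nonneg[OF f])
    have "c * B ^ j \<le> c * B ^ T" using c B_ge_1 j by (intro mult_left_mono power_increasing) auto
    then have Pj: "wbound (c * B ^ T) (P j f)" using P_wbound[OF f] wbound_mono by blast
    have "oscillation_le \<beta> (c * B ^ T / \<beta>) (P j f)"
      unfolding oscillation_le_def
    proof (intro allI)
      fix x y
      have "P j f x - P j f y \<le> c * B ^ T * (w x + w y)"
        using wboundD(2)[OF Pj, of x] wboundD(2)[OF Pj, of y] by (simp add: abs_le_iff algebra_simps)
      also have "\<dots> = c * B ^ T / \<beta> * (\<beta> * (w x + w y))" using \<beta> by simp
      also have "\<dots> \<le> c * B ^ T / \<beta> * (2 + \<beta> * (w x + w y))"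
        using c B_ge_1 \<beta> by (intro mult_left_mono) auto
      finally show "P j f x - P j f y \<le> c * B ^ T / \<beta> * (2 + \<beta> * (w x + w y))" .
    qed
    then have "oscillation_le \<beta> (\<alpha> ^ k * (c * B ^ T / \<beta>)) (P (k * T) (P j f))"
      using c B_ge_1 \<beta> by (intro iter[OF Pj]) auto
    also have "P (k * T) (P j f) = P t f" using P_P_add[OF f, of "k * T" j] by (intro ext) (simp add: t)
    finally have osc: "oscillation_le \<beta> (\<alpha> ^ k * (c * B ^ T / \<beta>)) (P t f)" .
    define E where "E = D * \<rho> ^ t * c"
    have E: "0 \<le> E" using D \<rho> c by (simp add: E_def)
    have diff: "P t f x - P t f y \<le> E * (w x + w y)" for x y
    proof -
      have "2 \<le> 2 * (w x + w y)" using w_ge_1[of x] w_ge_1[of y] by simp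
      then have "P t f x - P t f y \<le> (\<alpha> ^ k * (c * B ^ T / \<beta>)) * (2 * (w x + w y) + \<beta> * (w x + w y))"
        using c B_ge_1 \<beta> \<alpha>
        by (intro order_trans[OF osc[unfolded oscillation_le_def, rule_format]] mult_left_mono) auto
      also have "\<dots> = \<alpha> ^ k * (c * B ^ T * (2 / \<beta> + 1) * (w x + w y))"
        using \<beta> by (simp add: field_simps)
      also have "\<dots> \<le> ((1 / \<alpha> ^ 1) * \<rho> ^ t) * (c * B ^ T * (2 / \<beta> + 1) * (w x + w y))"
        using c B_ge_1 \<beta> j t by (intro mult_right_mono \<rho>(3)) auto
      also have "\<dots> = E * (w x + w y)" by (simp add: E_def D_def)
      finally show ?thesis .
    qed
    have int: "integrable \<pi> (P t f)" by (rule integrable_invariant[OF P_wbound[OF f]])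
    have intw: "integrable \<pi> (\<lambda>y. E * (w x + w y))" using integrable_w_invariant by simp
    have "(\<integral>y. P t f x - P t f y \<partial>\<pi>) \<le> (\<integral>y. E * (w x + w y) \<partial>\<pi>)"
      using diff int intw by (intro integral_mono) auto
    moreover have "(\<integral>y. P t f y - P t f x \<partial>\<pi>) \<le> (\<integral>y. E * (w x + w y) \<partial>\<pi>)"
      using diff int intw by (intro integral_mono) (auto simp: add.commute)
    moreover have "(\<integral>y. E * (w x + w y) \<partial>\<pi>) = E * (w x + W)"
      using integrable_w_invariant by (simp add: W_def \<pi>.prob_space)
    moreover have "(\<integral>y. P t f x - P t f y \<partial>\<pi>) = P t f x - (\<integral>y. f y \<partial>\<pi>)"
      "(\<integral>y. P t f y - P t f x \<partial>\<pi>) = (\<integral>y. f y \<partial>\<pi>) - P t f x"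
      using int integral_P_invariant[OF f, of t] by (simp_all add: \<pi>.prob_space)
    ultimately have "\<bar>P t f x - (\<integral>y. f y \<partial>\<pi>)\<bar> \<le> E * (w x + W)"
      by linarith
    also have "\<dots> \<le> E * ((1 + W) * w x)"
      using E W mult_left_mono[OF w_ge_1 W, of x] by (intro mult_left_mono) (auto simp: algebra_simps)
    finally show ?thesis by (simp add: E_def ac_simps)
  qed
  show ?thesis using main D W \<rho> by (intro exI[of _ "D * (1 + W)"] exI[of _ \<rho>]) auto
qed

end

section \<open>Averages along segments\<close>

text \<open>The uniform law on [0, 1]. As a probability measure it forms a product with
  \<open>M\<close>, so that averages over segments and over noise can be exchanged.\<close>

definition unit_measure :: "real measure" where
  "unit_measure = restrict_space lborel {0..1}"

lemma prob_space_unit_measure: "prob_space unit_measure"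
  by (rule prob_spaceI) (simp add: unit_measure_def space_restrict_space emeasure_restrict_space)

lemma space_unit_measure [simp]: "space unit_measure = {0..1}"
  by (simp add: unit_measure_def space_restrict_space)

lemma measurable_unit_measure: "f \<in> borel_measurable borel \<Longrightarrow> f \<in> borel_measurable unit_measure"
  unfolding unit_measure_def by (rule measurable_restrict_space1) simp

lemma continuous_unit_measure:
  fixes f :: "real \<Rightarrow> real"
  assumes "continuous_on {0..1} f"
  shows "integrable unit_measure f" "(\<integral>\<sigma>. f \<sigma> \<partial>unit_measure) = integral {0..1} f"
proof -
  have si: "set_integrable lborel {0..1} f"
    by (rule borel_integrable_atLeastAtMost') fact
  then show "integrable unit_measure f"
    by (simp add: unit_measure_def set_integrable_def integrable_restrict_space)
  have "(\<integral>\<sigma>. f \<sigma> \<partial>unit_measure) = (LINT \<sigma>:{0..1}|lborel. f \<sigma>)"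
    by (simp add: unit_measure_def set_lebesgue_integral_def integral_restrict_space)
  also have "\<dots> = integral {0..1} f" by (rule set_borel_integral_eq_integral(2)[OF si])
  finally show "(\<integral>\<sigma>. f \<sigma> \<partial>unit_measure) = integral {0..1} f" .
qed

lemma continuous_segment:
  fixes q :: "real^'l::finite \<Rightarrow> real"
  shows "continuous_on UNIV q \<Longrightarrow> continuous_on S (\<lambda>\<sigma>. q (x + (\<sigma> * r) *\<^sub>R axis i 1))"
  by (rule continuous_on_compose2) (auto intro!: continuous_intros)

text \<open>The fundamental theorem of calculus is used rather than the mean value theorem, whose
  intermediate point would depend on the noise path. An average along the segment is compatible with
  taking expectations afterwards.\<close>

lemma partial_segment_bound:
  fixes g q :: "real^'l::finite \<Rightarrow> real"
  assumes g: "C1_partials g" and q: "continuous_on UNIV q"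
    and bound: "\<And>z. \<bar>partial i g z\<bar> \<le> q z"
  shows "\<bar>g (x + r *\<^sub>R axis i 1) - g x\<bar>
    \<le> \<bar>r\<bar> * (\<integral>\<sigma>. q (x + (\<sigma> * r) *\<^sub>R axis i 1) \<partial>unit_measure)"
proof -
  have "((\<lambda>\<sigma>. g (x + (\<sigma> * r) *\<^sub>R axis i 1)) has_real_derivative
          partial i g (x + (\<sigma> * r) *\<^sub>R axis i 1) * r) (at \<sigma>)" for \<sigma>
    by (rule DERIV_chain'[of "\<lambda>\<sigma>. \<sigma> * r" r \<sigma> UNIV "\<lambda>s. g (x + s *\<^sub>R axis i 1)", simplified mult.commute])
      (use g in \<open>auto intro!: derivative_eq_intros has_partial_DERIV simp: mult.commute C1_partials_def\<close>)
  then have "((\<lambda>\<sigma>. partial i g (x + (\<sigma> * r) *\<^sub>R axis i 1) * r) has_integral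
      (g (x + (1 * r) *\<^sub>R axis i 1) - g (x + (0 * r) *\<^sub>R axis i 1))) {0..1}"
    by (intro fundamental_theorem_of_calculus)
       (auto simp: has_real_derivative_iff_has_vector_derivative[symmetric] intro: DERIV_subset)
  then have hi: "((\<lambda>\<sigma>. partial i g (x + (\<sigma> * r) *\<^sub>R axis i 1) * r) has_integral
      (g (x + r *\<^sub>R axis i 1) - g x)) {0..1}" by simp
  have ci: "continuous_on {0..1} (\<lambda>\<sigma>. \<bar>r\<bar> * q (x + (\<sigma> * r) *\<^sub>R axis i 1))"
    by (intro continuous_intros continuous_segment q)
  have "norm (integral {0..1} (\<lambda>\<sigma>. partial i g (x + (\<sigma> * r) *\<^sub>R axis i 1) * r))
      \<le> integral {0..1} (\<lambda>\<sigma>. \<bar>r\<bar> * q (x + (\<sigma> * r) *\<^sub>R axis i 1))"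
  proof (rule Henstock_Kurzweil_Integration.integral_norm_bound_integral)
    show "(\<lambda>\<sigma>. partial i g (x + (\<sigma> * r) *\<^sub>R axis i 1) * r) integrable_on {0..1}"
      using hi by blast
    show "(\<lambda>\<sigma>. \<bar>r\<bar> * q (x + (\<sigma> * r) *\<^sub>R axis i 1)) integrable_on {0..1}"
      by (rule integrable_continuous_interval[OF ci])
    show "norm (partial i g (x + (\<sigma> * r) *\<^sub>R axis i 1) * r) \<le> \<bar>r\<bar> * q (x + (\<sigma> * r) *\<^sub>R axis i 1)" for \<sigma>
      using bound by (simp add: abs_mult mult.commute mult_left_mono)
  qed
  also have "\<dots> = (\<integral>\<sigma>. \<bar>r\<bar> * q (x + (\<sigma> * r) *\<^sub>R axis i 1) \<partial>unit_measure)"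
    by (rule continuous_unit_measure(2)[OF ci, symmetric])
  also have "integral {0..1} (\<lambda>\<sigma>. partial i g (x + (\<sigma> * r) *\<^sub>R axis i 1) * r) = g (x + r *\<^sub>R axis i 1) - g x"
    by (rule integral_unique[OF hi])
  finally show ?thesis by simp
qed

lemma segment_average_tendsto:
  fixes q :: "real^'l::finite \<Rightarrow> real"
  assumes q: "continuous_on UNIV q"
  shows "((\<lambda>r. \<integral>\<sigma>. q (x + (\<sigma> * r) *\<^sub>R axis i 1) \<partial>unit_measure) \<longlongrightarrow> q x) (at 0)"
proof (rule tendstoI)
  interpret U: prob_space unit_measure by (rule prob_space_unit_measure)
  fix e :: real assume e: "0 < e"
  have "isCont q x" using q by (simp add: continuous_on_eq_continuous_at)
  then obtain d where d: "0 < d" "\<And>y. dist y x < d \<Longrightarrow> dist (q y) (q x) < e / 2"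
    unfolding continuous_at_eps_delta using e by (metis half_gt_zero)
  show "\<forall>\<^sub>F r in at 0. dist (\<integral>\<sigma>. q (x + (\<sigma> * r) *\<^sub>R axis i 1) \<partial>unit_measure) (q x) < e"
    unfolding eventually_at
  proof (intro exI[of _ d] conjI ballI impI d(1))
    fix r :: real assume "r \<noteq> 0 \<and> dist r 0 < d"
    then have r: "\<bar>r\<bar> < d" by simp
    let ?f = "\<lambda>\<sigma>. q (x + (\<sigma> * r) *\<^sub>R axis i 1)"
    have int: "integrable unit_measure ?f"
      by (intro continuous_unit_measure continuous_segment q)
    have close: "\<bar>?f \<sigma> - q x\<bar> \<le> e / 2" if "\<sigma> \<in> {0..1}" for \<sigma>
    proof -
      have "\<bar>\<sigma> * r\<bar> \<le> \<bar>r\<bar>" using that by (simp add: abs_mult mult_left_le_one_le)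
      then have "dist (x + (\<sigma> * r) *\<^sub>R axis i 1) x < d" using r by (simp add: dist_norm)
      from d(2)[OF this] show ?thesis by (simp add: dist_real_def)
    qed
    have "\<bar>\<integral>\<sigma>. ?f \<sigma> - q x \<partial>unit_measure\<bar> \<le> (\<integral>\<sigma>. \<bar>?f \<sigma> - q x\<bar> \<partial>unit_measure)"
      by (rule integral_abs_bound)
    also have "\<dots> \<le> (\<integral>\<sigma>. e / 2 \<partial>unit_measure)"
      using close int by (intro integral_mono) auto
    also have "\<dots> < e" using e by (simp add: U.prob_space del: space_unit_measure)
    finally show "dist (\<integral>\<sigma>. ?f \<sigma> \<partial>unit_measure) (q x) < e"
      using int by (simp add: dist_real_def U.prob_space del: space_unit_measure)
  qed
qed

section \<open>Smoothing\<close>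

context smooth_markov_flow
begin

text \<open>\<open>K ^ t\<close> bounds the derivative of the flow, and \<open>real CARD('l)\<close>
  comes from summing over the partial derivatives of the outer function.\<close>

definition jac :: "nat \<Rightarrow> real" where
  "jac t = K ^ t * real CARD('l)"

lemma jac_nonneg: "0 \<le> jac t"
  using K_nonneg by (simp add: jac_def)

lemma path_C1:
  assumes g: "C1_partials g" and d: "\<And>j z. \<bar>partial j g z\<bar> \<le> d * w z" and \<omega>: "\<omega> \<in> space M"
  shows "C1_partials (\<lambda>z. g (F t z \<omega>))"
    and "\<bar>partial i (\<lambda>z. g (F t z \<omega>)) x\<bar> \<le> jac t * d * w (F t x \<omega>)"
proof -
  show "C1_partials (\<lambda>z. g (F t z \<omega>))" by (rule C1_partials_compose(1)[OF g F_C1[OF \<omega>]])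
  have "\<bar>partial i (\<lambda>z. g (F t z \<omega>)) x\<bar> \<le> K ^ t * (\<Sum>j\<in>UNIV. \<bar>partial j g (F t x \<omega>)\<bar>)"
    by (rule C1_partials_compose(2)[OF g F_C1[OF \<omega>]])
  also have "\<dots> \<le> K ^ t * (\<Sum>j\<in>(UNIV::'l set). d * w (F t x \<omega>))"
    using d K_nonneg by (intro mult_left_mono sum_mono) auto
  also have "\<dots> = jac t * d * w (F t x \<omega>)" by (simp add: jac_def)
  finally show "\<bar>partial i (\<lambda>z. g (F t z \<omega>)) x\<bar> \<le> jac t * d * w (F t x \<omega>)" .
qed

lemma w_path_continuous:
  assumes "\<omega> \<in> space M"
  shows "continuous_on UNIV (\<lambda>x. w (F t x \<omega>))"
  using continuous_on_compose2[OF w_continuous F_continuous[OF assms]] by simp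

text \<open>Fubini turns the expected segment average into the segment average of
  \<open>P t w\<close>. It applies because \<open>P t w\<close> is at most \<open>B ^ t * w\<close>,
  which is bounded on the segment.\<close>

lemma segment_average_path:
  fixes t x r i
  defines "Z \<equiv> \<lambda>\<omega>. \<integral>\<sigma>. w (F t (x + (\<sigma> * r) *\<^sub>R axis i 1) \<omega>) \<partial>unit_measure"
  shows "integrable M Z"
    and "(\<integral>\<omega>. Z \<omega> \<partial>M) = (\<integral>\<sigma>. P t w (x + (\<sigma> * r) *\<^sub>R axis i 1) \<partial>unit_measure)"
    and "integrable unit_measure (\<lambda>\<sigma>. P t w (x + (\<sigma> * r) *\<^sub>R axis i 1))"
proof -
  interpret U: prob_space unit_measure by (rule prob_space_unit_measure)
  interpret pair_prob_space unit_measure M ..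
  let ?z = "\<lambda>\<sigma>. x + (\<sigma> * r) *\<^sub>R axis i 1"
  have z [measurable]: "?z \<in> borel_measurable unit_measure"
    by (rule measurable_unit_measure) measurable
  have meas: "(\<lambda>(\<sigma>, \<omega>). w (F t (?z \<sigma>) \<omega>)) \<in> borel_measurable (unit_measure \<Otimes>\<^sub>M M)"
    by measurable
  have Pmeas: "(\<lambda>\<sigma>. P t w (?z \<sigma>)) \<in> borel_measurable unit_measure"
    by (rule measurable_compose[OF z P_borel[OF w_borel]])
  have "bounded ((\<lambda>\<sigma>. w (?z \<sigma>)) ` {0..1})"
    by (intro compact_imp_bounded compact_continuous_image continuous_segment w_continuous) simp
  then obtain C where C: "\<forall>\<sigma>\<in>{0..1}. \<bar>w (?z \<sigma>)\<bar> \<le> C" unfolding bounded_iff by auto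
  show int: "integrable unit_measure (\<lambda>\<sigma>. P t w (?z \<sigma>))"
  proof (rule U.integrable_const_bound[OF _ Pmeas, of "B ^ t * C"], rule AE_I2)
    fix \<sigma> assume "\<sigma> \<in> space unit_measure"
    then have "B ^ t * w (?z \<sigma>) \<le> B ^ t * C" using C B_ge_1 by (intro mult_left_mono) auto
    then show "norm (P t w (?z \<sigma>)) \<le> B ^ t * C"
      using P_w_le[of t "?z \<sigma>"] P_nonneg[of w t "?z \<sigma>"] by simp
  qed
  have prod: "integrable (unit_measure \<Otimes>\<^sub>M M) (\<lambda>(\<sigma>, \<omega>). w (F t (?z \<sigma>) \<omega>))"
    using integrable_w int by (intro Fubini_integrable meas) (auto simp: P_def)
  show "integrable M Z" unfolding Z_def using integrable_snd[OF prod] .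
  show "(\<integral>\<omega>. Z \<omega> \<partial>M) = (\<integral>\<sigma>. P t w (?z \<sigma>) \<partial>unit_measure)"
    unfolding Z_def P_def using Fubini_integral[OF prod] .
qed

text \<open>Valid for every \<open>t\<close>, including times at which \<open>P t g\<close> is not
  known to be differentiable; the gradient inequality uses it at time \<open>t0\<close>.\<close>

lemma P_lipschitz:
  assumes g: "C1_partials g" "wbound c g" and d: "\<And>j z. \<bar>partial j g z\<bar> \<le> d * w z"
  shows "\<bar>P t g (x + r *\<^sub>R axis i 1) - P t g x\<bar>
    \<le> \<bar>r\<bar> * (jac t * d * (\<integral>\<sigma>. P t w (x + (\<sigma> * r) *\<^sub>R axis i 1) \<partial>unit_measure))"
proof -
  let ?Z = "\<lambda>\<omega>. \<integral>\<sigma>. w (F t (x + (\<sigma> * r) *\<^sub>R axis i 1) \<omega>) \<partial>unit_measure"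
  note int = integrable_wbound[OF g(2)]
  have "\<bar>\<integral>\<omega>. g (F t (x + r *\<^sub>R axis i 1) \<omega>) - g (F t x \<omega>) \<partial>M\<bar>
      \<le> (\<integral>\<omega>. \<bar>g (F t (x + r *\<^sub>R axis i 1) \<omega>) - g (F t x \<omega>)\<bar> \<partial>M)"
    by (rule integral_abs_bound)
  also have "\<dots> \<le> (\<integral>\<omega>. \<bar>r\<bar> * (jac t * d * ?Z \<omega>) \<partial>M)"
  proof (intro integral_mono)
    show "integrable M (\<lambda>\<omega>. \<bar>g (F t (x + r *\<^sub>R axis i 1) \<omega>) - g (F t x \<omega>)\<bar>)"
      using int by simp
    show "integrable M (\<lambda>\<omega>. \<bar>r\<bar> * (jac t * d * ?Z \<omega>))"
      using segment_average_path(1) by simp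
    fix \<omega> assume \<omega>: "\<omega> \<in> space M"
    have "\<bar>g (F t (x + r *\<^sub>R axis i 1) \<omega>) - g (F t x \<omega>)\<bar>
       \<le> \<bar>r\<bar> * (\<integral>\<sigma>. jac t * d * w (F t (x + (\<sigma> * r) *\<^sub>R axis i 1) \<omega>) \<partial>unit_measure)"
      by (rule partial_segment_bound[of "\<lambda>z. g (F t z \<omega>)" "\<lambda>z. jac t * d * w (F t z \<omega>)"])
         (intro path_C1[OF g(1) d \<omega>] continuous_intros w_path_continuous[OF \<omega>])+
    then show "\<bar>g (F t (x + r *\<^sub>R axis i 1) \<omega>) - g (F t x \<omega>)\<bar> \<le> \<bar>r\<bar> * (jac t * d * ?Z \<omega>)"
      by simp
  qed
  also have "\<dots> = \<bar>r\<bar> * (jac t * d * (\<integral>\<sigma>. P t w (x + (\<sigma> * r) *\<^sub>R axis i 1) \<partial>unit_measure))"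
    using segment_average_path(2)[of t x r i] by simp
  finally show ?thesis unfolding P_def[of t g] using int by simp
qed

text \<open>\<open>P t w\<close> is replaced by a continuous majorant \<open>\<psi>\<close>, such as
  \<open>B ^ t * w\<close> or the sharper one containing \<open>\<kappa>\<close>. Continuity makes
  the segment averages converge to the value at \<open>x\<close>.\<close>

lemma P_partial_le:
  assumes g: "C1_partials g" "wbound c g" and d: "\<And>j z. \<bar>partial j g z\<bar> \<le> d * w z"
    and \<psi>: "continuous_on UNIV \<psi>" "\<And>z. P t w z \<le> \<psi> z"
    and par: "has_partial i (P t g) x"
  shows "\<bar>partial i (P t g) x\<bar> \<le> jac t * d * \<psi> x"
proof (rule partial_le[OF par])
  have d0: "0 \<le> d"
    using order_trans[OF abs_ge_zero d[of _ 0]] w_ge_1[of 0] by (auto simp: zero_le_mult_iff)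
  show "\<forall>\<^sub>F r in at 0. \<bar>P t g (x + r *\<^sub>R axis i 1) - P t g x\<bar>
      \<le> \<bar>r\<bar> * (jac t * d * (\<integral>\<sigma>. \<psi> (x + (\<sigma> * r) *\<^sub>R axis i 1) \<partial>unit_measure))"
  proof (intro always_eventually allI)
    fix r
    have "(\<integral>\<sigma>. P t w (x + (\<sigma> * r) *\<^sub>R axis i 1) \<partial>unit_measure)
        \<le> (\<integral>\<sigma>. \<psi> (x + (\<sigma> * r) *\<^sub>R axis i 1) \<partial>unit_measure)"
      by (intro integral_mono segment_average_path(3) continuous_unit_measure continuous_segment \<psi>)
    then show "\<bar>P t g (x + r *\<^sub>R axis i 1) - P t g x\<bar>
      \<le> \<bar>r\<bar> * (jac t * d * (\<integral>\<sigma>. \<psi> (x + (\<sigma> * r) *\<^sub>R axis i 1) \<partial>unit_measure))"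
      using d0 jac_nonneg by (intro order_trans[OF P_lipschitz[OF g d]] mult_left_mono) auto
  qed
  show "((\<lambda>r. jac t * d * (\<integral>\<sigma>. \<psi> (x + (\<sigma> * r) *\<^sub>R axis i 1) \<partial>unit_measure)) \<longlongrightarrow> jac t * d * \<psi> x) (at 0)"
    by (intro tendsto_intros segment_average_tendsto \<psi>)
qed

section \<open>Regularity coming from the density\<close>

lemma p_locally_lipschitz:
  "\<exists>L\<ge>0. \<forall>x x' y. norm x \<le> \<rho> \<longrightarrow> norm x' \<le> \<rho> \<longrightarrow> norm y \<le> R \<longrightarrow> \<bar>p (x', y) - p (x, y)\<bar> \<le> L * norm (x' - x)"
proof -
  obtain D where D: "\<And>z. (p has_derivative blinfun_apply (D z)) (at z)" "continuous_on UNIV D"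
    using p_C1 unfolding continuously_differentiable_def by blast
  let ?S = "cball 0 \<rho> \<times> cball 0 R :: ((real^'l) \<times> (real^'l)) set"
  have "bounded (D ` ?S)"
    by (intro compact_imp_bounded compact_continuous_image compact_Times compact_cball
        continuous_on_subset[OF D(2)]) auto
  then obtain L where L: "0 < L" "\<forall>z\<in>?S. norm (D z) \<le> L" unfolding bounded_pos by auto
  have "\<bar>p (x', y) - p (x, y)\<bar> \<le> L * norm (x' - x)"
    if "norm x \<le> \<rho>" "norm x' \<le> \<rho>" "norm y \<le> R" for x x' y
  proof -
    have "norm (p (x', y) - p (x, y)) \<le> L * norm ((x', y) - (x, y))"
    proof (rule differentiable_bound[where S="?S" and f'="\<lambda>z. blinfun_apply (D z)"])
      show "convex ?S" by (intro convex_Times convex_cball)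
      show "(p has_derivative blinfun_apply (D z)) (at z within ?S)" for z
        by (rule has_derivative_at_withinI[OF D(1)])
      show "onorm (blinfun_apply (D z)) \<le> L" if "z \<in> ?S" for z
        using bspec[OF L(2) that] by (simp only: norm_blinfun.rep_eq)
    qed (use that in auto)
    then show ?thesis by simp
  qed
  then show ?thesis using L(1) by (intro exI[of _ L]) auto
qed

text \<open>The increment falls on the density, so the estimate involves the weighted bound
  \<open>c\<close> of \<open>u\<close> and not its gradient. The support condition confines the
  integral to bounded \<open>y\<close>, where the increments of \<open>p\<close> are
  controlled.\<close>

lemma P_t0_lipschitz:
  "\<exists>L\<ge>0. \<forall>u c x x'. wbound c u \<longrightarrow> (\<forall>y. R < norm y \<longrightarrow> u y = 0) \<longrightarrow> norm x \<le> \<rho> \<longrightarrow> norm x' \<le> \<rho>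
    \<longrightarrow> \<bar>P t0 u x' - P t0 u x\<bar> \<le> L * c * norm (x' - x)"
proof -
  obtain Lp where Lp: "0 \<le> Lp" "\<forall>x x' y. norm x \<le> \<rho> \<longrightarrow> norm x' \<le> \<rho> \<longrightarrow> norm y \<le> R
      \<longrightarrow> \<bar>p (x', y) - p (x, y)\<bar> \<le> Lp * norm (x' - x)"
    using p_locally_lipschitz[of \<rho> R] by blast
  let ?b = "\<lambda>y. indicator (cball 0 R) y * w y"
  have "bounded (w ` cball 0 R)"
    by (intro compact_imp_bounded compact_continuous_image compact_cball
        continuous_on_subset[OF w_continuous]) auto
  then obtain C where C: "\<forall>y\<in>cball 0 R. \<bar>w y\<bar> \<le> C" unfolding bounded_iff by auto
  have int_b: "integrable lborel ?b"
  proof (rule Bochner_Integration.integrable_bound)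
    show "integrable lborel (\<lambda>y. C * indicator (cball 0 R :: (real^'l) set) y)"
      by (intro integrable_mult_right integrable_real_indicator)
         (use emeasure_lborel_cball_finite in auto)
    show "AE y in lborel. norm (?b y) \<le> norm (C * indicator (cball 0 R) y)"
      using C by (intro AE_I2) (auto simp: indicator_def intro: order_trans[OF _ abs_ge_self])
    have "?b \<in> borel_measurable borel"
      by (intro borel_measurable_times borel_measurable_indicator w_borel) auto
    then show "?b \<in> borel_measurable lborel" by simp
  qed
  define W where "W = (\<integral>y. ?b y \<partial>lborel)"
  have W: "0 \<le> W" unfolding W_def by (intro Bochner_Integration.integral_nonneg) auto
  have "\<bar>P t0 u x' - P t0 u x\<bar> \<le> (Lp * W) * c * norm (x' - x)"
    if u: "wbound c u" and supp: "\<forall>y. R < norm y \<longrightarrow> u y = 0" and x: "norm x \<le> \<rho>" "norm x' \<le> \<rho>"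
    for u c x x'
  proof -
    note d = P_t0_density[OF u]
    have "P t0 u x' - P t0 u x = (\<integral>y. p (x', y) * u y - p (x, y) * u y \<partial>lborel)"
      using d by simp
    also have "\<bar>\<dots>\<bar> \<le> (\<integral>y. \<bar>p (x', y) * u y - p (x, y) * u y\<bar> \<partial>lborel)"
      by (rule integral_abs_bound)
    also have "\<dots> \<le> (\<integral>y. (Lp * norm (x' - x) * c) * ?b y \<partial>lborel)"
    proof (intro integral_mono)
      show "integrable lborel (\<lambda>y. \<bar>p (x', y) * u y - p (x, y) * u y\<bar>)" using d by simp
      show "integrable lborel (\<lambda>y. (Lp * norm (x' - x) * c) * ?b y)" using int_b by simp
      fix y
      show "\<bar>p (x', y) * u y - p (x, y) * u y\<bar> \<le> (Lp * norm (x' - x) * c) * ?b y"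
      proof (cases "norm y \<le> R")
        case True
        have "\<bar>p (x', y) * u y - p (x, y) * u y\<bar> = \<bar>p (x', y) - p (x, y)\<bar> * \<bar>u y\<bar>"
          by (simp add: left_diff_distrib[symmetric] abs_mult)
        also have "\<dots> \<le> (Lp * norm (x' - x)) * (c * w y)"
          using Lp x True wboundD(2)[OF u, of y] by (intro mult_mono) auto
        finally show ?thesis using True by simp
      next
        case False
        then show ?thesis using supp by simp
      qed
    qed
    also have "\<dots> = (Lp * W) * c * norm (x' - x)" by (simp add: W_def)
    finally show ?thesis .
  qed
  then show ?thesis using Lp(1) W by (intro exI[of _ "Lp * W"]) auto
qed

text \<open>Continuity of \<open>P t w\<close> is not clear for small \<open>t\<close>, as nothing makes \<open>w (F t x \<omega>)\<close> locally uniformly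
  integrable in \<open>x\<close>. After one step the weight has gained the factor \<open>\<kappa>\<close>, which makes the tail of the
  density integral negligible; this is why \<open>t0 + 1\<close> steps are needed below.\<close>

lemma P_t0_continuous:
  assumes u [measurable]: "u \<in> borel_measurable borel" and u_le: "\<And>x. \<bar>u x\<bar> \<le> c * (\<kappa> x * w x)"
    and c: "0 \<le> c"
  shows "continuous_on UNIV (P t0 u)"
  unfolding continuous_on_eq_continuous_at[OF open_UNIV] continuous_at_eps_delta
proof (intro ballI allI impI)
  fix x :: "real^'l" and e :: real assume e: "0 < e"
  define \<rho> where "\<rho> = norm x + 1"
  have "bounded (w ` cball 0 \<rho>)"
    by (intro compact_imp_bounded compact_continuous_image compact_cball
        continuous_on_subset[OF w_continuous]) auto
  then obtain W where W: "0 < W" "\<forall>y\<in>cball 0 \<rho>. \<bar>w y\<bar> \<le> W" unfolding bounded_pos by auto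
  define Q where "Q = c * B ^ t0 * W + 1"
  \<comment> \<open>The tail will contribute at most \<open>e / 4\<close> at each of the two points,
    and the truncated function another \<open>e / 4\<close>.\<close>
  define e1 where "e1 = e / (4 * Q)"
  have pos: "0 < Q" unfolding Q_def using c B_ge_1 W by (intro add_nonneg_pos) auto
  have e1: "0 < e1" using e pos by (simp add: e1_def)
  have e1_le: "c * e1 * B ^ t0 * W \<le> e / 4"
  proof -
    have "c * e1 * B ^ t0 * W = e1 * (c * B ^ t0 * W)" by (simp add: ac_simps)
    also have "\<dots> \<le> e1 * Q" using e1 by (simp add: Q_def)
    also have "\<dots> = e / 4" using pos by (simp add: e1_def)
    finally show ?thesis .
  qed
  obtain R where R: "\<And>y. R < norm y \<Longrightarrow> \<kappa> y \<le> e1" using \<kappa>_small[OF e1] by blast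
  define u1 where "u1 y = indicator (cball 0 R) y * u y" for y
  define u2 where "u2 y = u y - u1 y" for y
  have u1 [measurable]: "u1 \<in> borel_measurable borel"
    unfolding u1_def[abs_def] by (intro borel_measurable_times borel_measurable_indicator u) auto
  have [measurable]: "u2 \<in> borel_measurable borel"
    unfolding u2_def[abs_def] by (intro borel_measurable_diff u u1)
  have "c * (\<kappa> y * w y) \<le> c * (1 * w y)" for y
    using c \<kappa>_le_1 by (intro mult_left_mono mult_right_mono) auto
  then have wu: "\<bar>u y\<bar> \<le> c * w y" for y using u_le[of y] by (metis mult_1 order_trans)
  have w1: "wbound c u1"
    using wu c by (auto simp: wbound_def u1_def indicator_def)
  have w2: "wbound (c * e1) u2"
  proof -
    have "\<bar>u2 y\<bar> \<le> c * e1 * w y" for y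
    proof (cases "R < norm y")
      case True
      have "c * (\<kappa> y * w y) \<le> c * (e1 * w y)"
        using c R[OF True] by (intro mult_left_mono mult_right_mono) auto
      then show ?thesis using True u_le[of y] by (simp add: u2_def u1_def indicator_def mult.assoc)
    next
      case False
      then show ?thesis using c e1 by (simp add: u2_def u1_def indicator_def)
    qed
    then show ?thesis by (simp add: wbound_def)
  qed
  have small: "\<bar>P t0 u2 z\<bar> \<le> e / 4" if "norm z \<le> \<rho>" for z
  proof -
    have "\<bar>P t0 u2 z\<bar> \<le> c * e1 * B ^ t0 * w z" using P_wbound[OF w2] by (rule wboundD)
    also have "\<dots> \<le> c * e1 * B ^ t0 * W"
      using W(2) that c e1 B_ge_1 by (intro mult_left_mono) auto
    finally show ?thesis using e1_le by linarith
  qed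
  obtain L where L: "0 \<le> L" "\<And>z. norm z \<le> \<rho> \<Longrightarrow> \<bar>P t0 u1 z - P t0 u1 x\<bar> \<le> L * c * norm (z - x)"
    using P_t0_lipschitz[of R \<rho>] w1 by (auto simp: u1_def \<rho>_def)
  define Q' where "Q' = L * c + 1"
  define \<delta> where "\<delta> = min 1 (e / (4 * Q'))"
  have posL: "0 < Q'" unfolding Q'_def using L(1) c by (intro add_nonneg_pos) auto
  have \<delta>: "0 < \<delta>" using e posL by (simp add: \<delta>_def)
  show "\<exists>d>0. \<forall>x'. dist x' x < d \<longrightarrow> dist (P t0 u x') (P t0 u x) < e"
  proof (intro exI[of _ \<delta>] conjI allI impI \<delta>)
    fix z assume z: "dist z x < \<delta>"
    then have zx: "norm (z - x) < 1" "norm (z - x) \<le> e / (4 * Q')"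
      by (auto simp: dist_norm \<delta>_def)
    have z\<rho>: "norm z \<le> \<rho>" using zx(1) norm_triangle_sub[of z x] by (simp add: \<rho>_def)
    have sx: "\<bar>P t0 u2 x\<bar> \<le> e / 4" by (rule small) (simp add: \<rho>_def)
    have split: "P t0 u y = P t0 u1 y + P t0 u2 y" for y
      using P_add[OF w1 w2, of t0 y] by (simp add: u2_def)
    have "L * c * norm (z - x) \<le> Q' * (e / (4 * Q'))"
      using zx(2) L(1) c posL by (intro mult_mono) (auto simp: Q'_def)
    also have "\<dots> = e / 4" using posL by simp
    finally have "\<bar>P t0 u1 z - P t0 u1 x\<bar> \<le> e / 4" using L(2)[OF z\<rho>] by linarith
    then show "dist (P t0 u z) (P t0 u x) < e"
      using small[OF z\<rho>] sx e unfolding dist_real_def split by linarith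
  qed
qed

lemma P_continuous:
  assumes g: "wbound c g" and t: "t0 + 1 \<le> t"
  shows "continuous_on UNIV (P t g)"
proof -
  obtain s where s: "t = t0 + s" "1 \<le> s" using t by (metis add.assoc le_iff_add le_add1 add.commute)
  have "P t g = P t0 (P s g)" using P_P_add[OF g] s by (intro ext) simp
  moreover have "continuous_on UNIV (P t0 (P s g))"
    using P_abs_le_\<kappa>[OF g s(2)] wboundD(1)[OF P_wbound[OF g]] wbound_nonneg[OF g] B_ge_1
    by (intro P_t0_continuous[of _ "c * B ^ s"]) auto
  ultimately show ?thesis by simp
qed

section \<open>Differentiation under the expectation\<close>

lemma path_partial_measurable:
  assumes g: "C1_partials g" "g \<in> borel_measurable borel"
  shows "(\<lambda>\<omega>. partial i (\<lambda>z. g (F t z \<omega>)) x) \<in> borel_measurable M"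
proof (rule borel_measurable_LIMSEQ_real)
  have [measurable]: "g \<in> borel_measurable borel" by fact
  fix \<omega> assume \<omega>: "\<omega> \<in> space M"
  have "has_partial i (\<lambda>z. g (F t z \<omega>)) x"
    using C1_partials_compose(1)[OF g(1) F_C1[OF \<omega>]] by (simp add: C1_partials_def)
  then have "((\<lambda>r. (g (F t (x + r *\<^sub>R axis i 1) \<omega>) - g (F t x \<omega>)) / r) \<longlongrightarrow> partial i (\<lambda>z. g (F t z \<omega>)) x) (at 0)"
    using has_partial_DERIV[of i "\<lambda>z. g (F t z \<omega>)" x 0] by (simp add: DERIV_def)
  moreover have "filterlim (\<lambda>n. inverse (real (Suc n))) (at 0) sequentially"
    using LIMSEQ_inverse_real_of_nat by (auto simp: filterlim_at)
  ultimately show "(\<lambda>n. (g (F t (x + inverse (real (Suc n)) *\<^sub>R axis i 1) \<omega>) - g (F t x \<omega>)) / inverse (real (Suc n)))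
      \<longlonglongrightarrow> partial i (\<lambda>z. g (F t z \<omega>)) x"
    by (rule filterlim_compose)
next
  have [measurable]: "g \<in> borel_measurable borel" by fact
  show "(\<lambda>\<omega>. (g (F t (x + inverse (real (Suc n)) *\<^sub>R axis i 1) \<omega>) - g (F t x \<omega>)) / inverse (real (Suc n)))
      \<in> borel_measurable M" for n
    by measurable
qed

text \<open>The expectations of the segment averages that bound the difference quotients converge,
  since \<open>P t w\<close> is continuous for these \<open>t\<close>; this is what convergence with
  varying majorants requires. The same theorem, with \<open>w\<close> along the flow as majorant,
  makes the derivative continuous.\<close>

lemma P_C1:
  assumes g: "C1_partials g" "wbound c g" and d: "\<And>j z. \<bar>partial j g z\<bar> \<le> d * w z"
    and t: "t0 + 1 \<le> t"
  shows "C1_partials (P t g)"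
proof -
  have [measurable]: "g \<in> borel_measurable borel" using g(2) by (rule wboundD)
  have Pw: "continuous_on UNIV (P t w)" by (rule P_continuous[OF wbound_w t])
  define D where "D i x = (\<integral>\<omega>. partial i (\<lambda>z. g (F t z \<omega>)) x \<partial>M)" for i x
  have meas: "(\<lambda>\<omega>. partial i (\<lambda>z. g (F t z \<omega>)) x) \<in> borel_measurable M" for i x
    by (rule path_partial_measurable) (use g in \<open>auto dest: wboundD\<close>)
  have "((\<lambda>s. P t g (x + s *\<^sub>R axis i 1)) has_real_derivative D i x) (at 0)" for i x
    unfolding DERIV_def tendsto_at_iff_sequentially o_def
  proof (intro allI impI)
    fix r :: "nat \<Rightarrow> real" assume r: "\<forall>k. r k \<in> UNIV - {0}" "r \<longlonglongrightarrow> 0"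
    have r0: "r k \<noteq> 0" for k using r(1) by auto
    have flim: "filterlim r (at 0) sequentially" using r by (simp add: filterlim_at)
    let ?f = "\<lambda>k \<omega>. (g (F t (x + r k *\<^sub>R axis i 1) \<omega>) - g (F t x \<omega>)) / r k"
    let ?Z = "\<lambda>k \<omega>. jac t * d * (\<integral>\<sigma>. w (F t (x + (\<sigma> * r k) *\<^sub>R axis i 1) \<omega>) \<partial>unit_measure)"
    have "(\<lambda>k. \<integral>\<omega>. ?f k \<omega> \<partial>M) \<longlonglongrightarrow> D i x"
      unfolding D_def
    proof (rule integral_tendsto_varying_majorant[where Z="?Z" and Y="\<lambda>\<omega>. jac t * d * w (F t x \<omega>)"])
      show "?f k \<in> borel_measurable M" for k by measurable
      show "integrable M (?Z k)" for k using segment_average_path(1) by simp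
      show "integrable M (\<lambda>\<omega>. jac t * d * w (F t x \<omega>))" using integrable_w by simp
      show "(\<lambda>k. \<integral>\<omega>. ?Z k \<omega> \<partial>M) \<longlonglongrightarrow> (\<integral>\<omega>. jac t * d * w (F t x \<omega>) \<partial>M)"
        using tendsto_mult_left[OF filterlim_compose[OF segment_average_tendsto[OF Pw] flim], of "jac t * d" x i]
        by (simp add: segment_average_path(2) P_def)
      fix \<omega> assume \<omega>: "\<omega> \<in> space M"
      note C1 = path_C1[OF g(1) d \<omega>]
      have "\<bar>g (F t (x + r k *\<^sub>R axis i 1) \<omega>) - g (F t x \<omega>)\<bar>
         \<le> \<bar>r k\<bar> * (\<integral>\<sigma>. jac t * d * w (F t (x + (\<sigma> * r k) *\<^sub>R axis i 1) \<omega>) \<partial>unit_measure)" for k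
        by (rule partial_segment_bound[of "\<lambda>z. g (F t z \<omega>)" "\<lambda>z. jac t * d * w (F t z \<omega>)"])
           (intro C1 continuous_intros w_path_continuous[OF \<omega>])+
      then show "\<bar>?f k \<omega>\<bar> \<le> ?Z k \<omega>" for k
        using r0[of k] by (simp add: abs_divide divide_le_eq mult.commute)
      have "has_partial i (\<lambda>z. g (F t z \<omega>)) x"
        using C1(1) by (simp add: C1_partials_def)
      then have "((\<lambda>r. (g (F t (x + r *\<^sub>R axis i 1) \<omega>) - g (F t x \<omega>)) / r) \<longlongrightarrow> partial i (\<lambda>z. g (F t z \<omega>)) x) (at 0)"
        using has_partial_DERIV[of i "\<lambda>z. g (F t z \<omega>)" x 0] by (simp add: DERIV_def)
      from filterlim_compose[OF this flim]
      show "(\<lambda>k. ?f k \<omega>) \<longlonglongrightarrow> partial i (\<lambda>z. g (F t z \<omega>)) x" .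
      show "(\<lambda>k. ?Z k \<omega>) \<longlonglongrightarrow> jac t * d * w (F t x \<omega>)"
        by (intro tendsto_mult_left filterlim_compose[OF segment_average_tendsto[OF w_path_continuous[OF \<omega>]] flim])
    qed (rule meas)
    moreover have "(\<integral>\<omega>. ?f k \<omega> \<partial>M) = (P t g (x + r k *\<^sub>R axis i 1) - P t g x) / r k" for k
      using integrable_wbound[OF g(2)] by (simp add: P_def)
    ultimately have "(\<lambda>k. (P t g (x + r k *\<^sub>R axis i 1) - P t g x) / r k) \<longlonglongrightarrow> D i x"
      by (simp only:)
    then show "(\<lambda>k. (P t g (x + (0 + r k) *\<^sub>R axis i 1) - P t g (x + 0 *\<^sub>R axis i 1)) / r k) \<longlonglongrightarrow> D i x"
      by simp
  qed
  note par = has_partialI[OF this]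
  have "continuous_on UNIV (D i)" for i
    unfolding D_def
  proof (rule continuous_integral_varying_majorant[where Z="\<lambda>x \<omega>. jac t * d * w (F t x \<omega>)"])
    show "integrable M (\<lambda>\<omega>. jac t * d * w (F t x \<omega>))" for x using integrable_w by simp
    show "continuous_on UNIV (\<lambda>x. \<integral>\<omega>. jac t * d * w (F t x \<omega>) \<partial>M)"
      using continuous_on_mult_left[OF Pw, of "jac t * d"] by (simp add: P_def[abs_def])
    fix \<omega> assume \<omega>: "\<omega> \<in> space M"
    note C1 = path_C1[OF g(1) d \<omega>]
    show "\<bar>partial i (\<lambda>z. g (F t z \<omega>)) x\<bar> \<le> jac t * d * w (F t x \<omega>)" for x by (rule C1)
    show "continuous_on UNIV (\<lambda>x. partial i (\<lambda>z. g (F t z \<omega>)) x)" using C1(1) by (simp add: C1_partials_def)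
    show "continuous_on UNIV (\<lambda>x. jac t * d * w (F t x \<omega>))"
      by (intro continuous_intros w_path_continuous[OF \<omega>])
  qed (rule meas)
  then show ?thesis unfolding C1_partials_def par(2)[abs_def] by (intro allI conjI par(1))
qed

text \<open>A Lasota--Yorke inequality. Far out the factor \<open>\<kappa>\<close> beats the Jacobian bound. On a compact set
  \<open>h = P (t0 + 1) g\<close> is split by a cutoff: the inner part is smoothed by the density, at the cost of
  a multiple of the norm of \<open>g\<close> alone, and the outer part is again small because of \<open>\<kappa>\<close>.\<close>

lemma lasota_yorke:
  "\<exists>C\<ge>0. \<forall>c d g i x. C1_partials g \<longrightarrow> wbound c g \<longrightarrow> 0 \<le> d \<longrightarrow> (\<forall>j z. \<bar>partial j g z\<bar> \<le> d * w z)
    \<longrightarrow> \<bar>partial i (P (2 * t0 + 1) g) x\<bar> \<le> (d / 2 + C * c) * w x"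
proof -
  \<comment> \<open>\<open>t0 + 1\<close> steps make \<open>h\<close> continuously differentiable;
    \<open>t0\<close> further steps smooth it by the density.\<close>
  define m n where "m = t0 + 1" and "n = 2 * t0 + 1"
  have mn: "n = t0 + m" "t0 + 1 \<le> m" "t0 + 1 \<le> n" "1 \<le> m" "1 \<le> n" by (auto simp: m_def n_def)
  define A1 A2 A3 where "A1 = jac m * B ^ m" and "A2 = jac t0 * B ^ t0" and "A3 = jac n * B ^ n"
  have A: "0 \<le> A1" "0 \<le> A2" "0 \<le> A3" using jac_nonneg B_ge_1 by (auto simp: A1_def A2_def A3_def)
  \<comment> \<open>\<open>A1 * A2\<close> bounds the growth of gradients over both stages, so a
    factor \<open>\<epsilon>\<close> brings the outer part down to at most one half.\<close>
  define \<epsilon> where "\<epsilon> = 1 / (2 * (A1 * A2 + 1))"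
  have \<epsilon>: "0 < \<epsilon>" "\<epsilon> \<le> 1" "\<epsilon> * A1 * A2 \<le> 1 / 2"
  proof -
    have A12: "0 \<le> A1 * A2" using A by simp
    then show "0 < \<epsilon>" "\<epsilon> \<le> 1" by (auto simp: \<epsilon>_def divide_le_eq)
    have "\<epsilon> * A1 * A2 \<le> \<epsilon> * (A1 * A2 + 1)" using \<open>0 < \<epsilon>\<close> by simp
    also have "\<dots> = 1 / 2" using A12 by (simp add: \<epsilon>_def field_simps)
    finally show "\<epsilon> * A1 * A2 \<le> 1 / 2" .
  qed
  have "0 < 1 / (2 * (A3 + 1))" using A by simp
  then obtain \<rho> where \<rho>: "\<And>x. \<rho> < norm x \<Longrightarrow> \<kappa> x \<le> 1 / (2 * (A3 + 1))"
    using \<kappa>_small by blast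
  obtain R1 where R1: "\<And>x. R1 < norm x \<Longrightarrow> \<kappa> x \<le> \<epsilon>" using \<kappa>_small[OF \<epsilon>(1)] by blast
  define q where "q = \<bar>R1\<bar> + 1"
  have q: "0 < q" "R1 \<le> q" by (auto simp: q_def)
  \<comment> \<open>Beyond \<open>R1\<close> the factor \<open>\<kappa>\<close> is at most
    \<open>\<epsilon>\<close>; inside, this large radius makes \<open>1 - cutoff R z\<close> at most
    \<open>\<epsilon>\<close>. Hence their product is small everywhere.\<close>
  define R where "R = 2 * q / \<epsilon>"
  have R: "0 < R" using \<epsilon> q by (simp add: R_def)
  have cut: "(1 - cutoff R z) * \<kappa> z \<le> \<epsilon>" for z
  proof (cases "R1 < norm z")
    case True
    have "(1 - cutoff R z) * \<kappa> z \<le> 1 * \<epsilon>"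
      using cutoff_props(2,3)[OF R] R1[OF True] \<kappa>_nonneg by (intro mult_mono) auto
    then show ?thesis by simp
  next
    case False
    have "1 - cutoff R z \<le> 2 * (norm z)\<^sup>2 / R\<^sup>2" by (rule cutoff_props(5)[OF R])
    also have "\<dots> \<le> 2 * q\<^sup>2 / R\<^sup>2"
      using False q by (intro divide_right_mono mult_left_mono power_mono) auto
    also have "\<dots> = \<epsilon>\<^sup>2 / 2"
      using \<epsilon>(1) q(1) by (simp add: R_def power2_eq_square)
    also have "\<dots> \<le> \<epsilon>" using \<epsilon> mult_left_le[of \<epsilon> \<epsilon>] by (simp add: power2_eq_square)
    finally have 1: "1 - cutoff R z \<le> \<epsilon>" .
    have "(1 - cutoff R z) * \<kappa> z \<le> \<epsilon> * 1"
      using 1 cutoff_props(3)[OF R] \<kappa>_nonneg[of z] \<kappa>_le_1[of z] \<epsilon>(1) by (intro mult_mono) auto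
    then show ?thesis by simp
  qed
  \<comment> \<open>The margin 1 keeps the shifted point within range for increments below
    1.\<close>
  obtain L where L: "0 \<le> L" "\<forall>u c x x'. wbound c u \<longrightarrow> (\<forall>y. R < norm y \<longrightarrow> u y = 0)
      \<longrightarrow> norm x \<le> \<rho> + 1 \<longrightarrow> norm x' \<le> \<rho> + 1 \<longrightarrow> \<bar>P t0 u x' - P t0 u x\<bar> \<le> L * c * norm (x' - x)"
    using P_t0_lipschitz[of R "\<rho> + 1"] by blast
  \<comment> \<open>The first summand comes from smoothing the inner part, the second from the
    gradient of the cutoff in the outer part.\<close>
  define C where "C = L * B ^ m + A2 * (4 / R) * B ^ m"
  have C: "0 \<le> C" using L(1) A R B_ge_1 by (auto simp: C_def)
  have "\<bar>partial i (P n g) x\<bar> \<le> (d / 2 + C * c) * w x"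
    if g: "C1_partials g" "wbound c g" and d0: "0 \<le> d" and d: "\<And>j z. \<bar>partial j g z\<bar> \<le> d * w z"
    for c d g i x
  proof -
    have c: "0 \<le> c" by (rule wbound_nonneg[OF g(2)])
    have parn: "has_partial i (P n g) x"
      using P_C1[OF g d mn(3)] by (simp add: C1_partials_def)
    show ?thesis
    proof (cases "\<rho> < norm x")
      case True
      have "\<bar>partial i (P n g) x\<bar> \<le> jac n * d * (B ^ n * (\<kappa> x * w x))"
        by (rule P_partial_le[OF g d _ P_w_le_\<kappa>[OF mn(5)] parn])
           (intro continuous_intros \<kappa>_continuous w_continuous)
      also have "\<dots> = d * (A3 * \<kappa> x) * w x" by (simp add: A3_def)
      also have "\<dots> \<le> d * (1 / 2) * w x"
      proof -
        have "A3 * \<kappa> x \<le> (A3 + 1) * (1 / (2 * (A3 + 1)))"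
          using A(3) \<rho>[OF True] \<kappa>_nonneg[of x] by (intro mult_mono) auto
        also have "\<dots> = 1 / 2" using A(3) by (simp add: field_simps)
        finally show ?thesis using d0 by (intro mult_right_mono mult_left_mono) auto
      qed
      also have "\<dots> \<le> (d / 2 + C * c) * w x" using C c by (intro mult_right_mono) auto
      finally show ?thesis .
    next
      case False
      define h where "h = P m g"
      define u v where "u z = h z * (1 + (- 1) * cutoff R z)" and "v z = cutoff R z * h z" for z
      have h_C1: "C1_partials h" unfolding h_def by (rule P_C1[OF g d mn(2)])
      have h_w: "wbound (c * B ^ m) h" unfolding h_def by (rule P_wbound[OF g(2)])
      have h_par: "\<bar>partial j h z\<bar> \<le> A1 * d * (\<kappa> z * w z)" for j z
      proof -
        have "has_partial j (P m g) z" using h_C1 by (simp add: C1_partials_def h_def)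
        then have "\<bar>partial j (P m g) z\<bar> \<le> jac m * d * (B ^ m * (\<kappa> z * w z))"
          by (intro P_partial_le[OF g d _ P_w_le_\<kappa>[OF mn(4)]] continuous_intros \<kappa>_continuous w_continuous)
        then show ?thesis by (simp add: h_def A1_def ac_simps)
      qed
      have [measurable]: "h \<in> borel_measurable borel" "cutoff R \<in> borel_measurable (borel :: (real^'l) measure)"
        using h_w C1_partials_continuous[OF cutoff_props(1)[OF R]]
        by (auto dest: wboundD intro: borel_measurable_continuous_onI)
      have mult_le: "\<bar>a * h z\<bar> \<le> c * B ^ m * w z" if "0 \<le> a" "a \<le> 1" for a z
      proof -
        have "\<bar>a * h z\<bar> \<le> 1 * \<bar>h z\<bar>" unfolding abs_mult using that by (intro mult_right_mono) auto
        then show ?thesis using wboundD(2)[OF h_w, of z] by simp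
      qed
      have v_w: "wbound (c * B ^ m) v"
        unfolding wbound_def
      proof (intro conjI allI)
        show "v \<in> borel_measurable borel" unfolding v_def[abs_def] by measurable
        show "\<bar>v z\<bar> \<le> c * B ^ m * w z" for z
          unfolding v_def by (rule mult_le[OF cutoff_props(2,3)[OF R]])
      qed
      have u_w: "wbound (c * B ^ m) u"
        unfolding wbound_def
      proof (intro conjI allI)
        show "u \<in> borel_measurable borel" unfolding u_def[abs_def] by measurable
        show "\<bar>u z\<bar> \<le> c * B ^ m * w z" for z
          unfolding u_def using cutoff_props(2,3)[OF R, of z]
          by (subst mult.commute) (intro mult_le, auto)
      qed
      have cut1: "C1_partials (\<lambda>z :: real^'l. 1 + (- 1) * cutoff R z)"
        by (rule C1_partials_affine(1)[OF cutoff_props(1)[OF R]])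
      have u_C1: "C1_partials u"
        unfolding u_def[abs_def] by (rule C1_partials_mult(1)[OF h_C1 cut1])
      define d' where "d' = \<epsilon> * A1 * d + 4 / R * (c * B ^ m)"
      have u_par: "\<bar>partial j u z\<bar> \<le> d' * w z" for j z
      proof -
        have "partial j u z = h z * partial j (\<lambda>z. 1 + (- 1) * cutoff R z) z
            + partial j h z * (1 + (- 1) * cutoff R z)"
          unfolding u_def[abs_def] by (rule C1_partials_mult(2)[OF h_C1 cut1])
        also have "partial j (\<lambda>z. 1 + (- 1) * cutoff R z) z = (- 1) * partial j (cutoff R) z"
          by (rule C1_partials_affine(2)[OF cutoff_props(1)[OF R]])
        finally have eq: "partial j u z = (1 - cutoff R z) * partial j h z - partial j (cutoff R) z * h z"
          by (simp add: algebra_simps)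
        have "\<bar>(1 - cutoff R z) * partial j h z\<bar> \<le> (1 - cutoff R z) * (A1 * d * (\<kappa> z * w z))"
          unfolding abs_mult using h_par[of j z] cutoff_props(3)[OF R, of z] by (simp add: mult_left_mono)
        also have "\<dots> = A1 * d * w z * ((1 - cutoff R z) * \<kappa> z)" by simp
        also have "\<dots> \<le> A1 * d * w z * \<epsilon>" using A d0 cut by (intro mult_left_mono) auto
        finally have 1: "\<bar>(1 - cutoff R z) * partial j h z\<bar> \<le> A1 * d * w z * \<epsilon>" .
        have 2: "\<bar>partial j (cutoff R) z * h z\<bar> \<le> 4 / R * (c * B ^ m * w z)"
          unfolding abs_mult using cutoff_props(6)[OF R] wboundD(2)[OF h_w, of z] R by (intro mult_mono) auto
        have "\<bar>partial j u z\<bar> \<le> A1 * d * w z * \<epsilon> + 4 / R * (c * B ^ m * w z)"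
          unfolding eq using 1 2 by linarith
        also have "\<dots> = d' * w z" by (simp add: d'_def algebra_simps)
        finally show ?thesis .
      qed
      have d': "0 \<le> d'" using \<epsilon> A d0 c R B_ge_1 by (auto simp: d'_def)
      have split: "P n g z = P t0 v z + P t0 u z" for z
      proof -
        have "P n g z = P t0 h z" using P_P_add[OF g(2), of t0 m z] by (simp add: mn(1) h_def)
        also have "h = (\<lambda>z. v z + u z)" by (simp add: u_def v_def fun_eq_iff algebra_simps)
        also have "P t0 \<dots> z = P t0 v z + P t0 u z" by (rule P_add[OF v_w u_w])
        finally show ?thesis .
      qed
      \<comment> \<open>Differentiability is known for \<open>P n g\<close>, but not for its two
        parts after only \<open>t0\<close> steps. Their difference quotients are therefore estimated
        separately, and the limit is taken for the sum.\<close>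
      let ?q = "\<lambda>r. L * (c * B ^ m) + jac t0 * d' * (\<integral>\<sigma>. B ^ t0 * w (x + (\<sigma> * r) *\<^sub>R axis i 1) \<partial>unit_measure)"
      have "\<bar>partial i (P n g) x\<bar> \<le> L * (c * B ^ m) + jac t0 * d' * (B ^ t0 * w x)"
      proof (rule partial_le[OF parn, where q="?q"])
        have "continuous_on UNIV (\<lambda>z. B ^ t0 * w z)" by (intro continuous_intros w_continuous)
        then show "(?q \<longlongrightarrow> L * (c * B ^ m) + jac t0 * d' * (B ^ t0 * w x)) (at 0)"
          by (intro tendsto_intros segment_average_tendsto)
        have "\<forall>\<^sub>F r in at 0. \<bar>r\<bar> < (1::real)"
          unfolding eventually_at by (intro exI[of _ 1]) auto
        then show "\<forall>\<^sub>F r in at 0. \<bar>P n g (x + r *\<^sub>R axis i 1) - P n g x\<bar> \<le> \<bar>r\<bar> * ?q r"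
        proof (rule eventually_mono)
          fix r :: real assume r: "\<bar>r\<bar> < 1"
          let ?x = "x + r *\<^sub>R axis i 1"
          have x: "norm x \<le> \<rho> + 1" "norm ?x \<le> \<rho> + 1"
            using norm_triangle_ineq[of x "r *\<^sub>R axis i 1"] r False by auto
          have "\<forall>y. R < norm y \<longrightarrow> v y = 0" by (simp add: v_def cutoff_props(4)[OF R])
          then have "\<bar>P t0 v ?x - P t0 v x\<bar> \<le> L * (c * B ^ m) * norm (?x - x)"
            using L(2) v_w x by blast
          then have 1: "\<bar>P t0 v ?x - P t0 v x\<bar> \<le> L * (c * B ^ m) * \<bar>r\<bar>" by simp
          have "(\<integral>\<sigma>. P t0 w (x + (\<sigma> * r) *\<^sub>R axis i 1) \<partial>unit_measure)
              \<le> (\<integral>\<sigma>. B ^ t0 * w (x + (\<sigma> * r) *\<^sub>R axis i 1) \<partial>unit_measure)"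
            by (intro integral_mono segment_average_path(3) continuous_unit_measure
                continuous_on_mult_left continuous_segment w_continuous P_w_le)
          then have 2: "\<bar>P t0 u ?x - P t0 u x\<bar>
              \<le> \<bar>r\<bar> * (jac t0 * d' * (\<integral>\<sigma>. B ^ t0 * w (x + (\<sigma> * r) *\<^sub>R axis i 1) \<partial>unit_measure))"
            using d' jac_nonneg by (intro order_trans[OF P_lipschitz[OF u_C1 u_w u_par]] mult_left_mono) auto
          show "\<bar>P n g ?x - P n g x\<bar> \<le> \<bar>r\<bar> * ?q r"
            unfolding split distrib_left using 1 2 by (simp only: mult.commute[of "\<bar>r\<bar>"])
        qed
      qed
      also have "\<dots> \<le> L * (c * B ^ m) * w x + jac t0 * d' * (B ^ t0 * w x)"
        using L(1) c B_ge_1 mult_left_mono[OF w_ge_1, of "L * (c * B ^ m)" x] by simp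
      also have "\<dots> = (d * (\<epsilon> * A1 * A2) + C * c) * w x"
        by (simp add: d'_def C_def A2_def algebra_simps)
      also have "\<dots> \<le> (d * (1 / 2) + C * c) * w x"
        using \<epsilon>(3) d0 by (intro mult_right_mono add_right_mono mult_left_mono) auto
      finally show ?thesis by simp
    qed
  qed
  then show ?thesis using C unfolding n_def by blast
qed

text \<open>Along multiples of \<open>n\<close> the gradient bounds satisfy a recursion with factor
  1/2 and a source term of order \<open>\<rho> ^ (k * n)\<close>. The time left over is covered by
  the crude Jacobian bound.\<close>

theorem C1_geometric_ergodicity:
  "\<exists>b \<rho> t1. 0 \<le> b \<and> 0 < \<rho> \<and> \<rho> < 1 \<and>
    (\<forall>c f t. C1_partials f \<longrightarrow> wbound c f \<longrightarrow> (\<forall>j z. \<bar>partial j f z\<bar> \<le> c * w z) \<longrightarrow> t1 \<le> t \<longrightarrow>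
      C1_partials (P t f) \<and> (\<forall>x. \<bar>P t f x - (\<integral>y. f y \<partial>\<pi>)\<bar> \<le> b * \<rho> ^ t * c * w x) \<and>
      (\<forall>i x. \<bar>partial i (P t f) x\<bar> \<le> b * \<rho> ^ t * c * w x))"
proof -
  obtain C \<rho> where C: "0 \<le> C" and \<rho>: "0 < \<rho>" "\<rho> < 1"
    and geo: "\<forall>c f t x. wbound c f \<longrightarrow> \<bar>P t f x - (\<integral>y. f y \<partial>\<pi>)\<bar> \<le> C * \<rho> ^ t * c * w x"
    using geometric_ergodicity by blast
  obtain CL where CL: "0 \<le> CL" and ly: "\<forall>c d g i x. C1_partials g \<longrightarrow> wbound c g \<longrightarrow> 0 \<le> d
      \<longrightarrow> (\<forall>j z. \<bar>partial j g z\<bar> \<le> d * w z) \<longrightarrow> \<bar>partial i (P (2 * t0 + 1) g) x\<bar> \<le> (d / 2 + CL * c) * w x"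
    using lasota_yorke by blast
  define n where "n = 2 * t0 + 1"
  have n: "1 \<le> n" "t0 + 1 \<le> n" by (auto simp: n_def)
  \<comment> \<open>3/4 leaves room above the factor 1/2 for absorbing the source term, and
    \<open>\<rho> ^ n\<close> lets \<open>r ^ k\<close> dominate that term.\<close>
  define r where "r = max (3 / 4) (\<rho> ^ n)"
  have "\<rho> ^ n < 1" using \<rho> n(1) by (simp add: power_less_one_iff)
  then have r: "0 < r" "r < 1" "3 / 4 \<le> r" "\<rho> ^ n \<le> r" by (auto simp: r_def)
  \<comment> \<open>The second entry gives \<open>D / 2 + CL * C \<le> D * (3 / 4)\<close>, which
    closes the induction; \<open>1 \<le> D\<close> starts it.\<close>
  define D where "D = max 1 (4 * CL * C)"
  have D: "1 \<le> D" "4 * CL * C \<le> D" unfolding D_def by (rule max.cobounded1, rule max.cobounded2)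
  obtain \<rho>1 where \<rho>1: "0 < \<rho>1" "\<rho>1 < 1" "\<And>t k. t \<le> (k + 2) * n \<Longrightarrow> r ^ k \<le> (1 / r\<^sup>2) * \<rho>1 ^ t"
    using geometric_subsequence[OF r(1,2) n(1), of 2] by auto
  \<comment> \<open>One bound for all remainders up to \<open>2 * n\<close>; \<open>max 1 K\<close>
    makes the power increasing also for \<open>K\<close> below 1.\<close>
  define J where "J = (max 1 K) ^ (2 * n) * real CARD('l) * B ^ (2 * n)"
  have J: "jac j * B ^ j \<le> J" if "j \<le> 2 * n" for j
  proof -
    have "K ^ j \<le> max 1 K ^ j" using K_nonneg by (intro power_mono) auto
    also have "\<dots> \<le> max 1 K ^ (2 * n)" using that by (intro power_increasing) auto
    finally have "K ^ j * real CARD('l) \<le> max 1 K ^ (2 * n) * real CARD('l)" by (intro mult_right_mono) auto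
    then show ?thesis unfolding jac_def J_def
      using B_ge_1 that by (intro mult_mono power_increasing) auto
  qed
  have J0: "0 \<le> J" using B_ge_1 by (simp add: J_def)
  define b where "b = C + J * D / r\<^sup>2"
  have b: "C \<le> b" "J * D / r\<^sup>2 \<le> b" "0 \<le> b" using C J0 D by (auto simp: b_def)
  define \<rho>0 where "\<rho>0 = max \<rho> \<rho>1"
  have \<rho>0: "0 < \<rho>0" "\<rho>0 < 1" "\<rho> \<le> \<rho>0" "\<rho>1 \<le> \<rho>0" using \<rho> \<rho>1 by (auto simp: \<rho>0_def)
  have "C1_partials (P t f) \<and> (\<forall>x. \<bar>P t f x - (\<integral>y. f y \<partial>\<pi>)\<bar> \<le> b * \<rho>0 ^ t * c * w x) \<and>
      (\<forall>i x. \<bar>partial i (P t f) x\<bar> \<le> b * \<rho>0 ^ t * c * w x)"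
    if f: "C1_partials f" "wbound c f" "\<forall>j z. \<bar>partial j f z\<bar> \<le> c * w z" and t: "n \<le> t" for c f t
  proof -
    have c: "0 \<le> c" by (rule wbound_nonneg[OF f(2)])
    define e where "e = (\<integral>y. f y \<partial>\<pi>)"
    define g where "g k z = P (k * n) f z - e" for k z
    have g_w: "wbound (C * \<rho> ^ (k * n) * c) (g k)" for k
    proof -
      have "P (k * n) f \<in> borel_measurable borel" using P_wbound[OF f(2)] by (rule wboundD)
      then have "g k \<in> borel_measurable borel" unfolding g_def[abs_def] by simp
      then show ?thesis using geo f(2) by (simp add: wbound_def g_def e_def)
    qed
    have shift: "P j (g k) z = P (j + k * n) f z - e" for j k z
      unfolding g_def[abs_def] using P_diff_const[OF P_wbound[OF f(2)]] P_P_add[OF f(2)] by simp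
    have g_C1: "C1_partials (g k) \<and> (\<forall>j z. \<bar>partial j (g k) z\<bar> \<le> D * c * r ^ k * w z)" for k
    proof (induction k)
      case 0
      have g0: "g 0 = (\<lambda>z. - e + 1 * f z)" by (simp add: g_def fun_eq_iff P_0)
      have "\<bar>partial j f z\<bar> \<le> D * c * w z" for j z
      proof -
        have "\<bar>partial j f z\<bar> \<le> c * w z" using f(3) by blast
        also have "\<dots> \<le> D * (c * w z)" using D(1) c mult_right_mono[of 1 D "c * w z"] by simp
        finally show ?thesis by simp
      qed
      then show ?case unfolding g0
        using C1_partials_affine[OF f(1), where b="- e" and a=1] by simp
    next
      case (Suc k)
      then have C1: "C1_partials (g k)" and par: "\<And>j z. \<bar>partial j (g k) z\<bar> \<le> D * c * r ^ k * w z" by auto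
      have gS: "g (Suc k) = P n (g k)" using shift[of n k] by (simp add: g_def fun_eq_iff)
      have "\<bar>partial i (P n (g k)) x\<bar> \<le> D * c * r ^ Suc k * w x" for i x
      proof -
        have "0 \<le> D * c * r ^ k" using D c r by simp
        then have "\<bar>partial i (P n (g k)) x\<bar> \<le> (D * c * r ^ k / 2 + CL * (C * \<rho> ^ (k * n) * c)) * w x"
          using ly C1 g_w[of k] par unfolding n_def[symmetric] by blast
        also have "\<dots> \<le> (D * c * r ^ k / 2 + CL * (C * r ^ k * c)) * w x"
        proof -
          have "\<rho> ^ (k * n) = (\<rho> ^ n) ^ k" by (simp add: power_mult[symmetric] mult.commute)
          also have "\<dots> \<le> r ^ k" using \<rho> r by (intro power_mono) auto
          finally show ?thesis
            using CL C c by (intro mult_right_mono add_left_mono mult_left_mono) auto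
        qed
        also have "\<dots> = (D / 2 + CL * C) * (c * r ^ k * w x)" by (simp add: algebra_simps)
        also have "\<dots> \<le> (D * r) * (c * r ^ k * w x)"
        proof (intro mult_right_mono)
          have "D / 2 + CL * C \<le> D * (3 / 4)" using D(2) by simp
          also have "\<dots> \<le> D * r" using D r by (intro mult_left_mono) auto
          finally show "D / 2 + CL * C \<le> D * r" .
        qed (use c r in simp)
        finally show ?thesis by (simp add: ac_simps)
      qed
      then show ?case unfolding gS using P_C1[OF C1 g_w par n(2)] by blast
    qed
    \<comment> \<open>One full block is held back, so the remainder \<open>j\<close> lies between
      \<open>n\<close> and \<open>2 * n\<close> and has the \<open>t0 + 1\<close> steps that
      \<open>P_C1\<close> requires.\<close>
    define k j where "k = t div n - 1" and "j = t - k * n"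
    have "1 \<le> t div n" using t n(1) by (simp add: Suc_le_eq div_greater_zero_iff)
    then have kt: "(k + 1) * n \<le> t" "t < (k + 2) * n"
      using n(1) dividend_less_div_times[of n t] by (auto simp: k_def algebra_simps)
    then have j: "t = j + k * n" "n \<le> j" "j \<le> 2 * n" by (auto simp: j_def algebra_simps)
    have C1k: "C1_partials (g k)" and park: "\<And>i z. \<bar>partial i (g k) z\<bar> \<le> D * c * r ^ k * w z"
      using g_C1[of k] by auto
    have Ptf: "P t f = (\<lambda>z. e + 1 * P j (g k) z)" by (simp add: shift j(1) fun_eq_iff)
    have Pj: "C1_partials (P j (g k))" using n(2) j(2) by (intro P_C1[OF C1k g_w park]) auto
    have 1: "C1_partials (P t f)" unfolding Ptf by (rule C1_partials_affine(1)[OF Pj])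
    have 2: "\<bar>P t f x - e\<bar> \<le> b * \<rho>0 ^ t * c * w x" for x
    proof -
      have "\<bar>P t f x - e\<bar> \<le> C * \<rho> ^ t * c * w x" using geo f(2) by (simp add: e_def)
      also have "\<dots> \<le> b * \<rho>0 ^ t * c * w x"
        using b C \<rho> \<rho>0 c by (intro mult_right_mono mult_mono power_mono) auto
      finally show ?thesis .
    qed
    have 3: "\<bar>partial i (P t f) x\<bar> \<le> b * \<rho>0 ^ t * c * w x" for i x
    proof -
      have "\<bar>partial i (P t f) x\<bar> = \<bar>partial i (P j (g k)) x\<bar>"
        unfolding Ptf C1_partials_affine(2)[OF Pj] by simp
      also have "\<dots> \<le> jac j * (D * c * r ^ k) * (B ^ j * w x)"
      proof (rule P_partial_le[OF C1k g_w park _ P_w_le])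
        show "has_partial i (P j (g k)) x" using Pj by (simp add: C1_partials_def)
      qed (intro continuous_intros w_continuous)
      also have "\<dots> = (jac j * B ^ j) * (D * c * w x * r ^ k)" by (simp add: ac_simps)
      also have "\<dots> \<le> J * (D * c * w x * ((1 / r\<^sup>2) * \<rho>0 ^ t))"
      proof (intro mult_mono J j(3) mult_left_mono)
        have "r ^ k \<le> (1 / r\<^sup>2) * \<rho>1 ^ t" using kt by (intro \<rho>1(3)) auto
        also have "\<dots> \<le> (1 / r\<^sup>2) * \<rho>0 ^ t" using \<rho>1 \<rho>0 by (intro mult_left_mono power_mono) auto
        finally show "r ^ k \<le> (1 / r\<^sup>2) * \<rho>0 ^ t" .
      qed (use D c J0 r in auto)
      also have "\<dots> = (J * D / r\<^sup>2) * (\<rho>0 ^ t * c * w x)" by (simp add: field_simps)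
      also have "\<dots> \<le> b * (\<rho>0 ^ t * c * w x)" using b \<rho>0 c by (intro mult_right_mono) auto
      finally show ?thesis by (simp add: mult.assoc)
    qed
    show ?thesis using 1 2 3 by (simp add: e_def)
  qed
  then show ?thesis using b(3) \<rho>0 by blast
qed

end

section \<open>The chain as a random flow\<close>

text \<open>The state reached from \<open>x\<close> along a fixed noise sequence, a function of
  \<open>n 1\<close> to \<open>n t\<close>. In contrast to \<open>X\<close> it is defined for all
  starting points at once and can be differentiated in \<open>x\<close>.\<close>

primrec flow :: "('x \<Rightarrow> 'n \<Rightarrow> 'x) \<Rightarrow> (nat \<Rightarrow> 'n) \<Rightarrow> nat \<Rightarrow> 'x \<Rightarrow> 'x" where
  "flow a n 0 x = x"
| "flow a n (Suc t) x = a (flow a n t x) (n (Suc t))"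

lemma flow_cong: "(\<And>s. s \<in> {1..t} \<Longrightarrow> n s = n' s) \<Longrightarrow> flow a n t x = flow a n' t x"
  by (induction t) auto

lemma flow_measurable:
  fixes a :: "'x::second_countable_topology \<Rightarrow> 'n::second_countable_topology \<Rightarrow> 'x"
  assumes a: "continuous_on UNIV (\<lambda>(x, n). a x n)"
    and n: "\<And>s. s \<in> {1..t} \<Longrightarrow> (\<lambda>z. n z s) \<in> borel_measurable S" and x: "x \<in> borel_measurable S"
  shows "(\<lambda>z. flow a (n z) t (x z)) \<in> borel_measurable S"
  using n
proof (induction t)
  case 0
  then show ?case using x by simp
next
  case (Suc t)
  have [measurable]: "(\<lambda>(x, n). a x n) \<in> borel_measurable (borel \<Otimes>\<^sub>M borel)"
    unfolding borel_prod by (rule borel_measurable_continuous_onI[OF a])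
  have [measurable]: "(\<lambda>z. flow a (n z) t (x z)) \<in> borel_measurable S" by (rule Suc.IH) (simp add: Suc.prems)
  have [measurable]: "(\<lambda>z. n z (Suc t)) \<in> borel_measurable S" by (rule Suc.prems) simp
  have "(\<lambda>z. case (flow a (n z) t (x z), n z (Suc t)) of (x, n) \<Rightarrow> a x n) \<in> borel_measurable S"
    by measurable
  then show ?case by simp
qed

lemma flow_C1_bound:
  assumes "\<And>n. C1_bound K (\<lambda>x. a x n)"
  shows "C1_bound (K ^ t) (flow a n t)"
proof (induction t)
  case 0
  have "flow a n 0 = (\<lambda>x. x)" by (simp add: fun_eq_iff)
  then show ?case using C1_bound_id by simp
next
  case (Suc t)
  then show ?case using C1_bound_compose[OF Suc assms] by (simp add: fun_eq_iff)
qed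

text \<open>All starting points are driven by the noise under the single measure
  \<open>Pr 0\<close>; equality of the noise laws is what allows this.\<close>

locale noise_chain =
  fixes Pr :: "real^'l::finite \<Rightarrow> 'w measure"
    and a :: "real^'l \<Rightarrow> real^'m::finite \<Rightarrow> real^'l"
    and N :: "nat \<Rightarrow> 'w \<Rightarrow> real^'m"
    and X :: "nat \<Rightarrow> 'w \<Rightarrow> real^'l"
  assumes model: "chain_model Pr a N X"
    and noise_law: "distr (Pr x) (PiM {1..} (\<lambda>_. borel)) (\<lambda>\<omega>. \<lambda>t\<in>{1..}. N t \<omega>)
          = distr (Pr y) (PiM {1..} (\<lambda>_. borel)) (\<lambda>\<omega>. \<lambda>t\<in>{1..}. N t \<omega>)"
begin

abbreviation "M \<equiv> Pr 0"

abbreviation "F t x \<omega> \<equiv> flow a (\<lambda>s. N s \<omega>) t x"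

lemma a_continuous: "continuous_on UNIV (\<lambda>(x, n). a x n)"
  using model unfolding chain_model_def by blast

lemma prob_space_Pr: "prob_space (Pr x)"
  using model unfolding chain_model_def by blast

lemma indep_noise: "prob_space.indep_vars (Pr x) (\<lambda>_. borel) N {1..}"
  using model unfolding chain_model_def by blast

lemma noise_identical: "1 \<le> s \<Longrightarrow> 1 \<le> t \<Longrightarrow> distr (Pr x) borel (N s) = distr (Pr x) borel (N t)"
  using model unfolding chain_model_def by blast

lemma N_measurable: "1 \<le> s \<Longrightarrow> N s \<in> borel_measurable (Pr x)"
  using indep_noise[of x, unfolded prob_space.indep_vars_def2[OF prob_space_Pr]] by simp

lemma X_measurable: "X t \<in> borel_measurable (Pr x)"
  using model unfolding chain_model_def by blast

lemma F_measurable: "(\<lambda>(x, \<omega>). F t x \<omega>) \<in> borel_measurable (borel \<Otimes>\<^sub>M Pr y)"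
  unfolding case_prod_beta
  by (intro flow_measurable[OF a_continuous] measurable_compose[OF measurable_snd N_measurable] measurable_fst) simp

lemma F_measurable1: "F t x \<in> borel_measurable (Pr y)"
  by (intro flow_measurable[OF a_continuous] N_measurable measurable_const) simp_all

lemma X_Suc: "\<omega> \<in> space (Pr x) \<Longrightarrow> X (Suc t) \<omega> = a (X t \<omega>) (N (Suc t) \<omega>)"
  using model unfolding chain_model_def by blast

lemma X_eq_flow: "AE \<omega> in Pr x. X t \<omega> = F t x \<omega>"
proof -
  have X0: "AE \<omega> in Pr x. X 0 \<omega> = x" using model unfolding chain_model_def by blast
  have "X t \<omega> = F t x \<omega>" if "\<omega> \<in> space (Pr x)" "X 0 \<omega> = x" for \<omega>
    using that by (induction t) (auto simp: X_Suc)
  then show ?thesis by (rule AE_mp[OF X0 AE_I2[OF impI]])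
qed

text \<open>Under \<open>Pr x\<close> the chain is almost surely the flow from \<open>x\<close>. The
  law of the flow depends on the measure only through the law of the noise, so \<open>Pr x\<close>
  may be exchanged for \<open>Pr 0\<close>.\<close>

lemma law_X: "Pt Pr X t x = distr M borel (F t x)"
proof -
  have meas: "(\<lambda>n. flow a n t x) \<in> borel_measurable (PiM {1..} (\<lambda>_. borel))"
    by (intro flow_measurable[OF a_continuous] measurable_component_singleton measurable_const) auto
  have N: "(\<lambda>\<omega>. \<lambda>t\<in>{1..}. N t \<omega>) \<in> Pr y \<rightarrow>\<^sub>M PiM {1..} (\<lambda>_. borel)" for y
    by (intro measurable_restrict N_measurable) simp
  have F: "distr (Pr y) borel (F t x)
      = distr (distr (Pr y) (PiM {1..} (\<lambda>_. borel)) (\<lambda>\<omega>. \<lambda>t\<in>{1..}. N t \<omega>)) borel (\<lambda>n. flow a n t x)" for y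
    unfolding distr_distr[OF meas N] by (intro distr_cong) (auto simp: o_def intro!: flow_cong)
  have "Pt Pr X t x = distr (Pr x) borel (F t x)"
    unfolding Pt_def using X_eq_flow by (intro distr_cong_AE X_measurable F_measurable1) auto
  also have "\<dots> = distr M borel (F t x)" unfolding F noise_law[of x 0] ..
  finally show ?thesis .
qed

text \<open>\<open>F t x\<close> is a function of the noise up to time \<open>t\<close>, hence
  independent of the next noise variable, which in turn has the law of \<open>N 1\<close>.\<close>

lemma markov_step:
  fixes f :: "real^'l \<Rightarrow> ennreal"
  assumes f [measurable]: "f \<in> borel_measurable borel"
  shows "(\<integral>\<^sup>+\<omega>. f (F (Suc t) x \<omega>) \<partial>M) = (\<integral>\<^sup>+\<omega>. (\<integral>\<^sup>+\<omega>'. f (F 1 (F t x \<omega>) \<omega>') \<partial>M) \<partial>M)"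
proof -
  interpret prob_space M by (rule prob_space_Pr)
  have [measurable]: "(\<lambda>(x, n). a x n) \<in> borel_measurable (borel \<Otimes>\<^sub>M borel)"
    unfolding borel_prod by (rule borel_measurable_continuous_onI[OF a_continuous])
  have [measurable]: "F t x \<in> borel_measurable M" by (rule F_measurable1)
  have [measurable]: "N (Suc t) \<in> borel_measurable M" "N 1 \<in> borel_measurable M"
    by (simp_all add: N_measurable)
  \<comment> \<open>The library notion of a pair of independent variables needs both to have the same type.\<close>
  define Y1 Y2 where "Y1 \<omega> = (F t x \<omega>, 0 :: real^'m)" and "Y2 \<omega> = (0 :: real^'l, N (Suc t) \<omega>)" for \<omega>
  have [measurable]: "Y1 \<in> borel_measurable M" "Y2 \<in> borel_measurable M"
    unfolding Y1_def[abs_def] Y2_def[abs_def] by (intro borel_measurable_Pair; measurable)+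
  define A where "A = case_bool {1..t} {Suc t}"
  have "indep_vars (\<lambda>j. PiM (A j) (\<lambda>_. borel)) (\<lambda>j \<omega>. restrict (\<lambda>i. N i \<omega>) (A j)) UNIV"
    by (rule indep_vars_restrict[OF indep_noise[of 0]])
       (auto simp: A_def disjoint_family_on_def split: bool.split)
  moreover have "(\<lambda>j. PiM (A j) (\<lambda>_. borel :: (real^'m) measure)) = case_bool (PiM {1..t} (\<lambda>_. borel)) (PiM {Suc t} (\<lambda>_. borel))"
    "(\<lambda>j \<omega>. restrict (\<lambda>i. N i \<omega>) (A j))
      = case_bool (\<lambda>\<omega>. restrict (\<lambda>i. N i \<omega>) {1..t}) (\<lambda>\<omega>. restrict (\<lambda>i. N i \<omega>) {Suc t})"
    by (auto simp: A_def fun_eq_iff split: bool.split)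
  ultimately have "indep_var (PiM {1..t} (\<lambda>_. borel)) (\<lambda>\<omega>. restrict (\<lambda>i. N i \<omega>) {1..t})
      (PiM {Suc t} (\<lambda>_. borel)) (\<lambda>\<omega>. restrict (\<lambda>i. N i \<omega>) {Suc t})"
    unfolding indep_var_def by simp
  then have "indep_var borel ((\<lambda>n. (flow a n t x, 0)) \<circ> (\<lambda>\<omega>. restrict (\<lambda>i. N i \<omega>) {1..t}))
      borel ((\<lambda>n. (0, n (Suc t))) \<circ> (\<lambda>\<omega>. restrict (\<lambda>i. N i \<omega>) {Suc t}))"
    by (rule indep_var_compose)
       (auto intro!: borel_measurable_Pair flow_measurable[OF a_continuous] measurable_component_singleton)
  moreover have "(\<lambda>n. (flow a n t x, 0)) \<circ> (\<lambda>\<omega>. restrict (\<lambda>i. N i \<omega>) {1..t}) = Y1"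
    by (auto simp: fun_eq_iff Y1_def intro!: flow_cong)
  moreover have "(\<lambda>n. (0, n (Suc t))) \<circ> (\<lambda>\<omega>. restrict (\<lambda>i. N i \<omega>) {Suc t}) = Y2"
    by (auto simp: fun_eq_iff Y2_def)
  ultimately have "indep_var borel Y1 borel Y2" by simp
  then have joint: "distr M borel Y1 \<Otimes>\<^sub>M distr M borel Y2
      = distr M (borel \<Otimes>\<^sub>M borel) (\<lambda>\<omega>. (Y1 \<omega>, Y2 \<omega>))"
    by (simp add: indep_var_distribution_eq)
  let ?g = "\<lambda>(y :: (real^'l) \<times> (real^'m), n :: (real^'l) \<times> (real^'m)). f (a (fst y) (snd n))"
  have [measurable]: "?g \<in> borel_measurable (borel \<Otimes>\<^sub>M borel)"
  proof -
    have "(\<lambda>z :: ((real^'l) \<times> (real^'m)) \<times> ((real^'l) \<times> (real^'m)).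
        (case (fst (fst z), snd (snd z)) of (x, n) \<Rightarrow> a x n)) \<in> borel_measurable (borel \<Otimes>\<^sub>M borel)"
      unfolding borel_prod[symmetric] by measurable
    from measurable_compose[OF this f] show ?thesis by (simp add: case_prod_beta)
  qed
  interpret Y2: prob_space "distr M borel Y2" by (rule prob_space_distr) measurable
  have step: "(\<integral>\<^sup>+\<omega>'. f (a y (N (Suc t) \<omega>')) \<partial>M) = (\<integral>\<^sup>+\<omega>'. f (F 1 y \<omega>') \<partial>M)" for y
  proof -
    have g: "(\<lambda>n. f (a y n)) \<in> borel_measurable borel"
      using measurable_compose[OF borel_measurable_continuous_onI f]
        continuous_on_compose2[OF a_continuous, of UNIV "\<lambda>n. (y, n)"]
      by (auto intro!: continuous_intros)
    have "(\<integral>\<^sup>+\<omega>'. f (a y (N (Suc t) \<omega>')) \<partial>M) = (\<integral>\<^sup>+n. f (a y n) \<partial>distr M borel (N (Suc t)))"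
      by (rule nn_integral_distr[symmetric]) (simp_all add: g)
    also have "distr M borel (N (Suc t)) = distr M borel (N 1)" by (rule noise_identical) auto
    also have "(\<integral>\<^sup>+n. f (a y n) \<partial>distr M borel (N 1)) = (\<integral>\<^sup>+\<omega>'. f (a y (N 1 \<omega>')) \<partial>M)"
      by (rule nn_integral_distr) (simp_all add: g N_measurable)
    finally show ?thesis by simp
  qed
  have "(\<integral>\<^sup>+\<omega>. f (F (Suc t) x \<omega>) \<partial>M)
      = (\<integral>\<^sup>+z. ?g z \<partial>distr M (borel \<Otimes>\<^sub>M borel) (\<lambda>\<omega>. (Y1 \<omega>, Y2 \<omega>)))"
    by (subst nn_integral_distr) (auto simp: Y1_def Y2_def)
  also have "\<dots> = (\<integral>\<^sup>+y. \<integral>\<^sup>+n. ?g (y, n) \<partial>distr M borel Y2 \<partial>distr M borel Y1)"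
    unfolding joint[symmetric] by (rule Y2.nn_integral_fst[symmetric]) measurable
  also have "\<dots> = (\<integral>\<^sup>+\<omega>. \<integral>\<^sup>+n. ?g (Y1 \<omega>, n) \<partial>distr M borel Y2 \<partial>M)"
    by (rule nn_integral_distr) measurable
  also have "\<dots> = (\<integral>\<^sup>+\<omega>. \<integral>\<^sup>+\<omega>'. ?g (Y1 \<omega>, Y2 \<omega>') \<partial>M \<partial>M)"
    by (intro nn_integral_cong nn_integral_distr) measurable
  also have "\<dots> = (\<integral>\<^sup>+\<omega>. (\<integral>\<^sup>+\<omega>'. f (F 1 (F t x \<omega>) \<omega>') \<partial>M) \<partial>M)"
    using step by (simp add: Y1_def Y2_def)
  finally show ?thesis .
qed

text \<open>The induction removes the last step and therefore runs over all \<open>f\<close>: its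
  hypothesis is applied to the expectation of \<open>f\<close> after one step.\<close>

lemma markov:
  fixes f :: "real^'l \<Rightarrow> ennreal"
  assumes "f \<in> borel_measurable borel"
  shows "(\<integral>\<^sup>+\<omega>. f (F (s + t) x \<omega>) \<partial>M) = (\<integral>\<^sup>+\<omega>. (\<integral>\<^sup>+\<omega>'. f (F t (F s x \<omega>) \<omega>') \<partial>M) \<partial>M)"
  using assms
proof (induction t arbitrary: f)
  case 0
  interpret prob_space M by (rule prob_space_Pr)
  show ?case by (simp add: emeasure_space_1)
next
  case (Suc t)
  interpret prob_space M by (rule prob_space_Pr)
  note [measurable] = Suc.prems
  have "(\<lambda>(y, \<omega>). f (F 1 y \<omega>)) \<in> borel_measurable (borel \<Otimes>\<^sub>M M)"
    using measurable_compose[OF F_measurable[of 1 0] Suc.prems] by (simp only: case_prod_unfold)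
  then have g: "(\<lambda>y. \<integral>\<^sup>+\<omega>'. f (F 1 y \<omega>') \<partial>M) \<in> borel_measurable borel"
    by (rule borel_measurable_nn_integral)
  have "(\<integral>\<^sup>+\<omega>. f (F (s + Suc t) x \<omega>) \<partial>M) = (\<integral>\<^sup>+\<omega>. (\<integral>\<^sup>+\<omega>'. f (F 1 (F (s + t) x \<omega>) \<omega>') \<partial>M) \<partial>M)"
    using markov_step[OF Suc.prems, of "s + t" x] by simp
  also have "\<dots> = (\<integral>\<^sup>+\<omega>. (\<integral>\<^sup>+\<omega>'. (\<integral>\<^sup>+\<omega>''. f (F 1 (F t (F s x \<omega>) \<omega>') \<omega>'') \<partial>M) \<partial>M) \<partial>M)"
    by (rule Suc.IH[OF g])
  also have "\<dots> = (\<integral>\<^sup>+\<omega>. (\<integral>\<^sup>+\<omega>'. f (F (Suc t) (F s x \<omega>) \<omega>') \<partial>M) \<partial>M)"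
    unfolding markov_step[OF Suc.prems] ..
  finally show ?case .
qed

text \<open>Invariance on sets says that \<open>\<pi>\<close> is the image of
  \<open>\<pi> \<Otimes>\<^sub>M M\<close> under one step; a change of variables and Fubini then
  treat functions.\<close>

lemma invariant:
  fixes f :: "real^'l \<Rightarrow> ennreal"
  assumes inv: "invariant_prob Pr X \<pi>" and f: "f \<in> borel_measurable borel"
  shows "(\<integral>\<^sup>+x. f x \<partial>\<pi>) = (\<integral>\<^sup>+x. (\<integral>\<^sup>+\<omega>. f (F 1 x \<omega>) \<partial>M) \<partial>\<pi>)"
proof -
  interpret prob_space M by (rule prob_space_Pr)
  have sets [measurable_cong]: "sets \<pi> = sets borel" using inv unfolding invariant_prob_def by blast
  have F: "(\<lambda>(x, \<omega>). F 1 x \<omega>) \<in> borel_measurable (\<pi> \<Otimes>\<^sub>M M)"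
    using F_measurable[of 1 0] sets by (simp cong: measurable_cong_sets sets_pair_measure_cong)
  have \<pi>: "\<pi> = distr (\<pi> \<Otimes>\<^sub>M M) borel (\<lambda>(x, \<omega>). F 1 x \<omega>)"
  proof (rule measure_eqI)
    show "sets \<pi> = sets (distr (\<pi> \<Otimes>\<^sub>M M) borel (\<lambda>(x, \<omega>). F 1 x \<omega>))" by (simp add: sets)
    fix A assume "A \<in> sets \<pi>"
    then have A: "A \<in> sets borel" by (simp add: sets)
    have "emeasure \<pi> A = (\<integral>\<^sup>+x. emeasure (Pt Pr X 1 x) A \<partial>\<pi>)"
      using inv A unfolding invariant_prob_def by blast
    also have "\<dots> = (\<integral>\<^sup>+x. emeasure M (Pair x -` ((\<lambda>(x, \<omega>). F 1 x \<omega>) -` A \<inter> space (\<pi> \<Otimes>\<^sub>M M))) \<partial>\<pi>)"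
    proof (intro nn_integral_cong)
      fix x assume x: "x \<in> space \<pi>"
      have "emeasure (Pt Pr X 1 x) A = emeasure M (F 1 x -` A \<inter> space M)"
        unfolding law_X by (rule emeasure_distr[OF F_measurable1 A])
      also have "F 1 x -` A \<inter> space M = Pair x -` ((\<lambda>(x, \<omega>). F 1 x \<omega>) -` A \<inter> space (\<pi> \<Otimes>\<^sub>M M))"
        using x by (auto simp: space_pair_measure)
      finally show "emeasure (Pt Pr X 1 x) A
          = emeasure M (Pair x -` ((\<lambda>(x, \<omega>). F 1 x \<omega>) -` A \<inter> space (\<pi> \<Otimes>\<^sub>M M)))" .
    qed
    also have "\<dots> = emeasure (\<pi> \<Otimes>\<^sub>M M) ((\<lambda>(x, \<omega>). F 1 x \<omega>) -` A \<inter> space (\<pi> \<Otimes>\<^sub>M M))"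
      by (rule emeasure_pair_measure_alt[symmetric]) (rule measurable_sets[OF F A])
    also have "\<dots> = emeasure (distr (\<pi> \<Otimes>\<^sub>M M) borel (\<lambda>(x, \<omega>). F 1 x \<omega>)) A"
      by (rule emeasure_distr[OF F A, symmetric])
    finally show "emeasure \<pi> A = emeasure (distr (\<pi> \<Otimes>\<^sub>M M) borel (\<lambda>(x, \<omega>). F 1 x \<omega>)) A" .
  qed
  have "(\<integral>\<^sup>+x. f x \<partial>\<pi>) = (\<integral>\<^sup>+z. f (case z of (x, \<omega>) \<Rightarrow> F 1 x \<omega>) \<partial>(\<pi> \<Otimes>\<^sub>M M))"
    by (subst \<pi>) (rule nn_integral_distr[OF F], use f in simp)
  also have "\<dots> = (\<integral>\<^sup>+x. (\<integral>\<^sup>+\<omega>. f (F 1 x \<omega>) \<partial>M) \<partial>\<pi>)"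
    using nn_integral_fst[OF measurable_compose[OF F f]] by simp
  finally show ?thesis .
qed

end

section \<open>Verification of the hypotheses\<close>

text \<open>A negative value of \<open>q\<close> would persist on a ball by continuity and give that
  ball negative measure.\<close>

lemma continuous_density:
  fixes q :: "'a::euclidean_space \<Rightarrow> real"
  assumes \<nu>: "prob_space \<nu>" "sets \<nu> = sets borel" and q: "continuous_on UNIV q"
    and eq: "\<And>A. A \<in> sets borel \<Longrightarrow> measure \<nu> A = (LINT y:A|lborel. q y)"
  shows "0 \<le> q y" and "\<nu> = density lborel (\<lambda>y. ennreal (q y))"
proof -
  interpret \<nu>: prob_space \<nu> by (rule \<nu>)
  have [measurable]: "q \<in> borel_measurable borel" by (rule borel_measurable_continuous_onI[OF q])
  have "space \<nu> = UNIV" using sets_eq_imp_space_eq[OF \<nu>(2)] by simp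
  then have "(\<integral>y. q y \<partial>lborel) = 1" using eq[of UNIV] \<nu>.prob_space by (simp add: set_lebesgue_integral_def)
  \<comment> \<open>A non-integrable function has Bochner integral 0, which the value 1
    excludes.\<close>
  then have int: "integrable lborel q" using not_integrable_integral_eq by fastforce
  have int_on: "set_integrable lborel A q" if "A \<in> sets borel" for A
    unfolding set_integrable_def using that by (intro integrable_mult_indicator int) simp
  show nonneg: "0 \<le> q y" for y
  proof (rule ccontr)
    assume "\<not> 0 \<le> q y"
    then have neg: "q y < 0" by simp
    have "isCont q y" using q by (simp add: continuous_on_eq_continuous_at)
    then obtain d where d: "0 < d" "\<And>z. dist z y < d \<Longrightarrow> dist (q z) (q y) < - q y / 2"
      unfolding continuous_at_eps_delta using neg by (metis half_gt_zero neg_0_less_iff_less)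
    have le: "q z \<le> q y / 2" if "z \<in> ball y d" for z
      using d(2)[of z] that by (simp add: dist_commute dist_real_def abs_less_iff)
    have fin: "emeasure lborel (ball y d) < \<infinity>" using emeasure_lborel_ball_finite by auto
    have "measure \<nu> (ball y d) = (LINT z:ball y d|lborel. q z)" by (rule eq) simp
    also have "\<dots> \<le> (LINT z:ball y d|lborel. q y / 2)"
      using le fin by (intro set_integral_mono int_on) (auto simp: set_integrable_def)
    also have "\<dots> = measure lborel (ball y d) * (q y / 2)"
      using fin by (simp add: set_lebesgue_integral_def)
    also have "\<dots> < 0" using neg content_ball_pos[OF d(1), of y] by (simp add: mult_pos_neg)
    finally show False using measure_nonneg[of \<nu> "ball y d"] by linarith
  qed
  show "\<nu> = density lborel (\<lambda>y. ennreal (q y))"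
  proof (rule measure_eqI)
    show "sets \<nu> = sets (density lborel (\<lambda>y. ennreal (q y)))" by (simp add: \<nu>)
    fix A assume "A \<in> sets \<nu>"
    then have A [measurable]: "A \<in> sets borel" by (simp add: \<nu>)
    have "emeasure (density lborel (\<lambda>y. ennreal (q y))) A = (\<integral>\<^sup>+y. ennreal (q y) * indicator A y \<partial>lborel)"
      by (subst emeasure_density) auto
    also have "\<dots> = (\<integral>\<^sup>+y. ennreal (indicator A y *\<^sub>R q y) \<partial>lborel)"
      by (intro nn_integral_cong) (auto simp: indicator_def)
    also have "\<dots> = ennreal (LINT y:A|lborel. q y)"
      unfolding set_lebesgue_integral_def
      using int_on[OF A] nonneg by (intro nn_integral_eq_integral) (auto simp: set_integrable_def)
    also have "\<dots> = emeasure \<nu> A" using eq[OF A] by (simp add: \<nu>.emeasure_eq_measure)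
    finally show "emeasure \<nu> A = emeasure (density lborel (\<lambda>y. ennreal (q y))) A" by simp
  qed
qed

text \<open>Jensen's inequality for the concave power, obtained from Young's inequality with the
  mean \<open>c\<close> as second factor: the expectation of the right-hand side of
  \<open>young\<close> is \<open>c\<close>.\<close>

lemma (in prob_space) expectation_powr_le:
  fixes Y :: "'a \<Rightarrow> real"
  assumes Y: "integrable M Y" "\<And>\<omega>. 1 \<le> Y \<omega>" and \<eta>: "0 < \<eta>" "\<eta> \<le> 1"
  shows "(\<integral>\<^sup>+\<omega>. ennreal (Y \<omega> powr \<eta>) \<partial>M) \<le> ennreal ((\<integral>\<omega>. Y \<omega> \<partial>M) powr \<eta>)"
proof -
  define c where "c = (\<integral>\<omega>. Y \<omega> \<partial>M)"
  have "(\<integral>\<omega>. 1 \<partial>M) \<le> c" unfolding c_def using Y by (intro integral_mono) auto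
  then have c: "1 \<le> c" by (simp add: prob_space)
  have young: "Y \<omega> powr \<eta> * c powr (1 - \<eta>) \<le> \<eta> * Y \<omega> + (1 - \<eta>) * c" for \<omega>
    using Youngs_inequality_0[of \<eta> "1 - \<eta>" "Y \<omega>" c] \<eta> c Y(2)[of \<omega>] by simp
  have cc: "0 < c powr (1 - \<eta>)" using c by simp
  have "(\<integral>\<^sup>+\<omega>. ennreal (Y \<omega> powr \<eta>) \<partial>M)
      \<le> (\<integral>\<^sup>+\<omega>. ennreal ((\<eta> * Y \<omega> + (1 - \<eta>) * c) / c powr (1 - \<eta>)) \<partial>M)"
    using young cc by (intro nn_integral_mono ennreal_leI) (simp add: pos_le_divide_eq)
  also have "\<dots> = ennreal (\<integral>\<omega>. (\<eta> * Y \<omega> + (1 - \<eta>) * c) / c powr (1 - \<eta>) \<partial>M)"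
  proof (intro nn_integral_eq_integral AE_I2)
    show "0 \<le> (\<eta> * Y \<omega> + (1 - \<eta>) * c) / c powr (1 - \<eta>)" for \<omega>
      using \<eta> c order_trans[OF zero_le_one Y(2)[of \<omega>]] by auto
  qed (use Y in simp)
  also have "(\<integral>\<omega>. (\<eta> * Y \<omega> + (1 - \<eta>) * c) / c powr (1 - \<eta>) \<partial>M) = c / c powr (1 - \<eta>)"
    using Y(1) by (simp add: prob_space c_def[symmetric] algebra_simps)
  also have "\<dots> = c powr \<eta>" using c by (simp add: powr_diff powr_divide)
  finally show ?thesis by (simp add: c_def)
qed

section \<open>Weighted norms\<close>

lemma wnorm_leI:
  assumes "\<And>x. 0 < w x" "\<And>x. \<bar>f x\<bar> \<le> c * w x"
  shows "wnorm w f \<le> ereal c"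
  unfolding wnorm_def using assms by (intro SUP_least) (simp add: divide_le_eq)

lemma wnorm_leD:
  assumes "\<And>x. 0 < w x" "wnorm w f \<le> ereal c"
  shows "\<bar>f x\<bar> \<le> c * w x"
proof -
  have "ereal (\<bar>f x\<bar> / w x) \<le> wnorm w f" unfolding wnorm_def by (rule SUP_upper) simp
  then have "ereal (\<bar>f x\<bar> / w x) \<le> ereal c" using assms(2) by (rule order_trans)
  then show ?thesis using assms(1)[of x] by (simp add: divide_le_eq)
qed

lemma wnorm_nonneg:
  assumes "\<And>x. 0 < w x"
  shows "0 \<le> wnorm w f"
proof -
  have "0 \<le> ereal (\<bar>f undefined\<bar> / w undefined)" using assms[of undefined] by simp
  also have "\<dots> \<le> wnorm w f" unfolding wnorm_def by (rule SUP_upper) simp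
  finally show ?thesis .
qed

lemma wnorm1_le_iff:
  "wnorm1 w f \<le> c \<longleftrightarrow> wnorm w f \<le> c \<and> (\<forall>i. wnorm w (partial i f) \<le> c)"
  unfolding wnorm1_def by (subst Max_le_iff) auto

lemma Linf1D:
  fixes w :: "real^'l::finite \<Rightarrow> real"
  assumes w: "\<And>x. 0 < w x" and f: "f \<in> Linf1 w"
  shows "C1_partials f" "f \<in> borel_measurable borel"
    "\<exists>c\<ge>0. wnorm1 w f = ereal c \<and> (\<forall>x. \<bar>f x\<bar> \<le> c * w x) \<and> (\<forall>i x. \<bar>partial i f x\<bar> \<le> c * w x)"
proof -
  have "wnorm w f < \<infinity>" "wnorm w (partial i f) < \<infinity>" for i
    using f by (auto simp: Linf1_def Linf0_def Linf_def)
  then have "wnorm1 w f < \<infinity>" unfolding wnorm1_def by (subst Max_less_iff) auto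
  moreover have "0 \<le> wnorm1 w f"
    using wnorm_nonneg[of w f, OF w] wnorm1_le_iff[of w f "wnorm1 w f"] by (auto intro: order_trans)
  ultimately obtain c where c: "wnorm1 w f = ereal c" by (cases "wnorm1 w f") auto
  have le: "wnorm w f \<le> ereal c" "wnorm w (partial i f) \<le> ereal c" for i
    using wnorm1_le_iff[of w f "ereal c"] c by auto
  have "0 \<le> c" using \<open>0 \<le> wnorm1 w f\<close> c by simp
  then show "\<exists>c\<ge>0. wnorm1 w f = ereal c \<and> (\<forall>x. \<bar>f x\<bar> \<le> c * w x) \<and> (\<forall>i x. \<bar>partial i f x\<bar> \<le> c * w x)"
    using c wnorm_leD[OF w le(1)] wnorm_leD[OF w le(2)] by blast
  show "C1_partials f" "f \<in> borel_measurable borel"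
    using f by (auto simp: Linf1_def Linf0_def Linf_def C1_partials_def)
qed

lemma Linf1I:
  fixes w :: "real^'l::finite \<Rightarrow> real"
  assumes w: "\<And>x. 0 < w x" and f: "C1_partials f"
    and c: "\<And>x. \<bar>f x\<bar> \<le> c * w x" "\<And>i x. \<bar>partial i f x\<bar> \<le> c * w x"
  shows "f \<in> Linf1 w" "wnorm1 w f \<le> ereal c"
proof -
  have le: "wnorm w f \<le> ereal c" "wnorm w (partial i f) \<le> ereal c" for i
    using c by (auto intro!: wnorm_leI w)
  then show "wnorm1 w f \<le> ereal c" by (simp add: wnorm1_le_iff)
  have fin: "wnorm w f < \<infinity>" "wnorm w (partial i f) < \<infinity>" for i
    by (rule order_le_less_trans[OF le(1)], simp, rule order_le_less_trans[OF le(2)], simp)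
  have cont: "continuous_on UNIV f" "continuous_on UNIV (partial i f)" for i
    using f C1_partials_continuous[OF f] by (auto simp: C1_partials_def)
  show "f \<in> Linf1 w"
    using fin cont f by (auto simp: Linf1_def Linf0_def Linf_def C1_partials_def
        intro: borel_measurable_continuous_onI)
qed

section \<open>From (DV3) to the drift condition\<close>

lemma exp_neg_small_at_infinity:
  fixes W :: "real^'l::finite \<Rightarrow> real"
  assumes W: "\<And>r. 0 \<le> r \<Longrightarrow> compact {x. W x \<le> r}" and c: "0 < c" and e: "0 < e"
  shows "\<exists>r. \<forall>x. r < norm x \<longrightarrow> exp (- (c * W x)) \<le> e"
proof -
  \<comment> \<open>The maximum with 0 is taken because compactness is given for sublevel sets at
    nonnegative levels.\<close>
  define s where "s = max 0 (- ln e / c)"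
  have "bounded {x. W x \<le> s}" by (intro compact_imp_bounded W) (simp add: s_def)
  then obtain R where R: "\<And>x. W x \<le> s \<Longrightarrow> norm x \<le> R" unfolding bounded_iff by auto
  have "exp (- (c * W x)) \<le> e" if "R < norm x" for x
  proof -
    have "s < W x" using R[of x] that by (meson not_le)
    then have "- ln e / c < W x" by (simp add: s_def)
    then have "- ln e < c * W x" using mult_strict_left_mono[OF _ c, of "- ln e / c" "W x"] c by simp
    then have "exp (- (c * W x)) \<le> exp (ln e)" by simp
    then show ?thesis using e by simp
  qed
  then show ?thesis by blast
qed

text \<open>Below level 1 the set is empty because \<open>V\<close> is positive; from level 1 on,
  \<open>ln r / c\<close> is a nonnegative level of \<open>V\<close>.\<close>

lemma compact_exp_sublevel:
  fixes V :: "'a::metric_space \<Rightarrow> real"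
  assumes V: "\<And>r. 0 \<le> r \<Longrightarrow> compact {x. V x \<le> r}" "\<And>x. 0 < V x" and c: "0 < c"
  shows "compact {x. exp (c * V x) \<le> r}"
proof (cases "1 \<le> r")
  case True
  have "exp (c * V x) \<le> r \<longleftrightarrow> V x \<le> ln r / c" for x
  proof -
    have "exp (c * V x) \<le> r \<longleftrightarrow> c * V x \<le> ln r" using True by (simp add: ln_ge_iff)
    then show ?thesis using c by (simp add: pos_le_divide_eq mult.commute)
  qed
  then show ?thesis using V(1)[of "ln r / c"] True c by simp
next
  case False
  have "1 < exp (c * V x)" for x using V(2)[of x] c by simp
  then have "{x. exp (c * V x) \<le> r} = {}" using False by (auto simp: not_le intro: less_trans)
  then show ?thesis by simp
qed

text \<open>\<open>b\<close> may be negative; with \<open>max b 0\<close> the leading factor is at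
  least 1, as required of the constant \<open>B\<close>.\<close>

lemma powr_drift_le:
  fixes y :: real
  assumes "0 < y" "ln y - V \<le> - d * W + b * i" "0 \<le> i" "i \<le> 1" "0 < \<eta>"
  shows "y powr \<eta> \<le> exp (\<eta> * max b 0) * (exp (- (\<eta> * d * W)) * exp (\<eta> * V))"
proof -
  have "b * i \<le> max b 0 * 1" using assms(3,4) by (intro mult_mono) auto
  then have "ln y \<le> max b 0 - d * W + V" using assms(2) by simp
  then have "\<eta> * ln y \<le> \<eta> * (max b 0 - d * W + V)" using assms(5) by (intro mult_left_mono) auto
  also have "\<dots> = \<eta> * max b 0 + (- (\<eta> * d * W) + \<eta> * V)" by (simp add: algebra_simps)
  finally show ?thesis using assms(1) by (simp add: powr_def mult_exp_exp)
qed

theorem theorem2p1: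
  fixes Pr :: "real^'l::finite \<Rightarrow> 'w measure"
    and a :: "real^'l \<Rightarrow> real^'m::finite \<Rightarrow> real^'l"
    and N :: "nat \<Rightarrow> 'w \<Rightarrow> real^'m"
    and X :: "nat \<Rightarrow> 'w \<Rightarrow> real^'l"
    and V v :: "real^'l \<Rightarrow> real"
    and \<pi> :: "(real^'l) measure"
    and \<eta> :: real
  assumes model: "chain_model Pr a N X"
    and A1: "assumption_A1 Pr a N"
    and A2: "assumption_A2 Pr X"
    and A3: "assumption_A3 Pr X"
    and A4: "assumption_A4 Pr X V"
    and v: "v = (\<lambda>x. exp (V x))"
    and inv: "invariant_prob Pr X \<pi>"
    and eta: "0 < \<eta>" "\<eta> \<le> 1"
  shows "\<exists>(b0::real) (t1::nat) (\<rho>0::real). 0 \<le> \<rho>0 \<and> \<rho>0 < 1 \<and>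
      (\<forall>t\<ge>t1. (\<forall>f\<in>Linf1 (\<lambda>x. v x powr \<eta>). Pt_centered Pr X \<pi> t f \<in> Linf1 (\<lambda>x. v x powr \<eta>))
          \<and> opnorm1 (\<lambda>x. v x powr \<eta>) (Pt_centered Pr X \<pi> t) \<le> ereal (b0 * \<rho>0 ^ t)) \<and>
      (\<forall>f\<in>Linf1 (\<lambda>x. v x powr \<eta>). integrable \<pi> f \<and>
        (\<forall>x. \<forall>t\<ge>t1.
           integrable (Pr x) (\<lambda>\<omega>. f (X t \<omega>)) \<and>
           ereal \<bar>(\<integral>\<omega>. f (X t \<omega>) \<partial>Pr x) - (\<integral>y. f y \<partial>\<pi>)\<bar>
             \<le> ereal (b0 * \<rho>0 ^ t) * wnorm1 (\<lambda>x. v x powr \<eta>) f * ereal (v x powr \<eta>) \<and>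
           (\<forall>i. has_partial i (\<lambda>z. \<integral>\<omega>. f (X t \<omega>) \<partial>Pr z) x \<and>
              ereal \<bar>partial i (\<lambda>z. \<integral>\<omega>. f (X t \<omega>) \<partial>Pr z) x\<bar>
                \<le> ereal (b0 * \<rho>0 ^ t) * wnorm1 (\<lambda>x. v x powr \<eta>) f * ereal (v x powr \<eta>))))"
proof -
  interpret C: noise_chain Pr a N X
    by (rule noise_chain.intro[OF model]) (use A1 in \<open>unfold assumption_A1_def, blast\<close>)
  interpret M: prob_space "Pr 0" by (rule C.prob_space_Pr)
  define F where "F t x \<omega> = flow a (\<lambda>s. N s \<omega>) t x" for t x \<omega>
  have F_meas1: "F t x \<in> borel_measurable (Pr y)" for t x y
    unfolding F_def[abs_def] by (rule C.F_measurable1)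
  have law: "Pt Pr X t x = distr (Pr 0) borel (F t x)" for t x
    unfolding C.law_X F_def[abs_def] ..

  obtain L where L: "\<And>x n. norm (grad_fst a x n) \<le> L"
    using A1 unfolding assumption_A1_def bdd_above_def by auto
  have L0: "0 \<le> L" using L norm_ge_zero order_trans by blast
  have a_C1: "C1_bound (real CARD('l) * L) (\<lambda>x. a x n)" for n
  proof (rule C1_boundI_partials)
    show "continuously_differentiable (\<lambda>x. a x n)" using A1 unfolding assumption_A1_def by blast
    show "norm (\<chi> j. partial i (\<lambda>z. a z n $ j) x) \<le> L" for i x
      \<comment> \<open>The vector in question is row \<open>i\<close> of
        \<open>grad_fst a x n\<close>, and a row is bounded by the norm of the whole matrix.\<close>
      using order_trans[OF Finite_Cartesian_Product.norm_nth_le[of "grad_fst a x n" i] L] by (simp add: grad_fst_def)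
  qed

  obtain t0 p where t0: "1 \<le> t0" and p: "continuously_differentiable p"
    and dens: "\<And>x A. A \<in> sets borel \<Longrightarrow> measure (Pt Pr X t0 x) A = (LINT y:A|lborel. p (x, y))"
    using A2 unfolding assumption_A2_def by blast
  have density: "0 \<le> p (x, y)" "distr (Pr 0) borel (F t0 x) = density lborel (\<lambda>y. ennreal (p (x, y)))" for x y
  proof -
    have prob: "prob_space (distr (Pr 0) borel (F t0 x))" by (rule M.prob_space_distr[OF F_meas1])
    have cont: "continuous_on UNIV (\<lambda>y. p (x, y))"
      by (rule continuous_on_compose2[OF continuously_differentiable_continuous[OF p]])
         (auto intro!: continuous_intros)
    show "0 \<le> p (x, y)" "distr (Pr 0) borel (F t0 x) = density lborel (\<lambda>y. ennreal (p (x, y)))"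
      using continuous_density[OF prob _ cont dens[of _ x, unfolded law]] by simp_all
  qed

  obtain x0 where x0: "\<And>x U. open U \<Longrightarrow> x0 \<in> U \<Longrightarrow> \<forall>\<^sub>F t in sequentially. measure (Pt Pr X t x) U > 0"
    using A3 unfolding assumption_A3_def by blast

  obtain W C \<delta> b where Vpos: "\<And>x. 0 < V x" and V: "continuously_differentiable V"
    and W: "continuously_differentiable W" and W1: "\<And>x. 1 \<le> W x"
    and Vc: "\<And>r. 0 \<le> r \<Longrightarrow> compact {x. V x \<le> r}" and Wc: "\<And>r. 0 \<le> r \<Longrightarrow> compact {x. W x \<le> r}"
    and \<delta>: "0 < \<delta>" and dv: "DV3 Pr X V W C \<delta> b"
    using A4 unfolding assumption_A4_def by blast
  note [continuous_intros] = continuously_differentiable_continuous[OF V] continuously_differentiable_continuous[OF W]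
  define w where "w x = exp (\<eta> * V x)" for x
  \<comment> \<open>The factor gained from (DV3) after raising to the power \<open>\<eta>\<close>;
    compact sublevel sets of \<open>W\<close> make it vanish at infinity.\<close>
  define \<kappa> where "\<kappa> x = exp (- (\<eta> * \<delta> * W x))" for x
  define B where "B = exp (\<eta> * max b 0)"
  have V_borel: "V \<in> borel_measurable borel"
    by (rule borel_measurable_continuous_onI) (rule continuous_intros)
  have w_eq: "(\<lambda>x. v x powr \<eta>) = w" by (simp add: v w_def powr_def fun_eq_iff)

  interpret S: smooth_markov_flow "Pr 0" F "real CARD('l) * L" B w \<kappa> t0 p x0 \<pi>
  proof (intro smooth_markov_flow.intro smooth_markov_flow_axioms.intro)
    show "prob_space (Pr 0)" by (rule C.prob_space_Pr)
    show "(\<lambda>(x, \<omega>). F t x \<omega>) \<in> borel_measurable (borel \<Otimes>\<^sub>M Pr 0)" for t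
      unfolding F_def by (rule C.F_measurable)
    show "F 0 x \<omega> = x" for x \<omega> by (simp add: F_def)
    show "C1_bound ((real CARD('l) * L) ^ t) (\<lambda>x. F t x \<omega>)" for t \<omega>
      unfolding F_def by (rule flow_C1_bound[of _ a, OF a_C1])
    show "0 \<le> real CARD('l) * L" using L0 by simp
    show "(\<integral>\<^sup>+\<omega>. f (F (s + t) x \<omega>) \<partial>Pr 0) = (\<integral>\<^sup>+\<omega>. (\<integral>\<^sup>+\<omega>'. f (F t (F s x \<omega>) \<omega>') \<partial>Pr 0) \<partial>Pr 0)"
      if "f \<in> borel_measurable borel" for f :: "real^'l \<Rightarrow> ennreal" and s t x
      unfolding F_def by (rule C.markov[OF that])
    show "1 \<le> w x" for x using Vpos[of x] eta by (simp add: w_def)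
    show "continuous_on UNIV w" unfolding w_def[abs_def] by (intro continuous_intros)
    show "compact {x. w x \<le> r}" for r
      unfolding w_def by (rule compact_exp_sublevel[OF Vc Vpos eta(1)])
    show "continuous_on UNIV \<kappa>" unfolding \<kappa>_def[abs_def] by (intro continuous_intros)
    show "0 \<le> \<kappa> x" "\<kappa> x \<le> 1" for x
      using \<delta> eta order_trans[OF zero_le_one W1[of x]] by (auto simp: \<kappa>_def)
    show "\<exists>r. \<forall>x. r < norm x \<longrightarrow> \<kappa> x \<le> e" if "0 < e" for e
      unfolding \<kappa>_def using \<delta> eta that by (intro exp_neg_small_at_infinity Wc) auto
    show "1 \<le> B" using eta by (simp add: B_def)
    show "(\<integral>\<^sup>+\<omega>. ennreal (w (F 1 x \<omega>)) \<partial>Pr 0) \<le> ennreal (B * (\<kappa> x * w x))" for x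
    proof -
      define Y where "Y \<omega> = exp (V (F 1 x \<omega>))" for \<omega>
      have exp_borel: "(\<lambda>y. exp (V y)) \<in> borel_measurable borel" using V_borel by measurable
      have Y1: "1 \<le> Y \<omega>" for \<omega> using Vpos[of "F 1 x \<omega>"] by (simp add: Y_def)
      have "integrable (Pt Pr X 1 x) (\<lambda>y. exp (V y))" using dv unfolding DV3_def by blast
      then have Y: "integrable (Pr 0) Y"
        unfolding law Y_def[abs_def] using integrable_distr_eq[OF F_meas1 exp_borel] by simp
      have eq: "Pt_op Pr X 1 (\<lambda>y. exp (V y)) x = (\<integral>\<omega>. Y \<omega> \<partial>Pr 0)"
        unfolding Pt_op_def law Y_def by (rule integral_distr[OF F_meas1 exp_borel])
      have "(\<integral>\<omega>. 1 \<partial>Pr 0) \<le> (\<integral>\<omega>. Y \<omega> \<partial>Pr 0)" using Y Y1 by (intro integral_mono) auto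
      then have pos: "0 < (\<integral>\<omega>. Y \<omega> \<partial>Pr 0)" by (simp add: M.prob_space)
      have "(\<integral>\<^sup>+\<omega>. ennreal (w (F 1 x \<omega>)) \<partial>Pr 0) = (\<integral>\<^sup>+\<omega>. ennreal (Y \<omega> powr \<eta>) \<partial>Pr 0)"
        by (simp add: w_def Y_def powr_def)
      also have "\<dots> \<le> ennreal ((\<integral>\<omega>. Y \<omega> \<partial>Pr 0) powr \<eta>)"
        by (rule M.expectation_powr_le[OF Y Y1 eta])
      also have "\<dots> \<le> ennreal (B * (\<kappa> x * w x))"
        unfolding B_def \<kappa>_def w_def
      proof (intro ennreal_leI powr_drift_le[OF pos _ _ _ eta(1), of _ _ _ _ "indicator C x"])
        show "ln (\<integral>\<omega>. Y \<omega> \<partial>Pr 0) - V x \<le> - \<delta> * W x + b * indicator C x"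
          using dv unfolding DV3_def eq[symmetric] by blast
      qed (auto simp: indicator_def)
      finally show ?thesis .
    qed
    show "1 \<le> t0" by (rule t0)
    show "continuously_differentiable p" by (rule p)
    show "0 \<le> p z" for z using density(1)[of "fst z" "snd z"] by simp
    show "distr (Pr 0) borel (F t0 x) = density lborel (\<lambda>y. ennreal (p (x, y)))" for x
      by (rule density)
    show "\<forall>\<^sub>F t in sequentially. 0 < measure (Pr 0) {\<omega> \<in> space (Pr 0). F t x \<omega> \<in> U}"
      if U: "open U" "x0 \<in> U" for x U
    proof -
      have "measure (Pt Pr X t x) U = measure (Pr 0) {\<omega> \<in> space (Pr 0). F t x \<omega> \<in> U}" for t
        unfolding law using U by (subst measure_distr[OF F_meas1]) (auto intro: arg_cong[where f="measure (Pr 0)"])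
      then show ?thesis using x0[OF U, of x] by simp
    qed
    show "prob_space \<pi>" "sets \<pi> = sets borel" using inv unfolding invariant_prob_def by blast+
    show "(\<integral>\<^sup>+x. f x \<partial>\<pi>) = (\<integral>\<^sup>+x. (\<integral>\<^sup>+\<omega>. f (F 1 x \<omega>) \<partial>Pr 0) \<partial>\<pi>)"
      if "f \<in> borel_measurable borel" for f :: "real^'l \<Rightarrow> ennreal"
      unfolding F_def by (rule C.invariant[OF inv that])
  qed

  have op: "Pt_op Pr X t f x = S.P t f x" "(\<integral>\<omega>. f (X t \<omega>) \<partial>Pr x) = S.P t f x"
    if "f \<in> borel_measurable borel" for t f x
  proof -
    show *: "Pt_op Pr X t f x = S.P t f x"
      unfolding Pt_op_def law S.P_def by (rule integral_distr[OF F_meas1 that])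
    show "(\<integral>\<omega>. f (X t \<omega>) \<partial>Pr x) = S.P t f x"
      unfolding *[symmetric] Pt_op_def Pt_def by (rule integral_distr[OF C.X_measurable that, symmetric])
  qed
  obtain b \<rho> t1 where b: "0 \<le> b" and \<rho>: "0 < \<rho>" "\<rho> < 1" and main:
    "\<forall>c f t. C1_partials f \<longrightarrow> S.wbound c f \<longrightarrow> (\<forall>j z. \<bar>partial j f z\<bar> \<le> c * w z) \<longrightarrow> t1 \<le> t \<longrightarrow>
      C1_partials (S.P t f) \<and> (\<forall>x. \<bar>S.P t f x - (\<integral>y. f y \<partial>\<pi>)\<bar> \<le> b * \<rho> ^ t * c * w x) \<and>
      (\<forall>i x. \<bar>partial i (S.P t f) x\<bar> \<le> b * \<rho> ^ t * c * w x)"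
    using S.C1_geometric_ergodicity by blast
  have wpos: "0 < w x" for x by (simp add: w_def)

  \<comment> \<open>Membership is shown along with the norm bound, since \<open>wnorm1\<close> of an
    image is meaningful only when its partial derivatives exist.\<close>
  have ops: "Pt_centered Pr X \<pi> t f \<in> Linf1 w
      \<and> (wnorm1 w f = ereal c \<longrightarrow> wnorm1 w (Pt_centered Pr X \<pi> t f) \<le> ereal (b * \<rho> ^ t * c))"
    if f: "f \<in> Linf1 w" and t: "t1 \<le> t" for f t c
  proof -
    note fD = Linf1D[OF wpos f]
    obtain c' where c': "wnorm1 w f = ereal c'"
      "\<forall>x. \<bar>f x\<bar> \<le> c' * w x" "\<forall>i x. \<bar>partial i f x\<bar> \<le> c' * w x"
      using fD(3) by blast
    have "S.wbound c' f" using c' fD by (simp add: S.wbound_def)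
    then have m: "C1_partials (S.P t f)" "\<And>x. \<bar>S.P t f x - (\<integral>y. f y \<partial>\<pi>)\<bar> \<le> b * \<rho> ^ t * c' * w x"
      "\<And>i x. \<bar>partial i (S.P t f) x\<bar> \<le> b * \<rho> ^ t * c' * w x"
      using main fD(1) c' t by blast+
    have eq: "Pt_centered Pr X \<pi> t f = (\<lambda>x. - (\<integral>y. f y \<partial>\<pi>) + 1 * S.P t f x)"
      by (simp add: Pt_centered_def op(1)[OF fD(2)] fun_eq_iff)
    note aff = C1_partials_affine[OF m(1), where b="- (\<integral>y. f y \<partial>\<pi>)" and a=1, folded eq]
    have q1: "\<bar>Pt_centered Pr X \<pi> t f x\<bar> \<le> b * \<rho> ^ t * c' * w x" for x
      using m(2)[of x] by (simp add: eq)
    have q2: "\<bar>partial i (Pt_centered Pr X \<pi> t f) x\<bar> \<le> b * \<rho> ^ t * c' * w x" for i x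
      using m(3)[of i x] by (simp add: aff(2))
    have "Pt_centered Pr X \<pi> t f \<in> Linf1 w"
      "wnorm1 w (Pt_centered Pr X \<pi> t f) \<le> ereal (b * \<rho> ^ t * c')"
      by (rule Linf1I[of w, OF wpos aff(1) q1 q2])+
    then show ?thesis using c'(1) by auto
  qed
  have opnorm: "opnorm1 w (Pt_centered Pr X \<pi> t) \<le> ereal (b * \<rho> ^ t)" if t: "t1 \<le> t" for t
    unfolding opnorm1_def
  proof (rule SUP_least)
    fix f assume "f \<in> {f \<in> Linf1 w. wnorm1 w f \<noteq> 0}"
    then have f: "f \<in> Linf1 w" "wnorm1 w f \<noteq> 0" by auto
    obtain c where c: "wnorm1 w f = ereal c" "0 \<le> c" using Linf1D(3)[OF wpos f(1)] by blast
    \<comment> \<open>The supremum leaves out functions of norm 0, so the quotient is by a positive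
      real.\<close>
    have cpos: "0 < c" using f(2) c by auto
    obtain d where d: "wnorm1 w (Pt_centered Pr X \<pi> t f) = ereal d"
      using ops[OF f(1) t] Linf1D(3)[of w "Pt_centered Pr X \<pi> t f", OF wpos] by blast
    have "d \<le> b * \<rho> ^ t * c" using ops[OF f(1) t, of c] c d by simp
    then show "wnorm1 w (Pt_centered Pr X \<pi> t f) / wnorm1 w f \<le> ereal (b * \<rho> ^ t)"
      using cpos by (simp add: c d divide_le_eq)
  qed
  have point: "integrable \<pi> f \<and>
        (\<forall>x. \<forall>t\<ge>t1.
           integrable (Pr x) (\<lambda>\<omega>. f (X t \<omega>)) \<and>
           ereal \<bar>(\<integral>\<omega>. f (X t \<omega>) \<partial>Pr x) - (\<integral>y. f y \<partial>\<pi>)\<bar>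
             \<le> ereal (b * \<rho> ^ t) * wnorm1 w f * ereal (w x) \<and>
           (\<forall>i. has_partial i (\<lambda>z. \<integral>\<omega>. f (X t \<omega>) \<partial>Pr z) x \<and>
              ereal \<bar>partial i (\<lambda>z. \<integral>\<omega>. f (X t \<omega>) \<partial>Pr z) x\<bar>
                \<le> ereal (b * \<rho> ^ t) * wnorm1 w f * ereal (w x)))"
    if f: "f \<in> Linf1 w" for f
  proof -
    note fD = Linf1D[OF wpos f]
    obtain c where c: "wnorm1 w f = ereal c"
      "\<forall>x. \<bar>f x\<bar> \<le> c * w x" "\<forall>i x. \<bar>partial i f x\<bar> \<le> c * w x"
      using fD(3) by blast
    have wb: "S.wbound c f" using c fD by (simp add: S.wbound_def)
    have "integrable (Pr x) (\<lambda>\<omega>. f (X t \<omega>))" for x t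
    proof -
      have "integrable (distr (Pr 0) borel (F t x)) f"
        using S.integrable_wbound[OF wb] by (subst integrable_distr_eq[OF F_meas1 fD(2)])
      then show ?thesis
        unfolding law[symmetric] Pt_def by (subst (asm) integrable_distr_eq[OF C.X_measurable fD(2)])
    qed
    moreover have m: "C1_partials (S.P t f)" "\<And>x. \<bar>S.P t f x - (\<integral>y. f y \<partial>\<pi>)\<bar> \<le> b * \<rho> ^ t * c * w x"
      "\<And>i x. \<bar>partial i (S.P t f) x\<bar> \<le> b * \<rho> ^ t * c * w x" if "t1 \<le> t" for t
      using main wb fD(1) c that by blast+
    moreover have "(\<lambda>z. \<integral>\<omega>. f (X t \<omega>) \<partial>Pr z) = S.P t f" for t
      by (simp add: op(2)[OF fD(2)] fun_eq_iff)
    ultimately show ?thesis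
      using S.integrable_invariant[OF wb] by (simp add: c(1) op(2)[OF fD(2)] C1_partials_def)
  qed
  show ?thesis
    unfolding w_eq
    using ops opnorm point \<rho> fun_cong[OF w_eq]
    by (intro exI[of _ b] exI[of _ t1] exI[of _ \<rho>] conjI ballI allI impI) auto
qed

end
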